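(* Every oriented tree with $n$ nodes ($n\ge 2$) and $k$ leaves is $(n+144k^2-280k+124)$-unavoidable.
   Context: A tournament is an orientation of a complete graph. A digraph $D$ is $m$-unavoidable if every tournament of order $m$ contains $D$ as a subdigraph. An oriented tree is an orientation of a tree; its vertices are called nodes. A leaf of an oriented tree is a vertex adjacent to at most one vertex. *)

theory Defs
  imports "Graph_Theory.Graph_Theory"
begin

text \<open>
  As in the library, a finite simple undirected graph is a symmetric loop-free digraph
  (\<^locale>\<open>pair_graph\<close>): an edge \<open>uv\<close> is the pair of arcs \<open>(u,v)\<close>, \<open>(v,u)\<close>.
\<close>

definition orientation :: "'a pair_pre_digraph \<Rightarrow> 'a pair_pre_digraph \<Rightarrow> bool" where
  "orientation D G \<longleftrightarrow>
     pverts D = pverts G \<and>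
     parcs D \<union> (parcs D)\<inverse> = parcs G \<and>
     parcs D \<inter> (parcs D)\<inverse> = {}"

text \<open>
  In the symmetric representation every edge gives a directed cycle of length 2, so the cycles
  of the undirected graph are the directed cycles of length at least 3. For this reason the
  library predicate \<^const>\<open>tree\<close>, which forbids all directed cycles, is not usable here; nor
  can it be applied to the oriented tree itself, where it would only forbid directed cycles.
\<close>

definition undirected_tree :: "'a pair_pre_digraph \<Rightarrow> bool" where
  "undirected_tree G \<longleftrightarrow>
     pair_graph G \<and>
     connected (with_proj G) \<and>
     (\<nexists>p. pre_digraph.cycle (with_proj G) p \<and> 3 \<le> length p)"

definition oriented_tree :: "'a pair_pre_digraph \<Rightarrow> bool" where
  "oriented_tree D \<longleftrightarrow> (\<exists>G. undirected_tree G \<and> orientation D G)"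

definition leaves :: "'a pair_pre_digraph \<Rightarrow> 'a set" where
  "leaves D = {v \<in> pverts D. card {u. (u, v) \<in> parcs D \<or> (v, u) \<in> parcs D} \<le> 1}"

definition tournament :: "nat \<Rightarrow> 'a pair_pre_digraph \<Rightarrow> bool" where
  "tournament m T \<longleftrightarrow> (\<exists>K. complete_digraph m (with_proj K) \<and> orientation T K)"

definition contains_subdigraph :: "'b pair_pre_digraph \<Rightarrow> 'a pair_pre_digraph \<Rightarrow> bool" where
  "contains_subdigraph T D \<longleftrightarrow>
     (\<exists>H. subgraph (with_proj H) (with_proj T) \<and> digraph_iso (with_proj D) (with_proj H))"

text \<open>
  A definition cannot quantify over types, so the vertex type of the tournaments is a parameter.
  It is to be left as a free type variable in theorems, hence arbitrary and unrelated to the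
  vertex type of \<open>D\<close>.
\<close>

definition unavoidable :: "'b itself \<Rightarrow> nat \<Rightarrow> 'a pair_pre_digraph \<Rightarrow> bool" where
  "unavoidable _ m D \<longleftrightarrow>
     (\<forall>T :: 'b pair_pre_digraph. tournament m T \<longrightarrow> contains_subdigraph T D)"

end

(*
The tournament is listed along a median order, one with as many forward arcs as possible. In every
interval of such an order the exchange inequality "med" holds, and it makes the order behave almost
like a transitive tournament: even after deleting a sparse set of positions there is a directed path
with two inner vertices from p to q (lemma link), and a directed path starting at z can be continued
greedily, losing only two positions per deleted one (lemma run).

The tree is decomposed into nodes (the vertices of degree other than 2) and paths between nodes.
Subtrees whose paths are short are embedded as clusters, paying 20 positions per vertex. Long paths
are put between two already embedded pieces at the cost of a constant number of positions: a
directed path by link and run, and a path that changes direction by a lemma on tournaments without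
any order (two_ended): an oriented path with at least two blocks can be found with its two ends in
prescribed sets X and Y, provided that X and Y exceed the first and last block lengths by 3. The
positions of nodes are fixed in advance in a sparse set F, and pieces tolerate the later deletion of
g further positions outside F, which leaves room for the links of the paths attached to them.

A tree with k leaves has at most 2k-2 nodes and hence at most 2k-3 paths between them, each losing
at most 300 positions, and at most 160 if it ends in a leaf; the nested deletions lose another
12 l (l-1) for l long paths.
*)
theory Submission imports Defs begin

section \<open>Median orders\<close>

text \<open>A bent path has to leave a node in a prescribed direction, but the position of that node
  may have no neighbours of that kind, and \<open>two_ended\<close> asks for whole sets of possible
  ends. Both problems are met by dummy leaves: a subtree is embedded together with extra leaves at
  the node, all pointing the right way, and afterwards their positions are released as end sets. The
  trees therefore grow during the recursion, and only the number of long paths decreases. At most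
  seven dummies are used at each end; a longer first block is first followed along a directed path,
  whose end then provides the set.

  The constants are decided by \<open>k = 3\<close>. There the bound allows 580 positions beyond
  \<open>n\<close>, whereas three long paths could lose \<open>3 * 300 + 12 * 3 * 2 = 972\<close>;
  the 140 saved for each path that ends in a leaf bring this down to 552. For \<open>k = 2\<close>
  the bound allows exactly 140; the tree is then a path, and no median order is needed.\<close>

definition rtour :: "('v \<Rightarrow> 'v \<Rightarrow> bool) \<Rightarrow> bool" where
  "rtour R \<longleftrightarrow> (\<forall>x y. x \<noteq> y \<longrightarrow> R x y = (\<not> R y x))"

text \<open>Moving \<open>B\<close> to the front of the interval \<open>{i..<j}\<close> of the order does not increase the number of forward arcs.\<close>

definition med :: "(int \<Rightarrow> int \<Rightarrow> bool) \<Rightarrow> int \<Rightarrow> int \<Rightarrow> bool" where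
  "med R lo hi \<longleftrightarrow> (\<forall>i j B. lo \<le> i \<and> i \<le> j \<and> j \<le> hi \<and> B \<subseteq> {i..<j} \<longrightarrow>
     (\<Sum>y\<in>B. card {x\<in>{i..<j} - B. x < y \<and> R y x}) \<le> (\<Sum>y\<in>B. card {x\<in>{i..<j} - B. x < y \<and> R x y}))"

lemma med_sub: "med R lo hi \<Longrightarrow> lo \<le> lo' \<Longrightarrow> hi' \<le> hi \<Longrightarrow> med R lo' hi'"
  unfolding med_def by (meson order_trans)

lemma card_eq_sum_of_bool: "finite A \<Longrightarrow> card {x\<in>A. P x} = (\<Sum>x\<in>A. of_bool (P x) :: nat)"
  by (simp add: Int_def conj_commute)

text \<open>This is the exchange that moves \<open>p\<close> behind \<open>{p<..t}\<close>,
  expressed as moving \<open>{p<..t}\<close> in front of \<open>p\<close>. Its counterpart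
  \<open>med_in\<close> moves the single vertex \<open>q\<close> to the front.\<close>

lemma med_out:
  assumes "med R lo hi" "lo \<le> p" "t < hi"
  shows "card {y\<in>{p<..t}. R y p} \<le> card {y\<in>{p<..t}. R p y}"
proof (cases "p \<le> t")
  case True
  have *: "{p..<t+1} - {p<..t} = {p}" using True by auto
  have sing: "{x\<in>{p}. Q x} = (if Q p then {p} else {})" for Q by auto
  have "(\<Sum>y\<in>{p<..t}. card {x\<in>{p..<t+1} - {p<..t}. x < y \<and> R y x})
     \<le> (\<Sum>y\<in>{p<..t}. card {x\<in>{p..<t+1} - {p<..t}. x < y \<and> R x y})"
    by (rule assms(1)[unfolded med_def, rule_format]) (use assms(2,3) True in auto)
  moreover have "(\<Sum>y\<in>{p<..t}. card {x\<in>{p..<t+1} - {p<..t}. x < y \<and> R y x}) = (\<Sum>y\<in>{p<..t}. of_bool (R y p))"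
    unfolding * sing by (rule sum.cong) auto
  moreover have "(\<Sum>y\<in>{p<..t}. card {x\<in>{p..<t+1} - {p<..t}. x < y \<and> R x y}) = (\<Sum>y\<in>{p<..t}. of_bool (R p y))"
    unfolding * sing by (rule sum.cong) auto
  ultimately show ?thesis by (simp only: card_eq_sum_of_bool finite_greaterThanAtMost_int)
qed auto

lemma med_in:
  assumes "med R lo hi" "lo \<le> t" "q < hi"
  shows "card {x\<in>{t..<q}. R q x} \<le> card {x\<in>{t..<q}. R x q}"
proof (cases "t \<le> q")
  case True
  have *: "{x \<in> {t..<q + 1} - {q}. x < q \<and> P x} = {x\<in>{t..<q}. P x}" for P by auto
  have "(\<Sum>y\<in>{q}. card {x\<in>{t..<q+1} - {q}. x < y \<and> R y x}) \<le> (\<Sum>y\<in>{q}. card {x\<in>{t..<q+1} - {q}. x < y \<and> R x y})"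
    by (rule assms(1)[unfolded med_def, rule_format]) (use assms(2,3) True in auto)
  then show ?thesis by (simp only: sum.insert sum.empty finite.emptyI empty_iff not_False_eq_True add_0_right *)
qed auto

lemma rtour_card:
  assumes "rtour R" "finite A" "p \<notin> A"
  shows "card {y\<in>A. R p y} + card {y\<in>A. R y p} = card A"
proof -
  have "R y p \<longleftrightarrow> \<not> R p y" if "y \<in> A" for y using assms that unfolding rtour_def by metis
  then have "{y\<in>A. R y p} = A - {y\<in>A. R p y}" by auto
  then show ?thesis using assms(2) by (simp add: card_Diff_subset card_mono)
qed

lemma med_out_half:
  assumes "rtour R" "med R lo hi" "lo \<le> p" "t < hi"
  shows "card {p<..t} \<le> 2 * card {y\<in>{p<..t}. R p y}"
  using med_out[OF assms(2-4)] rtour_card[OF assms(1), of "{p<..t}" p] by auto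

lemma med_in_half:
  assumes "rtour R" "med R lo hi" "lo \<le> t" "q < hi"
  shows "card {t..<q} \<le> 2 * card {y\<in>{t..<q}. R y q}"
  using med_in[OF assms(2-4)] rtour_card[OF assms(1), of "{t..<q}" q] by auto

text \<open>The ranks of the elements are 0, 1, ..., \<open>card U - 1\<close>; the factor 2 avoids
  a division.\<close>

lemma sum_rank:
  fixes U :: "'v::linorder set"
  assumes "finite U"
  shows "2 * (\<Sum>u\<in>U. card {x\<in>U. x < u}) = card U * (card U - 1)"
  using assms
proof (induction U rule: finite_linorder_max_induct)
  case (insert b A)
  have "(\<Sum>u\<in>insert b A. card {x\<in>insert b A. x < u}) = card {x\<in>insert b A. x < b} + (\<Sum>u\<in>A. card {x\<in>insert b A. x < u})"
    using insert by (subst sum.insert) auto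
  also have "{x\<in>insert b A. x < b} = A" using insert by auto
  also have "(\<Sum>u\<in>A. card {x\<in>insert b A. x < u}) = (\<Sum>u\<in>A. card {x\<in>A. x < u})"
    using insert by (intro sum.cong arg_cong[where f=card]) auto
  moreover have "card (insert b A) = card A + 1" using insert by auto
  ultimately show ?case using insert.IH by (cases "card A") (simp_all add: add_mult_distrib2)
qed simp

text \<open>If no such path exists, every vertex of \<open>U' = N\<^sup>-(q)\<close> dominates every other vertex of \<open>U = N\<^sup>+(p)\<close>; the exchange inequality for \<open>U'\<close> then makes \<open>U'\<close> too small to contain half of the interval.\<close>

lemma link:
  assumes R: "rtour R" and m: "med R lo hi" and lo: "lo \<le> p" "p < q" "q < hi"
    and N: "10 * int (card (F \<inter> {p<..<q})) + 11 \<le> q - p - 1"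
  shows "\<exists>u v. u \<noteq> v \<and> u \<in> {p<..<q} - F \<and> v \<in> {p<..<q} - F \<and> R p u \<and> R u v \<and> R v q"
proof (rule ccontr)
  assume neg: "\<not> ?thesis"
  let ?W = "{p<..<q}"
  define f where "f = card (F \<inter> ?W)"
  define U where "U = {w\<in>?W - F. R p w}"
  define U' where "U' = {w\<in>?W - F. R w q}"
  define Dd where "Dd = U - U'"
  define O' where "O' = ?W - U' - Dd"
  have fin: "finite U" "finite U'" "finite Dd" "finite O'" by (auto simp: U_def U'_def Dd_def O'_def intro: finite_subset[of _ ?W])
  have rev: "R v u" if "u \<in> U" "v \<in> U'" "u \<noteq> v" for u v
    using neg that R unfolding U_def U'_def rtour_def by blast
  have le1: "card (U \<inter> U') \<le> 1"
  proof (rule ccontr)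
    assume "\<not> ?thesis"
    then obtain a b where "a \<in> U \<inter> U'" "b \<in> U \<inter> U'" "a \<noteq> b"
      by (metis card_le_Suc0_iff_eq fin(1) finite_Int One_nat_def)
    then show False using rev[of a b] rev[of b a] R unfolding rtour_def by blast
  qed
  have sub: "U' \<subseteq> {p+1..<q}" by (auto simp: U'_def)
  have "(\<Sum>y\<in>U'. card {x\<in>{p+1..<q} - U'. x < y \<and> R y x}) \<le> (\<Sum>y\<in>U'. card {x\<in>{p+1..<q} - U'. x < y \<and> R x y})"
    using m[unfolded med_def, rule_format, of "p+1" q U'] lo sub by auto
  moreover have "(\<Sum>y\<in>U'. card {x\<in>Dd. x < y}) \<le> (\<Sum>y\<in>U'. card {x\<in>{p+1..<q} - U'. x < y \<and> R y x})"
  proof (intro sum_mono card_mono)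
    fix y assume y: "y \<in> U'"
    show "finite {x \<in> {p + 1..<q} - U'. x < y \<and> R y x}" by (rule finite_subset[of _ "{p+1..<q}"]) auto
    show "{x \<in> Dd. x < y} \<subseteq> {x \<in> {p + 1..<q} - U'. x < y \<and> R y x}"
    proof
      fix x assume x: "x \<in> {x \<in> Dd. x < y}"
      then have "R y x" using rev[OF _ y] unfolding Dd_def by blast
      then show "x \<in> {x \<in> {p + 1..<q} - U'. x < y \<and> R y x}" using x by (auto simp: Dd_def U_def)
    qed
  qed
  moreover have "(\<Sum>y\<in>U'. card {x\<in>{p+1..<q} - U'. x < y \<and> R x y}) \<le> (\<Sum>y\<in>U'. card {x\<in>O'. x < y})"
  proof (intro sum_mono card_mono)
    fix y assume y: "y \<in> U'"
    show "{x \<in> {p + 1..<q} - U'. x < y \<and> R x y} \<subseteq> {x \<in> O'. x < y}"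
    proof
      fix x assume x: "x \<in> {x \<in> {p + 1..<q} - U'. x < y \<and> R x y}"
      then have "x \<noteq> y" "R x y" by auto
      then have "x \<notin> U" using rev[OF _ y] R unfolding rtour_def by blast
      then show "x \<in> {x \<in> O'. x < y}" using x unfolding O'_def Dd_def by auto
    qed
  qed (rule finite_subset[of _ ?W], auto simp: O'_def)
  \<comment> \<open>In the exchange for \<open>U'\<close> on \<open>{p+1..<q}\<close> every vertex
    of \<open>Dd\<close> before some \<open>y\<close> in \<open>U'\<close> is dominated by
    \<open>y\<close> and counts as a gain, while losses can only come from
    \<open>O'\<close>.\<close>
  ultimately have main: "(\<Sum>y\<in>U'. card {x\<in>Dd. x < y}) \<le> (\<Sum>y\<in>U'. card {x\<in>O'. x < y})" by linarith
  \<comment> \<open>At least half of the positions between \<open>p\<close> and \<open>y\<close> are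
    out-neighbours of \<open>p\<close>. Up to one common vertex of \<open>U\<close> and
    \<open>U'\<close> and the \<open>f\<close> deleted positions they all lie in \<open>Dd\<close>,
    so before \<open>y\<close> the sets \<open>U'\<close> and \<open>O'\<close> can hardly outnumber
    \<open>Dd\<close>.\<close>
  have pre: "card {x\<in>U'. x < y} + card {x\<in>O'. x < y} \<le> card {x\<in>Dd. x < y} + 2 + 2 * f" if y: "y \<in> U'" for y
  proof -
    have yW: "p < y" "y < q" using y by (auto simp: U'_def)
    have h: "card {p<..y-1} \<le> 2 * card {x\<in>{p<..y-1}. R p x}" by (rule med_out_half[OF R m]) (use lo yW in auto)
    have "card {x\<in>{p<..y-1}. R p x} \<le> card ({x\<in>Dd. x < y} \<union> (U \<inter> U') \<union> (F \<inter> ?W))"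
    proof (rule card_mono)
      show "finite ({x \<in> Dd. x < y} \<union> U \<inter> U' \<union> F \<inter> ?W)" using fin by auto
    qed (use yW in \<open>auto simp: Dd_def U_def U'_def\<close>)
    also have "\<dots> \<le> card {x\<in>Dd. x < y} + 1 + f"
      using le1 card_Un_le[of "{x\<in>Dd. x < y}" "U \<inter> U'"] card_Un_le[of "{x\<in>Dd. x < y} \<union> (U \<inter> U')" "F \<inter> ?W"]
      unfolding f_def by linarith
    finally have a: "card {p<..y-1} \<le> 2 * (card {x\<in>Dd. x < y} + 1 + f)" by (rule order_trans[OF h mult_le_mono2])
    have e1: "{p<..y-1} = {x\<in>U'. x < y} \<union> {x\<in>O'. x < y} \<union> {x\<in>Dd. x < y}"
      using yW by (auto simp: U'_def U_def O'_def Dd_def)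
    have e2: "card ({x\<in>U'. x < y} \<union> {x\<in>O'. x < y} \<union> {x\<in>Dd. x < y}) = card {x\<in>U'. x < y} + card {x\<in>O'. x < y} + card {x\<in>Dd. x < y}"
    proof -
      have "{x\<in>U'. x < y} \<inter> {x\<in>O'. x < y} = {}" "({x\<in>U'. x < y} \<union> {x\<in>O'. x < y}) \<inter> {x\<in>Dd. x < y} = {}"
        by (auto simp: O'_def Dd_def)
      moreover have "finite {x\<in>U'. x < y}" "finite {x\<in>O'. x < y}" "finite {x\<in>Dd. x < y}" using fin by auto
      ultimately show ?thesis by (simp only: card_Un_disjoint finite_Un simp_thms)
    qed
    show ?thesis using a unfolding e1 e2 by (simp only: distrib_left)
  qed
  have "(\<Sum>y\<in>U'. card {x\<in>U'. x < y} + card {x\<in>O'. x < y}) \<le> (\<Sum>y\<in>U'. card {x\<in>Dd. x < y} + 2 + 2 * f)"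
    by (rule sum_mono) (rule pre)
  then have "(\<Sum>y\<in>U'. card {x\<in>U'. x < y}) \<le> card U' * (2 + 2 * f)"
    using main by (simp only: sum.distrib sum_constant distrib_left mult.assoc) simp
  then have "card U' * (card U' - 1) \<le> card U' * (4 + 4 * f)"
    using sum_rank[OF fin(2)] by (simp add: algebra_simps)
  \<comment> \<open>Summing \<open>pre\<close> over \<open>U'\<close> cancels \<open>O'\<close>
    against \<open>Dd\<close> by \<open>main\<close>, and the rank sum then bounds
    \<open>card U'\<close>. As \<open>U'\<close> and the deleted positions contain all in-neighbours
    of \<open>q\<close>, hence half of the interval, its length is at most
    \<open>2 * (5 * f + 5)\<close>. This is the origin of the density one in ten.\<close>
  then have U'5: "card U' \<le> 4 * f + 5" by (cases "card U' = 0") auto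
  have k: "card {p+1..<q} \<le> 2 * card {y\<in>{p+1..<q}. R y q}" by (rule med_in_half[OF R m]) (use lo in auto)
  have "card {y\<in>{p+1..<q}. R y q} \<le> card (U' \<union> (F \<inter> ?W))"
  proof (rule card_mono)
    show "finite (U' \<union> F \<inter> ?W)" using fin by auto
  qed (auto simp: U'_def)
  also have "\<dots> \<le> card U' + f" unfolding f_def by (rule card_Un_le)
  finally have "card {p+1..<q} \<le> 2 * (card U' + f)" by (rule order_trans[OF k mult_le_mono2])
  moreover have "x \<le> 2 * (u + f) \<Longrightarrow> u \<le> 4 * f + 5 \<Longrightarrow> x \<le> 10 * f + 10" for x u by arith
  ultimately have "card {p+1..<q} \<le> 10 * f + 10" using U'5 by blast
  moreover have "int (card {p+1..<q}) = q - p - 1" using lo by auto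
  ultimately show False using N unfolding f_def by linarith
qed

lemma card_split_int:
  fixes F :: "int set" assumes "z < y" "y < hi"
  shows "card (F \<inter> {z<..<hi}) = card (F \<inter> {z<..<y}) + of_bool (y \<in> F) + card (F \<inter> {y<..<hi})"
proof -
  have e: "F \<inter> {z<..<hi} = (F \<inter> {z<..<y}) \<union> (F \<inter> {y}) \<union> (F \<inter> {y<..<hi})" using assms by auto
  have "card (F \<inter> {z<..<hi}) = card (F \<inter> {z<..<y}) + card (F \<inter> {y}) + card (F \<inter> {y<..<hi})"
    unfolding e using assms
    by (subst card_Un_disjoint; (subst card_Un_disjoint)?; auto)
  then show ?thesis by auto
qed

text \<open>The path steps from \<open>z\<close> to its first out-neighbour \<open>y\<close> outside
  \<open>F\<close>. All out-neighbours before \<open>y\<close> are deleted, and they make up at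
  least half of the gap. So the gap is at most twice the number of deleted positions in it, and each
  deleted position is charged only once.\<close>

lemma run:
  assumes R: "rtour R" and m: "med R lo hi"
  shows "lo \<le> z \<Longrightarrow> z < hi \<Longrightarrow> z \<notin> F \<Longrightarrow> 1 \<le> r \<Longrightarrow> int r + 2 * int (card (F \<inter> {z<..<hi})) \<le> hi - z \<Longrightarrow>
    \<exists>zs. length zs = r \<and> hd zs = z \<and> sorted_wrt (<) zs \<and> set zs \<subseteq> {z..<hi} - F \<and> successively R zs
      \<and> last zs \<le> z + int r - 1 + 2 * int (card (F \<inter> {z<..<hi}))"
proof (induction r arbitrary: z)
  case (Suc r)
  show ?case
  proof (cases "r = 0")
    case True
    then show ?thesis using Suc.prems by (intro exI[of _ "[z]"]) auto
  next
    case False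
    define Q where "Q = {y\<in>{z<..<hi} - F. R z y}"
    have "Q \<noteq> {}"
    proof
      assume "Q = {}"
      then have "{y\<in>{z<..hi-1}. R z y} \<subseteq> F \<inter> {z<..<hi}" by (auto simp: Q_def)
      then have "card {y\<in>{z<..hi-1}. R z y} \<le> card (F \<inter> {z<..<hi})" by (intro card_mono) auto
      moreover have "card {z<..hi-1} \<le> 2 * card {y\<in>{z<..hi-1}. R z y}"
        by (rule med_out_half[OF R m]) (use Suc.prems in auto)
      moreover have "int (card {z<..hi-1}) = hi - 1 - z" using Suc.prems by auto
      ultimately show False using Suc.prems False by linarith
    qed
    define y where "y = Min Q"
    have fQ: "finite Q" by (rule finite_subset[of _ "{z<..<hi}"]) (auto simp: Q_def)
    have yQ: "y \<in> Q" using \<open>Q \<noteq> {}\<close> fQ by (simp add: y_def)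
    have ymin: "y \<le> x" if "x \<in> Q" for x using that fQ by (simp add: y_def)
    have y: "z < y" "y < hi" "y \<notin> F" "R z y" using yQ by (auto simp: Q_def)
    have "{x\<in>{z<..y-1}. R z x} \<subseteq> F \<inter> {z<..<y}"
    proof
      fix x assume x: "x \<in> {x\<in>{z<..y-1}. R z x}"
      then have "x \<notin> Q" using ymin[of x] by auto
      then show "x \<in> F \<inter> {z<..<y}" using x y by (auto simp: Q_def)
    qed
    then have "card {x\<in>{z<..y-1}. R z x} \<le> card (F \<inter> {z<..<y})" by (intro card_mono) auto
    moreover have "card {z<..y-1} \<le> 2 * card {x\<in>{z<..y-1}. R z x}"
      by (rule med_out_half[OF R m]) (use Suc.prems y in auto)
    moreover have "int (card {z<..y-1}) = y - 1 - z" using y by auto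
    ultimately have gap: "y - z \<le> 1 + 2 * int (card (F \<inter> {z<..<y}))" by linarith
    have sp: "card (F \<inter> {z<..<hi}) = card (F \<inter> {z<..<y}) + card (F \<inter> {y<..<hi})"
      using card_split_int[OF y(1,2), of F] y(3) by simp
    have "\<exists>zs. length zs = r \<and> hd zs = y \<and> sorted_wrt (<) zs \<and> set zs \<subseteq> {y..<hi} - F \<and> successively R zs
      \<and> last zs \<le> y + int r - 1 + 2 * int (card (F \<inter> {y<..<hi}))"
      by (rule Suc.IH) (use Suc.prems y gap sp False in auto)
    then obtain zs where zs: "length zs = r" "hd zs = y" "sorted_wrt (<) zs" "set zs \<subseteq> {y..<hi} - F" "successively R zs"
      "last zs \<le> y + int r - 1 + 2 * int (card (F \<inter> {y<..<hi}))" by blast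
    have ne: "zs \<noteq> []" using zs False by auto
    show ?thesis
      using zs ne y gap sp Suc.prems
      by (intro exI[of _ "z # zs"]) (auto simp: successively_Cons)
  qed
qed simp

section \<open>Oriented paths with ends in prescribed sets\<close>

fun walk :: "('v \<Rightarrow> 'v \<Rightarrow> bool) \<Rightarrow> bool list \<Rightarrow> 'v list \<Rightarrow> bool" where
  "walk R [] [y] = True"
| "walk R (d # ds) (y # y' # ys) = ((if d then R y y' else R y' y) \<and> walk R ds (y' # ys))"
| "walk R _ _ = False"

lemma walk_length: "walk R ds ys \<Longrightarrow> length ys = Suc (length ds)"
  by (induction R ds ys rule: walk.induct) auto

lemma walk_nonempty: "walk R ds ys \<Longrightarrow> ys \<noteq> []"
  by (induction R ds ys rule: walk.induct) auto

lemma walk_join: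
  "walk R ds1 xs \<Longrightarrow> (if d then R (last xs) (hd ys) else R (hd ys) (last xs)) \<Longrightarrow> walk R ds2 ys
    \<Longrightarrow> walk R (ds1 @ d # ds2) (xs @ ys)"
proof (induction R ds1 xs rule: walk.induct)
  case (1 R y)
  then show ?case by (cases ys) auto
next
  case (2 R a ds y y' zs)
  have l: "last (y # y' # zs) = last (y' # zs)" by simp
  have "walk R (ds @ d # ds2) ((y' # zs) @ ys)"
    using 2 unfolding l by (simp only: walk.simps)
  then show ?case using 2(2) by simp
qed auto

lemma walk_True: "walk R (replicate n True) xs \<longleftrightarrow> length xs = Suc n \<and> successively R xs"
proof (induction n arbitrary: xs)
  case 0
  then show ?case by (cases "(R, [] :: bool list, xs)" rule: walk.cases) auto
next
  case (Suc n)
  show ?case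
  proof (cases "(R, replicate (Suc n) True, xs)" rule: walk.cases)
    case (2 R' d ds y y' ys)
    then show ?thesis using Suc[of "y' # ys"] by auto
  qed auto
qed

lemma walk_conv: "walk (\<lambda>x y. R y x) (map Not ds) ys = walk R ds ys"
  by (induction R ds ys rule: walk.induct) auto

lemma walk_rev: "walk R ds ys \<Longrightarrow> walk R (rev (map Not ds)) (rev ys)"
proof (induction R ds ys rule: walk.induct)
  case (2 R d ds y y' ys)
  then show ?case using walk_join[of R "rev (map Not ds)" "rev ys @ [y']" "\<not> d" "[y]" "[]"] by auto
qed auto

lemma walk_False: "walk R (replicate n False) (rev xs) \<longleftrightarrow> length xs = Suc n \<and> successively R xs"
proof -
  have "walk R (replicate n False) (rev xs) \<longleftrightarrow> walk R (replicate n True) xs"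
    using walk_rev[of R "replicate n False" "rev xs"] walk_rev[of R "replicate n True" xs] by auto
  then show ?thesis by (simp add: walk_True)
qed

fun pat :: "bool \<Rightarrow> nat list \<Rightarrow> bool list" where
  "pat d [] = []"
| "pat d (b # bs) = replicate b d @ pat (\<not> d) bs"

lemma length_pat [simp]: "length (pat d bs) = sum_list bs"
  by (induction d bs rule: pat.induct) auto

lemma pat_Not: "map Not (pat d bs) = pat (\<not> d) bs"
  by (induction d bs rule: pat.induct) auto

lemma pat_snoc: "pat d (bs @ [b]) = pat d bs @ replicate b (if even (length bs) then d else \<not> d)"
  by (induction d bs rule: pat.induct) auto

lemma pat_rev: "rev (map Not (pat d bs)) = pat (if even (length bs) then d else \<not> d) (rev bs)"
  by (induction d bs rule: pat.induct) (auto simp: pat_snoc)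

lemma ex_pat: "\<exists>d bs. ds = pat d bs \<and> (\<forall>b\<in>set bs. 0 < b) \<and> (ds \<noteq> [] \<longrightarrow> d = hd ds)"
proof (induction ds)
  case Nil
  then show ?case by (intro exI[of _ True] exI[of _ "[]"]) auto
next
  case (Cons a ds)
  then obtain d bs where *: "ds = pat d bs" "\<forall>b\<in>set bs. 0 < b" "ds \<noteq> [] \<longrightarrow> d = hd ds" by blast
  show ?case
  proof (cases "bs \<noteq> [] \<and> a = d")
    case True
    then obtain b bs' where b: "bs = b # bs'" by (cases bs) auto
    have "a # ds = pat a (Suc b # bs')" using True *(1) by (simp add: b)
    then show ?thesis using *(2) unfolding b by (metis list.sel(1) set_ConsD list.set_intros(2) zero_less_Suc)
  next
    case False
    have "a # ds = pat a (1 # bs)"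
    proof (cases bs)
      case Nil
      then show ?thesis using *(1) by simp
    next
      case (Cons b bs')
      then have "d = (\<not> a)" using False by auto
      then show ?thesis using *(1) by simp
    qed
    then show ?thesis using *(2) by (metis less_one list.sel(1) set_ConsD zero_less_one)
  qed
qed

text \<open>Redei's theorem. The new vertex \<open>v\<close> is inserted behind the longest initial
  segment of vertices that dominate it; the next vertex is then dominated by
  \<open>v\<close>.\<close>

lemma ham_path:
  assumes "rtour R" "finite V"
  shows "\<exists>xs. set xs = V \<and> distinct xs \<and> successively R xs"
  using assms(2)
proof (induction V)
  case empty
  then show ?case by (intro exI[of _ "[]"]) auto
next
  case (insert v V)
  then obtain xs where xs: "set xs = V" "distinct xs" "successively R xs" by blast
  define as bs where "as = takeWhile (\<lambda>x. R x v) xs" and "bs = dropWhile (\<lambda>x. R x v) xs"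
  have xs_eq: "xs = as @ bs" by (simp add: as_def bs_def)
  have as: "\<forall>x\<in>set as. R x v" unfolding as_def by (meson set_takeWhileD)
  have bs: "bs \<noteq> [] \<Longrightarrow> R v (hd bs)"
    using hd_dropWhile[of "\<lambda>x. R x v" xs] assms(1) insert.hyps xs(1) xs_eq hd_in_set[of bs]
    unfolding bs_def rtour_def by (metis Un_iff bs_def set_append)
  show ?case using xs insert.hyps as bs unfolding xs_eq
    by (intro exI[of _ "as @ v # bs"]) (auto simp: successively_append_iff successively_Cons)
qed

lemma ham_sub:
  assumes "rtour R" "finite V" "n \<le> card V"
  shows "\<exists>xs. set xs \<subseteq> V \<and> distinct xs \<and> successively R xs \<and> length xs = n"
proof -
  obtain xs where xs: "set xs = V" "distinct xs" "successively R xs" using ham_path[OF assms(1,2)] by blast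
  have "successively R (take n xs @ drop n xs)" using xs(3) by simp
  then have "successively R (take n xs)" unfolding successively_append_iff by blast
  then show ?thesis using xs assms(3) set_take_subset[of n xs] distinct_card[OF xs(2)]
    by (intro exI[of _ "take n xs"]) auto
qed

lemma successively_tl: "successively R xs \<Longrightarrow> successively R (tl xs)"
  by (cases xs) (auto simp: successively_Cons)

lemma successively_take: "successively R xs \<Longrightarrow> successively R (take n xs)"
  by (metis append_take_drop_id successively_append_iff)

definition linked :: "('v \<Rightarrow> 'v \<Rightarrow> bool) \<Rightarrow> bool \<Rightarrow> nat list \<Rightarrow> 'v set \<Rightarrow> 'v set \<Rightarrow> 'v set \<Rightarrow> bool" where
  "linked R d bs V X Y \<longleftrightarrow>
     (\<exists>ys. walk R (pat d bs) ys \<and> distinct ys \<and> set ys \<subseteq> V \<and> hd ys \<in> X \<and> last ys \<in> Y)"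

lemma linkedI: "walk R (pat d bs) ys \<Longrightarrow> distinct ys \<Longrightarrow> set ys \<subseteq> V \<Longrightarrow> hd ys \<in> X \<Longrightarrow> last ys \<in> Y \<Longrightarrow> linked R d bs V X Y"
  unfolding linked_def by blast

text \<open>Reversing all arcs leaves only paths whose first block is forward to be treated;
  \<open>linked_rev\<close> transfers statements about the left end to the right end.\<close>

lemma linked_conv: "linked (\<lambda>x y. R y x) (\<not> d) bs V X Y \<Longrightarrow> linked R d bs V X Y"
  unfolding linked_def using walk_conv[of R "pat d bs"] by (auto simp: pat_Not)

lemma linked_rev: "linked R (if even (length bs) then d else \<not> d) (rev bs) V Y X \<Longrightarrow> linked R d bs V X Y"
proof -
  assume "linked R (if even (length bs) then d else \<not> d) (rev bs) V Y X"
  then obtain ys where ys: "walk R (pat (if even (length bs) then d else \<not> d) (rev bs)) ys" "distinct ys" "set ys \<subseteq> V" "hd ys \<in> Y" "last ys \<in> X"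
    unfolding linked_def by blast
  have "walk R (rev (map Not (rev (map Not (pat d bs))))) (rev ys)"
    by (rule walk_rev) (use ys(1) in \<open>simp only: pat_rev\<close>)
  then have "walk R (pat d bs) (rev ys)" by (simp add: rev_map o_def)
  then show ?thesis using ys walk_nonempty[OF ys(1)] by (intro linkedI[of _ _ _ "rev ys"]) (auto simp: hd_rev last_rev)
qed

lemma rtour_conv: "rtour R \<Longrightarrow> rtour (\<lambda>x y. R y x)"
  unfolding rtour_def by metis

lemma replicate_pred: "0 < n \<Longrightarrow> replicate n d @ zs = replicate (n - 1) d @ d # zs"
  by (cases n) (auto simp: replicate_app_Cons_same)

lemma replicate_pred': "0 < n \<Longrightarrow> replicate n d @ zs = d # replicate (n - 1) d @ zs"
  by (cases n) auto

text \<open>The Hamiltonian path chosen on each side already has as many arcs as its block. The arc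
  between their last vertices adds one arc to one of the two blocks, and the first vertex on that
  side is dropped.\<close>

lemma linked2:
  assumes R: "rtour R" and fin: "finite V" and b: "0 < b" "0 < b'"
    and XY: "X \<subseteq> V" "Y \<subseteq> V" "X \<inter> Y = {}" "b + 1 \<le> card X" "b' + 1 \<le> card Y"
  shows "linked R True [b, b'] V X Y"
proof -
  obtain xl where xl: "set xl \<subseteq> X" "distinct xl" "successively R xl" "length xl = b + 1"
    using ham_sub[OF R finite_subset[OF XY(1) fin] XY(4)] by blast
  obtain yl where yl: "set yl \<subseteq> Y" "distinct yl" "successively R yl" "length yl = b' + 1"
    using ham_sub[OF R finite_subset[OF XY(2) fin] XY(5)] by blast
  have ne: "xl \<noteq> []" "yl \<noteq> []" "tl xl \<noteq> []" "tl yl \<noteq> []" using xl yl b by (auto simp: neq_Nil_conv length_Suc_conv)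
  have sub: "set (tl xl) \<subseteq> X" "set (tl yl) \<subseteq> Y" using xl yl by (auto dest: list.set_sel(2)[rotated])
  have dj: "set xl \<inter> set yl = {}" using xl yl XY by auto
  show ?thesis
  proof (cases "R (last xl) (last yl)")
    case True
    have e: "pat True [b, b'] = replicate (b - 1) True @ True # replicate b' False"
      using b by (simp add: replicate_pred)
    have "walk R (pat True [b, b']) (tl xl @ rev yl)"
      unfolding e by (rule walk_join) (use xl yl b ne True in \<open>auto simp: walk_True walk_False successively_tl last_tl hd_rev\<close>)
    then show ?thesis using xl yl XY ne sub dj
      by (intro linkedI[of _ _ _ "tl xl @ rev yl"]) (auto simp: distinct_tl last_rev dest: list.set_sel(2)[rotated] hd_in_set)
  next
    case False
    then have F: "R (last yl) (last xl)"
      using R ne last_in_set[of xl] last_in_set[of yl] dj unfolding rtour_def by (metis disjoint_iff)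
    have e: "pat True [b, b'] = replicate b True @ False # replicate (b' - 1) False"
      using b replicate_pred'[of b' False "[]"] by simp
    have "walk R (pat True [b, b']) (xl @ rev (tl yl))"
      unfolding e by (rule walk_join) (use xl yl b ne F in \<open>auto simp: walk_True walk_False successively_tl last_tl hd_rev\<close>)
    then show ?thesis using xl yl XY ne sub dj
      by (intro linkedI[of _ _ _ "xl @ rev (tl yl)"]) (auto simp: distinct_tl last_rev dest: list.set_sel(2)[rotated] hd_in_set)
  qed
qed

lemma successively_Cons2: "successively R (x # y # zs) \<longleftrightarrow> R x y \<and> successively R (y # zs)" by simp

text \<open>No arc can be assumed to have a convenient direction: an undecided arc is given to
  whichever adjacent block it fits, and a spare vertex is dropped or kept to correct the block
  lengths.\<close>

lemma linked3:
  assumes R: "rtour R" and fin: "finite V" and b: "0 < b" "0 < b2" "0 < b'"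
    and XY: "X \<subseteq> V" "Y \<subseteq> V" "X \<inter> Y = {}" "b + 1 \<le> card X" "b' + 3 \<le> card Y"
    and V: "card X + card Y + b2 + 1 \<le> card V"
  shows "linked R True [b, b2, b'] V X Y"
proof -
  obtain xl where xl: "set xl \<subseteq> X" "distinct xl" "successively R xl" "length xl = b + 1"
    using ham_sub[OF R finite_subset[OF XY(1) fin] XY(4)] by blast
  obtain yl where yl: "set yl \<subseteq> Y" "distinct yl" "successively R yl" "length yl = b' + 3"
    using ham_sub[OF R finite_subset[OF XY(2) fin] XY(5)] by blast
  obtain y1 y2 y3 r where yl_eq: "yl = y1 # y2 # y3 # r"
    using yl(4) by (auto simp: numeral_3_eq_3 length_Suc_conv)
  have lr: "length r = b'" using yl(4) yl_eq by simp
  obtain b'' where b'': "b' = Suc b''" using b(3) by (cases b') auto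
  define q3 where "q3 = y3 # take b'' r"
  define q2 where "q2 = take b'' (y3 # r)"
  have sy: "R y1 y2" "R y2 y3" "successively R (y3 # r)" using yl(3) by (auto simp: yl_eq)
  have st: "successively R (y3 # take b'' r)" "successively R (y2 # q2)" "length q2 = b''" "set (take b'' r) \<subseteq> set r"
      "set q2 \<subseteq> insert y3 (set r)" "distinct q2" "distinct (take b'' r)"
    using successively_take[OF sy(3), of "Suc b''"] successively_take[of R "y2 # y3 # r" "Suc b''"] sy lr b'' yl(2)
      set_take_subset[of b'' r] set_take_subset[of b'' "y3 # r"] distinct_take[of "y3 # r" b''] distinct_take[of r b'']
    by (auto simp: q2_def yl_eq)
  \<comment> \<open>Either \<open>yb\<close> begins the last block itself, along \<open>q'\<close>,
    or the middle block ends with the arc from \<open>ya\<close> to \<open>yb\<close> and leaves the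
    last block to \<open>q\<close>. Both options are available whichever way the arc between
    \<open>y1\<close> and \<open>y3\<close> points; this is why \<open>Y\<close> has surplus
    3.\<close>
  have "\<exists>ya yb q q'. R ya yb \<and> successively R (ya # q) \<and> successively R (yb # q') \<and> length q = b' \<and> length q' = b'
    \<and> distinct (yb # ya # q) \<and> distinct (yb # q') \<and> set (yb # ya # q) \<subseteq> Y \<and> set (yb # q') \<subseteq> Y"
  proof (cases "R y1 y3")
    case True
    have "R y1 y2 \<and> successively R (y1 # q3) \<and> successively R (y2 # q3) \<and> length q3 = b' \<and> length q3 = b'
      \<and> distinct (y2 # y1 # q3) \<and> distinct (y2 # q3) \<and> set (y2 # y1 # q3) \<subseteq> Y \<and> set (y2 # q3) \<subseteq> Y"
      using True sy yl(1,2) lr b'' st unfolding yl_eq q3_def by (auto simp: successively_Cons2)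
    then show ?thesis by blast
  next
    case False
    then have "R y3 y1" using R yl(2) yl_eq unfolding rtour_def by auto
    then have "R y3 y1 \<and> successively R (y3 # r) \<and> successively R (y1 # y2 # q2) \<and> length r = b' \<and> length (y2 # q2) = b'
      \<and> distinct (y1 # y3 # r) \<and> distinct (y1 # y2 # q2) \<and> set (y1 # y3 # r) \<subseteq> Y \<and> set (y1 # y2 # q2) \<subseteq> Y"
      using sy yl(1,2) lr b'' st unfolding yl_eq by (auto simp: successively_Cons2)
    then show ?thesis by blast
  qed
  then obtain ya yb q q' where y: "R ya yb" "successively R (ya # q)" "successively R (yb # q')" "length q = b'" "length q' = b'"
    "distinct (yb # ya # q)" "distinct (yb # q')" "set (yb # ya # q) \<subseteq> Y" "set (yb # q') \<subseteq> Y" by blast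
  define x where "x = last xl"
  have ne: "xl \<noteq> []" "tl xl \<noteq> []" "q \<noteq> []" "q' \<noteq> []" using xl b y by (auto simp: neq_Nil_conv length_Suc_conv)
  have sub: "set (tl xl) \<subseteq> X" "distinct (tl xl)" "last (tl xl) = x" "hd (tl xl) \<in> X" "hd xl \<in> X"
  proof -
    show a: "set (tl xl) \<subseteq> X" using xl ne by (cases xl) auto
    show "hd (tl xl) \<in> X" "hd xl \<in> X" using a xl hd_in_set[OF ne(2)] hd_in_set[OF ne(1)] by blast+
  qed (use xl ne in \<open>simp_all add: x_def distinct_tl last_tl\<close>)
  have xX: "x \<in> X" using xl ne by (auto simp: x_def)
  have q: "set q \<subseteq> Y" "set q' \<subseteq> Y" "last q \<in> Y" "last q' \<in> Y" "ya \<in> Y" "yb \<in> Y"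
    using y ne last_in_set[OF ne(3)] last_in_set[OF ne(4)] by auto
  have XY': "set xl \<inter> Y = {}" "set (tl xl) \<inter> Y = {}" using xl sub XY by auto
  have xyb: "x \<noteq> yb" using xX q XY by auto
  have W: "walk R (replicate b True) xl" "walk R (replicate (b - 1) True) (tl xl)"
    "walk R (replicate b' True) (ya # q)" "walk R (replicate b' True) (yb # q')"
    using xl y b by (auto simp: walk_True successively_tl)
  show ?thesis
  proof (cases "b2 = 1")
    case True
    show ?thesis
    proof (cases "R yb x")
      case a: True
      have "walk R (replicate b True @ False # replicate b' True) (xl @ yb # q')"
        by (rule walk_join) (use W a in \<open>auto simp: x_def\<close>)
      then show ?thesis
        by (intro linkedI[of _ _ _ "xl @ yb # q'"]) (use True xl y sub q XY XY' ne in auto)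
    next
      case False
      then have a: "R x yb" using R xyb unfolding rtour_def by blast
      have "walk R (False # replicate b' True) (yb # ya # q)"
        using W y by simp
      then have "walk R (replicate (b - 1) True @ True # (False # replicate b' True)) (tl xl @ yb # ya # q)"
        by (rule walk_join[rotated 2]) (use W a sub in auto)
      then have "walk R (pat True [b, b2, b']) (tl xl @ yb # ya # q)"
        using True b by (simp add: replicate_pred)
      then show ?thesis
        by (rule linkedI) (use xl y sub q XY XY' ne in auto)
    qed
  next
    case b2: False
    \<comment> \<open>The middle block is now long enough to run through a directed path
      \<open>h\<close> outside \<open>X\<close> and \<open>Y\<close>, traversed against its
      arcs.\<close>
    define S where "S = V - X - Y"
    have "card S \<ge> b2 + 1"
      using V XY fin unfolding S_def Diff_eq
      by (subst card_Diff_subset[unfolded Diff_eq]; (subst card_Diff_subset[unfolded Diff_eq])?; auto simp: finite_subset)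
    then obtain h where h: "set h \<subseteq> S" "distinct h" "successively R h" "length h = b2 + 1"
      using ham_sub[OF R, of S "b2 + 1"] fin by (auto simp: S_def)
    have hV: "set h \<inter> X = {}" "set h \<inter> Y = {}" "set h \<subseteq> V" using h by (auto simp: S_def)
    \<comment> \<open>The middle block consists of \<open>hh\<close> reversed, the arc from
      \<open>yb\<close>, and one further arc: the arc into \<open>x\<close> if
      \<open>last hh\<close> dominates \<open>x\<close>, and otherwise the arc from
      \<open>ya\<close> to \<open>yb\<close>.\<close>
    have part: ?thesis if hh: "set hh \<subseteq> set h" "distinct hh" "successively R hh" "length hh = b2 - 1" "R yb (hd hh)" for hh
    proof -
      have hn: "hh \<noteq> []" using hh b2 b by auto
      then have hne: "hh \<noteq> []" "hd hh \<in> set hh" "last hh \<in> set hh" by simp_all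
      have hd_h: "set hh \<inter> set xl = {}" "set hh \<inter> set (tl xl) = {}" "set hh \<inter> Y = {}" "set hh \<subseteq> V"
        using hh hV sub xl by auto
      have wh: "walk R (replicate (b2 - 2) False) (rev hh)" using hh b2 b by (auto simp: walk_False)
      show ?thesis
      proof (cases "R x (last hh)")
        case True
        have "walk R (False # replicate b' True) (yb # ya # q)"
          using W y by simp
        then have "walk R (replicate (b2 - 2) False @ False # False # replicate b' True) (rev hh @ yb # ya # q)"
          by (rule walk_join[rotated 2]) (use wh hh hne in \<open>auto simp: last_rev\<close>)
        then have "walk R (replicate (b - 1) True @ True # (replicate (b2 - 2) False @ False # False # replicate b' True)) (tl xl @ rev hh @ yb # ya # q)"
          by (rule walk_join[rotated 2]) (use W sub True hne in \<open>auto simp: hd_rev\<close>)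
        moreover have "pat True [b, b2, b'] = replicate (b - 1) True @ True # (replicate (b2 - 2) False @ False # False # replicate b' True)"
          using b b2 by (simp add: replicate_pred numeral_2_eq_2)
        ultimately have "walk R (pat True [b, b2, b']) (tl xl @ rev hh @ yb # ya # q)" by (simp only:)
        then show ?thesis
          by (rule linkedI) (use xl y sub q XY XY' ne hh hd_h in auto)
      next
        case False
        have "x \<noteq> last hh" using hne(3) hh(1) xX hV(1) by blast
        with False have a: "R (last hh) x" using R unfolding rtour_def by metis
        have "walk R (replicate (b2 - 2) False @ False # replicate b' True) (rev hh @ yb # q')"
          by (rule walk_join) (use W wh hh hne in \<open>auto simp: last_rev\<close>)
        then have "walk R (replicate b True @ False # (replicate (b2 - 2) False @ False # replicate b' True)) (xl @ rev hh @ yb # q')"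
          by (rule walk_join[rotated 2]) (use W sub a hne in \<open>auto simp: hd_rev x_def\<close>)
        moreover have "pat True [b, b2, b'] = replicate b True @ False # (replicate (b2 - 2) False @ False # replicate b' True)"
          using b b2 by (simp add: replicate_pred[of _ False] replicate_pred'[of "b2 - 1"] numeral_2_eq_2 replicate_append_same replicate_app_Cons_same)
        ultimately have "walk R (pat True [b, b2, b']) (xl @ rev hh @ yb # q')" by (simp only:)
        then show ?thesis
          by (rule linkedI) (use xl y sub q XY XY' ne hh hd_h in auto)
      qed
    qed
    obtain h1 h2 t where h_eq: "h = h1 # h2 # t" using h(4) b(2) by (cases h; cases "tl h") auto
    have tne: "t \<noteq> []" using h(4) h_eq b2 b by auto
    define u where "u = last t"
    have uS: "u \<in> set h" using tne by (auto simp: h_eq u_def)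
    show ?thesis
    \<comment> \<open>If both \<open>h1\<close> and \<open>h2\<close> dominate \<open>yb\<close>,
      the last block begins with the arc from one of them. The vertex \<open>h1\<close> is left out
      when the arc between \<open>x\<close> and \<open>u\<close> belongs to the middle
      block.\<close>
    proof (cases "R h1 yb \<and> R h2 yb")
      case False
      have "yb \<noteq> h1" "yb \<noteq> h2" using q(6) hV(2) h_eq by auto
      with False consider "R yb h1" | "R yb h2" using R unfolding rtour_def by metis
      then show ?thesis
      proof cases
        case 1
        show ?thesis by (rule part[of "take (b2 - 1) h"])
          (use 1 h(2-4) b b2 in \<open>simp_all add: successively_take set_take_subset, simp add: h_eq\<close>)
      next
        case 2
        have "set (take (b2 - 1) (tl h)) \<subseteq> set h" using set_take_subset[of "b2 - 1" "tl h"] by (auto simp: h_eq)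
        then show ?thesis by (rule part)
          (use 2 h(2-4) b b2 in \<open>simp_all add: successively_take successively_tl distinct_tl, simp add: h_eq\<close>)
      qed
    next
      case True
      define q1 where "q1 = take (b' - 1) q'"
      have q1: "successively R (yb # q1)" "length q1 = b' - 1" "distinct (yb # q1)" "set q1 \<subseteq> Y" "last (yb # q1) \<in> Y"
      proof -
        have e: "yb # q1 = take b' (yb # q')" using b(3) by (cases b') (auto simp: q1_def)
        show "successively R (yb # q1)" unfolding e by (rule successively_take) (rule y)
        show "distinct (yb # q1)" unfolding e by (rule distinct_take) (rule y)
        show "length q1 = b' - 1" using y by (simp add: q1_def)
        show s: "set q1 \<subseteq> Y" using q by (auto simp: q1_def dest: in_set_takeD)
        show "last (yb # q1) \<in> Y" using s q last_in_set[of "yb # q1"] by auto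
      qed
      have Wq: "walk R (replicate (b' - 1) True) (yb # q1)" using q1 b by (auto simp: walk_True)
      show ?thesis
      proof (cases "R x u")
        case xu: True
        have "walk R (replicate b2 False) (rev h)" using h by (simp only: walk_False) simp
        then have "walk R (replicate b2 False @ True # replicate (b' - 1) True) (rev h @ yb # q1)"
          by (rule walk_join) (use Wq True in \<open>auto simp: last_rev h_eq\<close>)
        then have "walk R (replicate (b - 1) True @ True # (replicate b2 False @ True # replicate (b' - 1) True)) (tl xl @ rev h @ yb # q1)"
          by (rule walk_join[rotated 2]) (use W sub xu tne in \<open>auto simp: hd_rev u_def h_eq\<close>)
        moreover have "pat True [b, b2, b'] = replicate (b - 1) True @ True # (replicate b2 False @ True # replicate (b' - 1) True)"
          using b by (simp add: replicate_pred[of b] replicate_pred'[of b' True "[]", simplified])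
        ultimately have "walk R (pat True [b, b2, b']) (tl xl @ rev h @ yb # q1)" by (simp only:)
        then show ?thesis
          by (rule linkedI) (use xl y sub q XY XY' ne h hV q1 in auto)
      next
        case False
        have "x \<noteq> u" using uS xX hV(1) by blast
        with False have a: "R u x" using R unfolding rtour_def by metis
        have th: "set (h2 # t) \<inter> X = {}" "set (h2 # t) \<inter> Y = {}" "set (h2 # t) \<subseteq> V" "distinct (h2 # t)" "yb \<notin> set (h2 # t)"
          using hV h q h_eq by auto
        have "walk R (replicate (b2 - 1) False) (rev (h2 # t))"
          unfolding walk_False using h h_eq b by auto
        then have "walk R (replicate (b2 - 1) False @ True # replicate (b' - 1) True) (rev (h2 # t) @ yb # q1)"
          by (rule walk_join) (use Wq True in \<open>auto simp: last_rev\<close>)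
        then have "walk R (replicate b True @ False # (replicate (b2 - 1) False @ True # replicate (b' - 1) True)) (xl @ rev (h2 # t) @ yb # q1)"
          by (rule walk_join[rotated 2]) (use W sub a tne in \<open>auto simp: hd_rev u_def x_def hd_append\<close>)
        moreover have "pat True [b, b2, b'] = replicate b True @ False # (replicate (b2 - 1) False @ True # replicate (b' - 1) True)"
          using b by (simp add: replicate_pred'[of b2] replicate_pred'[of b' True "[]", simplified])
        ultimately have "walk R (pat True [b, b2, b']) (xl @ rev (h2 # t) @ yb # q1)" by (simp only:)
        then show ?thesis
          by (rule linkedI) (use xl y sub q XY XY' ne th q1 in auto)
      qed
    qed
  qed
qed

lemma obtain_subset_card:
  assumes "n \<le> card A" obtains B where "B \<subseteq> A" "card B = n"
  using assms by (metis obtain_subset_with_card_n)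

section \<open>Oriented paths with any number of blocks\<close>

definition link_cond :: "('v \<Rightarrow> 'v \<Rightarrow> bool) \<Rightarrow> nat list \<Rightarrow> 'v set \<Rightarrow> 'v set \<Rightarrow> 'v set \<Rightarrow> bool" where
  "link_cond R bs V X Y \<longleftrightarrow> rtour R \<and> finite V \<and> 2 \<le> length bs \<and> (\<forall>b\<in>set bs. 0 < b) \<and> X \<subseteq> V \<and> Y \<subseteq> V \<and> X \<inter> Y = {}
     \<and> hd bs + 3 \<le> card X \<and> last bs + 3 \<le> card Y \<and> sum_list bs + 11 \<le> card V"

lemma link_cond_conv: "link_cond R bs V X Y \<Longrightarrow> link_cond (\<lambda>x y. R y x) bs V X Y"
  unfolding link_cond_def using rtour_conv by blast

lemma link_cond_rev: "link_cond R bs V X Y \<Longrightarrow> link_cond R (rev bs) V Y X"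
  unfolding link_cond_def by (auto simp: hd_rev last_rev sum_list_rev)

lemma linked_prefix:
  assumes "linked R d' bs' V' X' Y" "walk R (replicate n True) xl" "distinct xl" "set xl \<inter> V' = {}" "set xl \<union> V' \<subseteq> V" "hd xl \<in> X"
    and "\<And>z. z \<in> X' \<Longrightarrow> if e then R (last xl) z else R z (last xl)"
    and "pat True bs = replicate n True @ e # pat d' bs'"
  shows "linked R True bs V X Y"
proof -
  obtain ys where ys: "walk R (pat d' bs') ys" "distinct ys" "set ys \<subseteq> V'" "hd ys \<in> X'" "last ys \<in> Y"
    using assms(1) unfolding linked_def by blast
  have "walk R (pat True bs) (xl @ ys)"
    unfolding assms(8) by (rule walk_join) (use assms ys in auto)
  moreover have "xl \<noteq> []" "ys \<noteq> []" using walk_nonempty assms(2) ys(1) by blast+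
  ultimately show ?thesis using assms ys by (intro linkedI[of _ _ _ "xl @ ys"]) auto
qed

text \<open>A maximal block at the left end can be peeled off at the last vertex \<open>x\<close> of a path in \<open>X\<close>, unless \<open>x\<close> has both few out-neighbours and few in-neighbours in the rest; by counting this can fail only if the second block is more than half of the inner blocks. It thus cannot fail at both ends.\<close>

lemma link_step_left:
  fixes R :: "'v \<Rightarrow> 'v \<Rightarrow> bool"
  assumes c: "link_cond R bs V X Y" and IH: "\<And>(R :: 'v \<Rightarrow> 'v \<Rightarrow> bool) d bs' V X Y. sum_list bs' < sum_list bs \<Longrightarrow> link_cond R bs' V X Y \<Longrightarrow> linked R d bs' V X Y"
    and len: "4 \<le> length bs" and neg: "\<not> linked R True bs V X Y"
  shows "sum_list (butlast (tl bs)) + 4 \<le> 2 * (bs ! 1)"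
proof -
  obtain b b2 b3 bs' where bs: "bs = b # b2 # b3 # bs'" and ne: "bs' \<noteq> []"
    using len by (cases bs; cases "tl bs"; cases "tl (tl bs)") (auto simp: Suc_le_eq)
  note c' = c[unfolded link_cond_def]
  have R: "rtour R" and fin: "finite V" using c' by auto
  have pos: "0 < b" "0 < b2" "0 < b3" "\<forall>x\<in>set bs'. 0 < x" using c' bs by auto
  define m where "m = sum_list (butlast (tl bs))"
  have m: "m = b2 + b3 + sum_list (butlast bs')" using ne by (simp add: m_def bs)
  have "sum_list bs' = sum_list (butlast bs') + last bs'"
    using ne by (metis append_butlast_last_id sum_list.Cons sum_list.Nil sum_list_append add.right_neutral)
  then have sm: "sum_list bs = b + m + last bs'" by (simp add: bs m)
  obtain xl where xl: "set xl \<subseteq> X" "distinct xl" "successively R xl" "length xl = b + 1"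
    using ham_sub[OF R, of X "b + 1"] c' bs finite_subset[of X V] by auto
  obtain Y0 where Y0: "Y0 \<subseteq> Y" "card Y0 = last bs' + 3"
    using c' ne bs by (auto intro: obtain_subset_card[of "last bs' + 3" Y])
  have x0: "xl \<noteq> []" "tl xl \<noteq> []" using xl pos by (auto simp: neq_Nil_conv length_Suc_conv)
  define x where "x = last xl"
  have txl: "set (tl xl) \<subseteq> set xl" "last (tl xl) = x" "hd (tl xl) \<in> X" "hd xl \<in> X" "distinct (tl xl)" "card (set (tl xl)) = b" "card (set xl) = b + 1"
  proof -
    show a: "set (tl xl) \<subseteq> set xl" using x0 by (cases xl) auto
    show "hd (tl xl) \<in> X" "hd xl \<in> X" using a xl hd_in_set[OF x0(1)] hd_in_set[OF x0(2)] by blast+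
    show "last (tl xl) = x" by (simp add: x_def last_tl x0)
    show d: "distinct (tl xl)" using xl by (simp add: distinct_tl)
    show "card (set (tl xl)) = b" using distinct_card[OF d] xl by simp
    show "card (set xl) = b + 1" using distinct_card[OF xl(2)] xl by simp
  qed
  define S where "S = V - set xl - Y0"
  have finY: "finite Y0" "Y0 \<subseteq> V" "set xl \<subseteq> V" "set xl \<inter> Y0 = {}" using Y0 c' fin xl by (auto intro: finite_subset)
  have cS: "card S = card V - (b + 1) - (last bs' + 3)"
    unfolding S_def using finY Y0 txl by (subst card_Diff_subset; (subst card_Diff_subset)?; auto)
  have cV: "b + m + last bs' + 11 \<le> card V" using c' sm by auto
  have xS: "x \<notin> S" using x0 by (simp add: S_def x_def)
  define A where "A = {z\<in>S. R x z}"
  define B where "B = {z\<in>S. R z x}"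
  have AB: "card A + card B = card S" unfolding A_def B_def by (rule rtour_card[OF R _ xS]) (simp add: S_def fin)
  have cardV1: "card (V - set (tl xl)) = card V - b" "card (V - set xl) = card V - (b + 1)"
    using finY txl by (subst card_Diff_subset; auto)+
  \<comment> \<open>Enough out-neighbours of \<open>x\<close> would serve as the left end set for
    the remaining blocks: the first block then ends with the arc out of \<open>x\<close>, so
    \<open>xl\<close> gives up its first vertex.\<close>
  have A: "card A < b2 + 3"
  proof (rule ccontr)
    assume "\<not> ?thesis"
    then have "link_cond R (b2 # b3 # bs') (V - set (tl xl)) A Y0"
      unfolding link_cond_def using R fin pos ne finY Y0 txl cardV1 cV sm bs by (auto simp: A_def S_def)
    then have "linked R False (b2 # b3 # bs') (V - set (tl xl)) A Y0"
      by (rule IH[rotated]) (use bs pos in auto)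
    then have "linked R True bs V X Y0"
      by (rule linked_prefix[of R False "b2 # b3 # bs'" _ A _ "b - 1" "tl xl" V X True])
        (use xl txl finY pos in \<open>auto simp: walk_True successively_tl A_def bs replicate_pred\<close>)
    then show False using neg Y0 unfolding linked_def by blast
  qed
  \<comment> \<open>With enough in-neighbours of \<open>x\<close> the arc into \<open>x\<close> is
    the first arc of the second block, which is shortened by one and disappears if it had only this
    arc.\<close>
  have B: "card B < (if b2 = 1 then b3 + 3 else b2 + 2)"
  proof (rule ccontr)
    assume large: "\<not> ?thesis"
    define bs2 where "bs2 = (if b2 = 1 then b3 # bs' else (b2 - 1) # b3 # bs')"
    define d2 where "d2 = (b2 = 1)"
    have "link_cond R bs2 (V - set xl) B Y0"
      unfolding link_cond_def bs2_def using R fin pos ne finY Y0 txl cardV1 cV sm bs large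
      by (cases bs') (auto simp: B_def S_def split: if_splits)
    then have "linked R d2 bs2 (V - set xl) B Y0"
      by (rule IH[rotated]) (use bs pos in \<open>auto simp: bs2_def\<close>)
    then have "linked R True bs V X Y0"
      by (rule linked_prefix[of R d2 bs2 _ B _ b xl V X False])
        (use xl txl finY pos in \<open>auto simp: walk_True B_def bs bs2_def d2_def replicate_pred' x_def\<close>)
    then show False using neg Y0 unfolding linked_def by blast
  qed
  \<comment> \<open>By \<open>cS\<close> and \<open>cV\<close> the set \<open>S\<close> has at least
    \<open>m + 7\<close> vertices. If \<open>b2 = 1\<close>, then \<open>A\<close> and
    \<open>B\<close> hold at most \<open>b3 + 5\<close> of them, which is impossible; otherwise they
    hold at most \<open>2 * b2 + 3\<close>.\<close>
  show ?thesis using A B AB cS cV m unfolding m_def[symmetric] bs by (auto split: if_splits)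
qed

text \<open>With at least four blocks the second and the last but one are different inner blocks,
  and they cannot both exceed half of the inner length. With three blocks they coincide, which is
  why that case has a lemma of its own.\<close>

lemma two_ended:
  assumes "link_cond R bs V X Y"
  shows "linked R d bs V X Y"
  using assms
proof (induction "sum_list bs" arbitrary: R d bs V X Y rule: less_induct)
  case less
  have IH: "\<And>(R :: 'a \<Rightarrow> 'a \<Rightarrow> bool) d bs' V X Y. sum_list bs' < sum_list bs \<Longrightarrow> link_cond R bs' V X Y \<Longrightarrow> linked R d bs' V X Y"
    using less.hyps by blast
  have short: "linked R True bs V X Y" if c: "link_cond R bs V X Y" "length bs < 4" for R :: "'a \<Rightarrow> 'a \<Rightarrow> bool"
  proof (cases "length bs = 2")
    case True
    then obtain b b' where bs: "bs = [b, b']" by (auto simp: length_Suc_conv numeral_2_eq_2)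
    show ?thesis unfolding bs by (rule linked2) (use c in \<open>auto simp: bs link_cond_def\<close>)
  next
    case False
    then obtain b b2 b' where bs: "bs = [b, b2, b']" using c
      by (auto simp: length_Suc_conv numeral_eq_Suc link_cond_def le_Suc_eq less_Suc_eq)
    obtain X0 where X0: "X0 \<subseteq> X" "card X0 = b + 3"
      using c bs by (auto simp: link_cond_def intro: obtain_subset_card[of "b + 3" X])
    obtain Y0 where Y0: "Y0 \<subseteq> Y" "card Y0 = b' + 3"
      using c bs by (auto simp: link_cond_def intro: obtain_subset_card[of "b' + 3" Y])
    have "linked R True [b, b2, b'] V X0 Y0"
      by (rule linked3) (use c X0 Y0 in \<open>auto simp: bs link_cond_def\<close>)
    then show ?thesis using X0 Y0 unfolding bs linked_def by blast
  qed
  show ?case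
  proof (rule ccontr)
    assume neg: "\<not> linked R d bs V X Y"
    have L: "sum_list (butlast (tl bs')) + 4 \<le> 2 * (bs' ! 1)"
      if c: "link_cond R bs' V X Y" "\<not> linked R d bs' V X Y" "4 \<le> length bs'" "sum_list bs' = sum_list bs"
      for R :: "'a \<Rightarrow> 'a \<Rightarrow> bool" and d bs' V X Y
    proof (cases d)
      case True
      show ?thesis by (rule link_step_left[OF c(1)]) (use IH c True in auto)
    next
      case False
      show ?thesis by (rule link_step_left[OF link_cond_conv[OF c(1)]]) (use linked_conv[of R d bs' V X Y] IH c False in auto)
    qed
    show False
    proof (cases "length bs < 4")
      case True
      then show False using short[OF less.prems] short[OF link_cond_conv[OF less.prems]] neg linked_conv[of R d bs V X Y]
        by (cases d) auto
    next
      case False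
      have l1: "sum_list (butlast (tl bs)) + 4 \<le> 2 * (bs ! 1)"
        by (rule L[OF less.prems neg]) (use False in auto)
      have l2: "sum_list (butlast (tl (rev bs))) + 4 \<le> 2 * (rev bs ! 1)"
        by (rule L[OF link_cond_rev[OF less.prems]]) (use False neg linked_rev[of R bs d V Y X] in \<open>auto simp: sum_list_rev\<close>)
      obtain b b2 cs b3 b' where bs: "bs = b # b2 # cs @ [b3, b']"
      proof -
        obtain b b2 t where t: "bs = b # b2 # t" "2 \<le> length t" using False by (cases bs; cases "tl bs") auto
        obtain b' b3 t' where "rev t = b' # b3 # t'" using t(2) by (cases "rev t"; cases "tl (rev t)") auto
        then have "t = rev t' @ [b3, b']" by (metis append.assoc append_Cons append_Nil rev.simps(2) rev_rev_ident)
        then show ?thesis using t that by blast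
      qed
      have "butlast (tl bs) = b2 # cs @ [b3]" "butlast (tl (rev bs)) = b3 # rev cs @ [b2]" "bs ! 1 = b2" "rev bs ! 1 = b3"
        by (auto simp: bs butlast_append)
      then show False using l1 l2 by (simp add: sum_list_rev)
    qed
  qed
qed

section \<open>Embeddings that avoid later deletions\<close>

definition mir :: "(int \<Rightarrow> int \<Rightarrow> bool) \<Rightarrow> int \<Rightarrow> int \<Rightarrow> bool" where
  "mir R x y = R (- y) (- x)"

lemma mir_mir [simp]: "mir (mir R) = R"
  by (intro ext) (simp add: mir_def)

lemma rtour_mir: "rtour R \<Longrightarrow> rtour (mir R)"
  unfolding rtour_def mir_def by (metis neg_equal_iff_equal)

lemma sum_card_swap:
  assumes "finite B" "finite C"
  shows "(\<Sum>y\<in>B. card {x\<in>C. P x y}) = (\<Sum>x\<in>C. card {y\<in>B. P x y})"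
  by (simp only: card_eq_sum_of_bool assms) (rule sum.swap)

lemma card_uminus: "card {x\<in>uminus ` A. P x} = card {x\<in>A. P (- x)}" for A :: "int set"
proof -
  have "{x\<in>uminus ` A. P x} = uminus ` {x\<in>A. P (- x)}" by auto
  then show ?thesis by (simp add: card_image)
qed

text \<open>Reversing the order and all arcs keeps forward arcs forward. Moving \<open>B\<close> to
  the front in the mirrored order means moving it to the back in the original one, that is, moving
  the complement \<open>C\<close> to the front. The ends are shifted by 1 because the intervals are
  half-open.\<close>

lemma med_mir:
  assumes "med R lo hi"
  shows "med (mir R) (1 - hi) (1 - lo)"
  unfolding med_def
proof (intro allI impI)
  fix i j B assume a: "1 - hi \<le> i \<and> i \<le> j \<and> j \<le> 1 - lo \<and> B \<subseteq> {i..<j}"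
  define C where "C = {i..<j} - B"
  define J where "J = {1 - j..<1 - i}"
  have fin: "finite B" "finite C" using a finite_subset[of B "{i..<j}"] by (auto simp: C_def)
  have J: "uminus ` C \<subseteq> J" "J - uminus ` C = uminus ` B"
  proof -
    have u: "x \<in> uminus ` Z \<longleftrightarrow> - x \<in> Z" for x :: int and Z by (metis image_iff minus_minus)
    show "uminus ` C \<subseteq> J" by (auto simp: C_def J_def)
    show "J - uminus ` C = uminus ` B" using a by (auto simp: C_def J_def u)
  qed
  have e: "(\<Sum>y\<in>B. card {x\<in>C. x < y \<and> Q (- x) (- y)}) = (\<Sum>y\<in>uminus ` C. card {x\<in>J - uminus ` C. x < y \<and> Q y x})" for Q
  proof -
    have "(\<Sum>y\<in>B. card {x\<in>C. x < y \<and> Q (- x) (- y)}) = (\<Sum>x\<in>C. card {y\<in>B. x < y \<and> Q (- x) (- y)})"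
      by (rule sum_card_swap[OF fin])
    also have "\<dots> = (\<Sum>x\<in>C. card {y\<in>uminus ` B. y < - x \<and> Q (- x) y})"
      unfolding card_uminus by simp
    also have "\<dots> = (\<Sum>y\<in>uminus ` C. card {x\<in>J - uminus ` C. x < y \<and> Q y x})"
      unfolding J by (simp add: sum.reindex)
    finally show ?thesis .
  qed
  have "(\<Sum>y\<in>uminus ` C. card {x\<in>J - uminus ` C. x < y \<and> R y x}) \<le> (\<Sum>y\<in>uminus ` C. card {x\<in>J - uminus ` C. x < y \<and> R x y})"
    unfolding J_def by (rule assms[unfolded med_def, rule_format]) (use a J in \<open>auto simp: J_def\<close>)
  then show "(\<Sum>y\<in>B. card {x\<in>{i..<j} - B. x < y \<and> mir R y x}) \<le> (\<Sum>y\<in>B. card {x\<in>{i..<j} - B. x < y \<and> mir R x y})"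
    unfolding mir_def C_def[symmetric] using e[of R] e[of "\<lambda>y x. R x y"] by simp
qed

text \<open>Both densities are counted from the ends of the interval: at most one position in ten, rounded up. This is what \<open>link\<close> needs, and it survives concatenation with gaps.\<close>

definition sparse :: "int set \<Rightarrow> int \<Rightarrow> int \<Rightarrow> bool" where
  "sparse F lo hi \<longleftrightarrow> F \<subseteq> {lo..<hi} \<and> (\<forall>i. lo \<le> i \<and> i \<le> hi \<longrightarrow>
     10 * int (card (F \<inter> {lo..<i})) \<le> i - lo + 9 \<and> 10 * int (card (F \<inter> {i..<hi})) \<le> hi - i + 9)"

lemma sparse_prefix:
  assumes "sparse F s e" "s \<le> e" "lo \<le> s"
  shows "10 * int (card (F \<inter> {lo..<i})) \<le> (if i \<le> s then 0 else min i e - s + 9)"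
proof (cases "i \<le> s")
  case True
  then have "F \<inter> {lo..<i} = {}" using assms by (auto simp: sparse_def)
  then show ?thesis using True by simp
next
  case False
  have "F \<inter> {lo..<i} = F \<inter> {s..<min i e}" using assms by (auto simp: sparse_def)
  then show ?thesis using assms False by (auto simp: sparse_def)
qed

lemma sparse_suffix:
  assumes "sparse F s e" "s \<le> e" "e \<le> hi"
  shows "10 * int (card (F \<inter> {i..<hi})) \<le> (if e \<le> i then 0 else e - max i s + 9)"
proof (cases "e \<le> i")
  case True
  then have "F \<inter> {i..<hi} = {}" using assms by (auto simp: sparse_def)
  then show ?thesis using True by simp
next
  case False
  have "F \<inter> {i..<hi} = F \<inter> {max i s..<e}" using assms by (auto simp: sparse_def)
  then show ?thesis using assms False by (auto simp: sparse_def)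
qed

lemma sparse_finite: "sparse F lo hi \<Longrightarrow> finite F"
  unfolding sparse_def by (meson finite_atLeastLessThan_int finite_subset)

lemma sparse_empty: "lo \<le> hi \<Longrightarrow> sparse {} lo hi"
  by (auto simp: sparse_def)

lemma sparse_mir: "sparse F lo hi \<Longrightarrow> sparse (uminus ` F) (1 - hi) (1 - lo)"
proof -
  assume s: "sparse F lo hi"
  have u: "uminus ` F \<inter> {a..<b} = uminus ` (F \<inter> {1 - b..<1 - a})" for a b
    by (auto simp: image_iff)
  have c: "card (uminus ` F \<inter> {a..<b}) = card (F \<inter> {1 - b..<1 - a})" for a b
    unfolding u by (simp add: card_image)
  show ?thesis
    unfolding sparse_def c
  proof (intro conjI allI impI)
    show "uminus ` F \<subseteq> {1 - hi..<1 - lo}" using s by (auto simp: sparse_def)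
    fix i assume "1 - hi \<le> i \<and> i \<le> 1 - lo"
    then show "10 * int (card (F \<inter> {1 - i..<1 - (1 - hi)})) \<le> i - (1 - hi) + 9"
      "10 * int (card (F \<inter> {1 - (1 - lo)..<1 - i})) \<le> 1 - lo - i + 9"
      using s[unfolded sparse_def] by (auto dest!: spec[of _ "1 - i"])
  qed
qed

text \<open>Every added position needs ten positions to be charged to, from either end. Counted from
  the left, the \<open>k\<close> positions that may lie inside the block of \<open>F1\<close> use
  the \<open>10 * k\<close> in front of it, and \<open>m\<close> uses itself and the gap behind that
  block. Counted from the right, all \<open>k + 1\<close> use the gap behind
  \<open>m\<close>.\<close>

lemma sparse_join:
  assumes F1: "sparse F1 s1 e1" and F2: "sparse F2 s2 hi" and ord: "s1 \<le> e1" "s2 \<le> hi"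
    and E: "E \<subseteq> {s1..m}" "finite E" "card E \<le> k + 1" "card (E \<inter> {..<m}) \<le> k"
    and pads: "lo + 10 * int k \<le> s1" "e1 + 9 \<le> m" "m + 10 * int k + 10 \<le> s2"
  shows "sparse (F1 \<union> F2 \<union> E) lo hi"
  unfolding sparse_def
proof (intro conjI allI impI)
  show "F1 \<union> F2 \<union> E \<subseteq> {lo..<hi}" using assms by (auto simp: sparse_def)
  fix i assume i: "lo \<le> i \<and> i \<le> hi"
  have split: "card ((F1 \<union> F2 \<union> E) \<inter> I) \<le> card (F1 \<inter> I) + card (F2 \<inter> I) + card (E \<inter> I)" for I
    using card_Un_le[of "F1 \<inter> I" "F2 \<inter> I"] card_Un_le[of "F1 \<inter> I \<union> F2 \<inter> I" "E \<inter> I"]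
    by (simp add: Int_Un_distrib2)
  have E1: "card (E \<inter> {lo..<i}) \<le> (if i \<le> s1 then 0 else if i \<le> m then k else k + 1)"
  proof -
    have "i \<le> s1 \<Longrightarrow> E \<inter> {lo..<i} = {}" using E by auto
    moreover have "i \<le> m \<Longrightarrow> card (E \<inter> {lo..<i}) \<le> k"
      using E card_mono[of "E \<inter> {..<m}" "E \<inter> {lo..<i}"] by fastforce
    moreover have "card (E \<inter> {lo..<i}) \<le> k + 1" using E card_mono[of E "E \<inter> {lo..<i}"] by fastforce
    ultimately show ?thesis by auto
  qed
  have E2: "card (E \<inter> {i..<hi}) \<le> (if m < i then 0 else k + 1)"
  proof -
    have "m < i \<Longrightarrow> E \<inter> {i..<hi} = {}" using E by auto
    moreover have "card (E \<inter> {i..<hi}) \<le> k + 1" using E card_mono[of E "E \<inter> {i..<hi}"] by fastforce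
    ultimately show ?thesis by auto
  qed
  have lo: "lo \<le> s1" "lo \<le> s2" "e1 \<le> hi" using pads ord by auto
  show "10 * int (card ((F1 \<union> F2 \<union> E) \<inter> {lo..<i})) \<le> i - lo + 9"
    using split[of "{lo..<i}"] E1 sparse_prefix[OF F1 ord(1) lo(1), of i] sparse_prefix[OF F2 ord(2) lo(2), of i] pads ord i
    by (auto split: if_splits simp: min_def)
  show "10 * int (card ((F1 \<union> F2 \<union> E) \<inter> {i..<hi})) \<le> hi - i + 9"
    using split[of "{i..<hi}"] E2 sparse_suffix[OF F1 ord(1) lo(3), of i] sparse_suffix[OF F2 ord(2), of hi i] pads ord i
    by (auto split: if_splits simp: max_def)
qed

section \<open>Embeddings of arc sets into integer positions\<close>

fun arcs_of :: "bool list \<Rightarrow> 'v list \<Rightarrow> ('v \<times> 'v) set" where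
  "arcs_of (d # ds) (x # y # xs) = insert (if d then (x, y) else (y, x)) (arcs_of ds (y # xs))"
| "arcs_of _ _ = {}"

lemma walk_arcs_of: "walk R ds (map f xs) \<Longrightarrow> (u, v) \<in> arcs_of ds xs \<Longrightarrow> R (f u) (f v)"
  by (induction ds xs rule: arcs_of.induct) (auto split: if_splits)

lemma arcs_of_sub: "arcs_of ds xs \<subseteq> set xs \<times> set xs"
  by (induction ds xs rule: arcs_of.induct) auto

lemma arcs_of_Not: "arcs_of (map Not ds) xs = (arcs_of ds xs)\<inverse>"
  by (induction ds xs rule: arcs_of.induct) auto

definition emb :: "(int \<Rightarrow> int \<Rightarrow> bool) \<Rightarrow> ('v \<times> 'v) set \<Rightarrow> 'v set \<Rightarrow> int set \<Rightarrow> ('v \<Rightarrow> int) \<Rightarrow> bool" where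
  "emb R A V I f \<longleftrightarrow> inj_on f V \<and> f ` V \<subseteq> I \<and> (\<forall>(u, v)\<in>A. R (f u) (f v))"

lemma inj_on_Un_disjoint: "inj_on f A \<Longrightarrow> inj_on f B \<Longrightarrow> f ` A \<inter> f ` B = {} \<Longrightarrow> inj_on f (A \<union> B)"
  unfolding inj_on_Un by blast

text \<open>The path to be added also runs through vertices of \<open>V1\<close> and
  \<open>V2\<close>, whose images come from \<open>f1\<close> and \<open>f2\<close>. The last
  conclusion is therefore stated for any list \<open>xs\<close> that the glued map turns into a
  walk.\<close>

lemma emb_glue:
  assumes "emb R A1 V1 I1 f1" "emb R A2 V2 I2 f2" "A1 \<subseteq> V1 \<times> V1" "A2 \<subseteq> V2 \<times> V2"
    and "V1 \<inter> V2 = {}" "set ps \<inter> (V1 \<union> V2) = {}" "distinct ps" "length qs = length ps" "distinct qs"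
    and "I1 \<inter> I2 = {}" "set qs \<inter> f1 ` V1 = {}" "set qs \<inter> f2 ` V2 = {}" "I1 \<subseteq> I" "I2 \<subseteq> I" "set qs \<subseteq> I"
  obtains f where "\<forall>v\<in>V1. f v = f1 v" "\<forall>v\<in>V2. f v = f2 v" "map f ps = qs"
    "f ` (V1 \<union> V2 \<union> set ps) = f1 ` V1 \<union> f2 ` V2 \<union> set qs"
    "\<And>ds xs. walk R ds (map f xs) \<Longrightarrow> emb R (A1 \<union> A2 \<union> arcs_of ds xs) (V1 \<union> V2 \<union> set ps) I f"
proof -
  define f where "f v = (if v \<in> V1 then f1 v else if v \<in> V2 then f2 v else the (map_of (zip ps qs) v))" for v
  have m: "map f ps = qs"
  proof (rule nth_equalityI)
    fix i assume i: "i < length (map f ps)"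
    have "map_of (zip ps qs) (ps ! i) = Some (qs ! i)" using i assms by (simp add: map_of_zip_nth)
    moreover have "ps ! i \<in> set ps" using i by simp
    then have "ps ! i \<notin> V1" "ps ! i \<notin> V2" using assms(6) by blast+
    ultimately show "map f ps ! i = qs ! i" using i by (simp add: f_def)
  qed (use assms in simp)
  have e: "\<forall>v\<in>V1. f v = f1 v" "\<forall>v\<in>V2. f v = f2 v" using assms(5) by (auto simp: f_def)
  have im: "f ` V1 = f1 ` V1" "f ` V2 = f2 ` V2" "f ` set ps = set qs"
  proof -
    show "f ` V1 = f1 ` V1" "f ` V2 = f2 ` V2" using e by simp_all
    show "f ` set ps = set qs" using m by (metis set_map)
  qed
  have inj: "inj_on f V1" "inj_on f V2" "inj_on f (set ps)"
  proof -
    show "inj_on f V1" using assms(1) e(1) inj_on_cong[of V1 f f1] unfolding emb_def by blast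
    show "inj_on f V2" using assms(2) e(2) inj_on_cong[of V2 f f2] unfolding emb_def by blast
    show "inj_on f (set ps)" using m assms(9) by (metis distinct_map)
  qed
  have inj: "inj_on f (V1 \<union> V2 \<union> set ps)"
  proof (intro inj_on_Un_disjoint inj)
    have "f1 ` V1 \<subseteq> I1" "f2 ` V2 \<subseteq> I2" using assms(1,2) by (auto simp: emb_def)
    then show "f ` V1 \<inter> f ` V2 = {}" using assms(10) unfolding im by blast
    show "f ` (V1 \<union> V2) \<inter> f ` set ps = {}" using assms(11,12) unfolding im image_Un by blast
  qed
  have img: "f ` (V1 \<union> V2 \<union> set ps) = f1 ` V1 \<union> f2 ` V2 \<union> set qs"
    using im by (simp add: image_Un)
  have "emb R (A1 \<union> A2 \<union> arcs_of ds xs) (V1 \<union> V2 \<union> set ps) I f" if "walk R ds (map f xs)" for ds xs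
    unfolding emb_def img
  proof (intro conjI ballI, rule inj)
    have "f1 ` V1 \<subseteq> I1" "f2 ` V2 \<subseteq> I2" using assms(1,2) by (auto simp: emb_def)
    then show "f1 ` V1 \<union> f2 ` V2 \<union> set qs \<subseteq> I" using assms(13,14,15) by blast
    fix x assume x: "x \<in> A1 \<union> A2 \<union> arcs_of ds xs"
    obtain u v where uv: "x = (u, v)" by (cases x)
    consider "(u, v) \<in> A1" | "(u, v) \<in> A2" | "(u, v) \<in> arcs_of ds xs" using x uv by blast
    then have "R (f u) (f v)"
    proof cases
      case 1
      then have "R (f1 u) (f1 v)" "u \<in> V1" "v \<in> V1" using assms(1,3) by (auto simp: emb_def)
      then show ?thesis using e(1) by simp
    next
      case 2
      then have "R (f2 u) (f2 v)" "u \<in> V2" "v \<in> V2" using assms(2,4) by (auto simp: emb_def)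
      then show ?thesis using e(2) by simp
    next
      case 3
      then show ?thesis by (rule walk_arcs_of[OF that])
    qed
    then show "case x of (u, v) \<Rightarrow> R (f u) (f v)" by (simp add: uv)
  qed
  then show ?thesis using that e m img by blast
qed

text \<open>The positions \<open>\<phi>\<close> of the vertices in \<open>S\<close> are chosen before the set \<open>G\<close> of forbidden positions is known, the rest of the embedding afterwards. A port moreover offers \<open>\<alpha>\<close> unused positions that are out-neighbours (in-neighbours if \<open>\<not> \<sigma>\<close>) of the image of \<open>t\<close>.\<close>

definition port :: "(int \<Rightarrow> int \<Rightarrow> bool) \<Rightarrow> nat \<Rightarrow> nat \<Rightarrow> 'v set \<Rightarrow> ('v \<times> 'v) set \<Rightarrow> 'v set \<Rightarrow> 'v \<Rightarrow> bool \<Rightarrow> nat \<Rightarrow> bool" where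
  "port R M g V A S t \<sigma> \<alpha> \<longleftrightarrow> (\<forall>lo. med R lo (lo + int M) \<longrightarrow>
     (\<exists>\<phi> F. sparse F lo (lo + int M) \<and> \<phi> ` S \<subseteq> F \<and>
       (\<forall>G. G \<inter> F = {} \<and> card (G \<inter> {lo..<lo + int M}) \<le> g \<longrightarrow>
         (\<exists>f X. emb R A V ({lo..<lo + int M} - G) f \<and> (\<forall>s\<in>S. f s = \<phi> s) \<and> X \<subseteq> {lo..<lo + int M} - G - f ` V
            \<and> card X = \<alpha> \<and> (\<forall>x\<in>X. if \<sigma> then R (f t) x else R x (f t))))))"

definition good :: "(int \<Rightarrow> int \<Rightarrow> bool) \<Rightarrow> nat \<Rightarrow> nat \<Rightarrow> 'v set \<Rightarrow> ('v \<times> 'v) set \<Rightarrow> 'v set \<Rightarrow> bool" where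
  "good R M g V A S \<longleftrightarrow> (\<forall>lo. med R lo (lo + int M) \<longrightarrow>
     (\<exists>\<phi> F. sparse F lo (lo + int M) \<and> \<phi> ` S \<subseteq> F \<and>
       (\<forall>G. G \<inter> F = {} \<and> card (G \<inter> {lo..<lo + int M}) \<le> g \<longrightarrow>
         (\<exists>f. emb R A V ({lo..<lo + int M} - G) f \<and> (\<forall>s\<in>S. f s = \<phi> s)))))"

text \<open>A piece without offered neighbours is a port with \<open>\<alpha> = 0\<close>, so the
  mirror argument is needed only for ports.\<close>

lemma good_port: "good R M g V A S \<longleftrightarrow> port R M g V A S t \<sigma> 0"
  unfolding good_def port_def
  by (intro all_cong1 imp_cong refl ex_cong1 conj_cong) (metis card.empty empty_iff empty_subsetI)

lemma portE:
  assumes "port R M g V A S t \<sigma> \<alpha>" "med R lo (lo + int M)"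
  obtains \<phi> F where "sparse F lo (lo + int M)" "\<phi> ` S \<subseteq> F"
    "\<And>G. G \<inter> F = {} \<Longrightarrow> card (G \<inter> {lo..<lo + int M}) \<le> g \<Longrightarrow>
         \<exists>f X. emb R A V ({lo..<lo + int M} - G) f \<and> (\<forall>s\<in>S. f s = \<phi> s) \<and> X \<subseteq> {lo..<lo + int M} - G - f ` V
            \<and> card X = \<alpha> \<and> (\<forall>x\<in>X. if \<sigma> then R (f t) x else R x (f t))"
  using assms(1)[unfolded port_def, rule_format, OF assms(2)]
  by (elim exE conjE) (rule that, assumption, assumption, erule allE, erule impE, rule conjI, assumption+)

lemma goodE:
  assumes "good R M g V A S" "med R lo (lo + int M)"
  obtains \<phi> F where "sparse F lo (lo + int M)" "\<phi> ` S \<subseteq> F"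
    "\<And>G. G \<inter> F = {} \<Longrightarrow> card (G \<inter> {lo..<lo + int M}) \<le> g \<Longrightarrow>
         \<exists>f. emb R A V ({lo..<lo + int M} - G) f \<and> (\<forall>s\<in>S. f s = \<phi> s)"
  using assms(1)[unfolded good_def, rule_format, OF assms(2)]
  by (elim exE conjE) (rule that, assumption, assumption, erule allE, erule impE, rule conjI, assumption+)

lemma port_mir:
  assumes "port R M g V A S t \<sigma> \<alpha>"
  shows "port (mir R) M g V (A\<inverse>) S t (\<not> \<sigma>) \<alpha>"
  unfolding port_def
proof (intro allI impI)
  fix lo assume m: "med (mir R) lo (lo + int M)"
  define lo' where "lo' = 1 - (lo + int M)"
  have hi: "1 - lo = lo' + int M" "1 - (lo' + int M) = lo" "1 - lo' = lo + int M" by (auto simp: lo'_def)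
  have "med R lo' (lo' + int M)" using med_mir[OF m] by (simp add: hi(1) flip: lo'_def)
  then obtain \<phi> F where F: "sparse F lo' (lo' + int M)" "\<phi> ` S \<subseteq> F"
    and ex: "\<And>G. G \<inter> F = {} \<Longrightarrow> card (G \<inter> {lo'..<lo' + int M}) \<le> g \<Longrightarrow>
      \<exists>f X. emb R A V ({lo'..<lo' + int M} - G) f \<and> (\<forall>s\<in>S. f s = \<phi> s) \<and> X \<subseteq> {lo'..<lo' + int M} - G - f ` V
        \<and> card X = \<alpha> \<and> (\<forall>x\<in>X. if \<sigma> then R (f t) x else R x (f t))"
    by (rule portE[OF assms]) (rule that)
  have u: "x \<in> uminus ` Z \<longleftrightarrow> - x \<in> Z" for x :: int and Z by (metis image_iff minus_minus)
  show "\<exists>\<phi> F. sparse F lo (lo + int M) \<and> \<phi> ` S \<subseteq> F \<and>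
       (\<forall>G. G \<inter> F = {} \<and> card (G \<inter> {lo..<lo + int M}) \<le> g \<longrightarrow>
         (\<exists>f X. emb (mir R) (A\<inverse>) V ({lo..<lo + int M} - G) f \<and> (\<forall>s\<in>S. f s = \<phi> s) \<and> X \<subseteq> {lo..<lo + int M} - G - f ` V
            \<and> card X = \<alpha> \<and> (\<forall>x\<in>X. if \<not> \<sigma> then mir R (f t) x else mir R x (f t))))"
  proof (rule exI[of _ "\<lambda>s. - \<phi> s"], rule exI[of _ "uminus ` F"], intro conjI allI impI)
    show "sparse (uminus ` F) lo (lo + int M)" using sparse_mir[OF F(1)] by (simp add: hi)
    show "(\<lambda>s. - \<phi> s) ` S \<subseteq> uminus ` F" using F(2) by auto
    fix G assume G: "G \<inter> uminus ` F = {} \<and> card (G \<inter> {lo..<lo + int M}) \<le> g"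
    have "uminus ` G \<inter> {lo'..<lo' + int M} = uminus ` (G \<inter> {lo..<lo + int M})"
      by (auto simp: u lo'_def)
    then have "card (uminus ` G \<inter> {lo'..<lo' + int M}) = card (G \<inter> {lo..<lo + int M})" by (simp add: card_image)
    then have "uminus ` G \<inter> F = {}" "card (uminus ` G \<inter> {lo'..<lo' + int M}) \<le> g"
      using G by (auto simp: u disjoint_iff)
    from ex[OF this] obtain f X where f: "emb R A V ({lo'..<lo' + int M} - uminus ` G) f" "\<forall>s\<in>S. f s = \<phi> s"
      "X \<subseteq> {lo'..<lo' + int M} - uminus ` G - f ` V" "card X = \<alpha>" "\<forall>x\<in>X. if \<sigma> then R (f t) x else R x (f t)"
      by (elim exE conjE)
    have sub: "uminus ` ({lo'..<lo' + int M} - uminus ` G) \<subseteq> {lo..<lo + int M} - G"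
      by (auto simp: u lo'_def)
    have "emb (mir R) (A\<inverse>) V ({lo..<lo + int M} - G) (\<lambda>v. - f v) \<and> (\<forall>s\<in>S. - f s = - \<phi> s) \<and>
      uminus ` X \<subseteq> {lo..<lo + int M} - G - (\<lambda>v. - f v) ` V \<and> card (uminus ` X) = \<alpha> \<and>
      (\<forall>x\<in>uminus ` X. if \<not> \<sigma> then mir R (- f t) x else mir R x (- f t))"
    proof (intro conjI)
      have "(\<lambda>v. - f v) ` V \<subseteq> uminus ` ({lo'..<lo' + int M} - uminus ` G)" using f(1) by (auto simp: emb_def)
      then show "emb (mir R) (A\<inverse>) V ({lo..<lo + int M} - G) (\<lambda>v. - f v)"
        using f(1) sub unfolding emb_def by (auto simp: inj_on_def mir_def)
      have "uminus ` X \<subseteq> uminus ` ({lo'..<lo' + int M} - uminus ` G)" using f(3) by auto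
      then have "uminus ` X \<subseteq> {lo..<lo + int M} - G" using sub by blast
      moreover have "uminus ` X \<inter> (\<lambda>v. - f v) ` V = {}" using f(3) by auto
      ultimately show "uminus ` X \<subseteq> {lo..<lo + int M} - G - (\<lambda>v. - f v) ` V" by blast
      show "card (uminus ` X) = \<alpha>" using f(4) by (simp add: card_image)
    qed (use f in \<open>auto simp: mir_def\<close>)
    then show "\<exists>f X. emb (mir R) (A\<inverse>) V ({lo..<lo + int M} - G) f \<and> (\<forall>s\<in>S. f s = - \<phi> s) \<and> X \<subseteq> {lo..<lo + int M} - G - f ` V
            \<and> card X = \<alpha> \<and> (\<forall>x\<in>X. if \<not> \<sigma> then mir R (f t) x else mir R x (f t))" by blast
  qed
qed

lemma good_mir: "good R M g V A S \<Longrightarrow> good (mir R) M g V (A\<inverse>) S"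
  using port_mir good_port by metis

lemma sparse_extend:
  assumes "sparse F lo hi" "lo \<le> hi" "lo' \<le> lo" "hi \<le> hi'"
  shows "sparse F lo' hi'"
  unfolding sparse_def
proof (intro conjI allI impI)
  show "F \<subseteq> {lo'..<hi'}" using assms by (auto simp: sparse_def)
  fix i assume i: "lo' \<le> i \<and> i \<le> hi'"
  show "10 * int (card (F \<inter> {lo'..<i})) \<le> i - lo' + 9"
    using sparse_prefix[OF assms(1,2,3), of i] assms i by (auto split: if_splits)
  show "10 * int (card (F \<inter> {i..<hi'})) \<le> hi' - i + 9"
    using sparse_suffix[OF assms(1,2,4), of i] assms i by (auto split: if_splits)
qed

lemma emb_subset: "emb R A V I f \<Longrightarrow> I \<subseteq> I' \<Longrightarrow> emb R A V I' f"
  unfolding emb_def by blast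

lemma good_mono:
  assumes "good R M g V A S" "M \<le> M'" "g' \<le> g" "S' \<subseteq> S"
  shows "good R M' g' V A S'"
  unfolding good_def
proof (intro allI impI)
  fix lo assume m: "med R lo (lo + int M')"
  have "med R lo (lo + int M)" by (rule med_sub[OF m]) (use assms in auto)
  then obtain \<phi> F where F: "sparse F lo (lo + int M)" "\<phi> ` S \<subseteq> F"
    and ex: "\<And>G. G \<inter> F = {} \<Longrightarrow> card (G \<inter> {lo..<lo + int M}) \<le> g \<Longrightarrow>
         \<exists>f. emb R A V ({lo..<lo + int M} - G) f \<and> (\<forall>s\<in>S. f s = \<phi> s)"
    by (rule goodE[OF assms(1)]) (rule that)
  show "\<exists>\<phi> F. sparse F lo (lo + int M') \<and> \<phi> ` S' \<subseteq> F \<and>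
       (\<forall>G. G \<inter> F = {} \<and> card (G \<inter> {lo..<lo + int M'}) \<le> g' \<longrightarrow>
         (\<exists>f. emb R A V ({lo..<lo + int M'} - G) f \<and> (\<forall>s\<in>S'. f s = \<phi> s)))"
  proof (rule exI[of _ \<phi>], rule exI[of _ F], intro conjI allI impI)
    show "sparse F lo (lo + int M')" by (rule sparse_extend[OF F(1)]) (use assms in auto)
    show "\<phi> ` S' \<subseteq> F" using F assms by blast
    fix G assume G: "G \<inter> F = {} \<and> card (G \<inter> {lo..<lo + int M'}) \<le> g'"
    have "card (G \<inter> {lo..<lo + int M}) \<le> card (G \<inter> {lo..<lo + int M'})"
      by (rule card_mono) (use assms in auto)
    then have "card (G \<inter> {lo..<lo + int M}) \<le> g" using G assms by linarith
    with G obtain f where f: "emb R A V ({lo..<lo + int M} - G) f" "\<forall>s\<in>S. f s = \<phi> s"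
      using ex[of G] by blast
    have "emb R A V ({lo..<lo + int M'} - G) f" by (rule emb_subset[OF f(1)]) (use assms in auto)
    moreover have "\<forall>s\<in>S'. f s = \<phi> s" using f(2) assms(4) by blast
    ultimately show "\<exists>f. emb R A V ({lo..<lo + int M'} - G) f \<and> (\<forall>s\<in>S'. f s = \<phi> s)" by blast
  qed
qed

section \<open>Clusters: trees placed one vertex at a time on a sparse set\<close>

definition cluster :: "(int \<Rightarrow> int \<Rightarrow> bool) \<Rightarrow> nat \<Rightarrow> 'v set \<Rightarrow> ('v \<times> 'v) set \<Rightarrow> bool" where
  "cluster R M V A \<longleftrightarrow> (\<forall>lo. med R lo (lo + int M) \<longrightarrow>
     (\<exists>f. emb R A V {lo..<lo + int M} f \<and> sparse (f ` V) lo (lo + int M)))"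

lemma cluster_single: "cluster R 1 {v} {}"
  unfolding cluster_def
proof (intro allI impI)
  fix lo
  have "10 * int (card ({lo} \<inter> {lo..<i})) \<le> i - lo + 9 \<and> 10 * int (card ({lo} \<inter> {i..<lo + 1})) \<le> lo + 1 - i + 9"
    if "lo \<le> i" "i \<le> lo + 1" for i
  proof -
    from that consider "i = lo" | "i = lo + 1" by linarith
    then show ?thesis by cases auto
  qed
  then have "sparse ((\<lambda>_. lo) ` {v}) lo (lo + int 1)" by (simp add: sparse_def)
  then show "\<exists>f. emb R {} {v} {lo..<lo + int 1} f \<and> sparse (f ` {v}) lo (lo + int 1)"
    by (intro exI[of _ "\<lambda>_. lo"]) (auto simp: emb_def)
qed

lemma cluster_mir:
  assumes "cluster R M V A"
  shows "cluster (mir R) M V (A\<inverse>)"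
  unfolding cluster_def
proof (intro allI impI)
  fix lo assume m: "med (mir R) lo (lo + int M)"
  define lo' where "lo' = 1 - (lo + int M)"
  have hi: "1 - lo = lo' + int M" "1 - (lo' + int M) = lo" "1 - lo' = lo + int M" by (auto simp: lo'_def)
  have "med R lo' (lo' + int M)" using med_mir[OF m] by (simp add: hi(1) flip: lo'_def)
  then obtain f where f: "emb R A V {lo'..<lo' + int M} f" "sparse (f ` V) lo' (lo' + int M)"
    using assms unfolding cluster_def by blast
  have "emb (mir R) (A\<inverse>) V {lo..<lo + int M} (\<lambda>v. - f v)"
    using f(1) by (auto simp: emb_def mir_def inj_on_def lo'_def image_subset_iff)
  moreover have "sparse ((\<lambda>v. - f v) ` V) lo (lo + int M)"
    using sparse_mir[OF f(2)] by (simp add: hi image_image)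
  ultimately show "\<exists>f. emb (mir R) (A\<inverse>) V {lo..<lo + int M} f \<and> sparse (f ` V) lo (lo + int M)" by blast
qed

text \<open>At least half of the positions behind \<open>p\<close> are out-neighbours of
  \<open>p\<close>, but only about a tenth are occupied, so a free out-neighbour \<open>y\<close>
  exists. Ten new positions at each end of the interval pay for \<open>y\<close> in the two density
  counts, which makes 20 positions per vertex.\<close>

lemma cluster_out:
  assumes R: "rtour R" and c: "cluster R M V A" and ab: "a \<in> V" "b \<notin> V" and A: "A \<subseteq> V \<times> V"
  shows "cluster R (M + 20) (insert b V) (insert (a, b) A)"
  unfolding cluster_def
proof (intro allI impI)
  fix lo assume m: "med R lo (lo + int (M + 20))"
  define s where "s = lo + 10"
  define e where "e = s + int M"
  have "med R s (s + int M)" by (rule med_sub[OF m]) (auto simp: s_def)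
  then obtain f where f: "emb R A V {s..<e} f" "sparse (f ` V) s e"
    using c unfolding cluster_def e_def by blast
  define p where "p = f a"
  have p: "p \<in> f ` V" "s \<le> p" "p < e" using ab f(1) by (auto simp: p_def emb_def)
  have fin: "finite (f ` V)" by (rule sparse_finite[OF f(2)])
  define Q where "Q = {y\<in>{p<..e + 9}. R p y}"
  have "\<exists>y. y \<in> Q - f ` V"
  proof (rule ccontr)
    assume "\<not> ?thesis"
    then have "Q \<subseteq> f ` V" by blast
    moreover have "f ` V \<subseteq> {s..<e}" using f(2) by (simp add: sparse_def)
    ultimately have "Q \<subseteq> f ` V \<inter> {p<..<e}" by (auto simp: Q_def subset_iff)
    then have c1: "card Q \<le> card (f ` V \<inter> {p<..<e})" by (intro card_mono) auto
    \<comment> \<open>Counting \<open>p\<close> itself cancels the rounding term 9, so the estimate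
      also holds when \<open>p\<close> is the last occupied position.\<close>
    have "f ` V \<inter> {p..<e} = insert p (f ` V \<inter> {p<..<e})" using p by auto
    then have "card (f ` V \<inter> {p..<e}) = Suc (card (f ` V \<inter> {p<..<e}))" using fin by simp
    then have "10 * int (Suc (card (f ` V \<inter> {p<..<e}))) \<le> e - p + 9"
      using f(2) p unfolding sparse_def by (metis less_imp_le)
    then have "10 * int (card (f ` V \<inter> {p<..<e})) + 10 \<le> e - p + 9" by simp
    moreover have "card {p<..e + 9} \<le> 2 * card Q"
      unfolding Q_def by (rule med_out_half[OF R m]) (use p in \<open>auto simp: s_def e_def\<close>)
    moreover have "int (card {p<..e + 9}) = e + 9 - p" using p by auto
    ultimately show False using c1 p by linarith
  qed
  then obtain y where y: "p < y" "y < e + 10" "R p y" "y \<notin> f ` V" by (auto simp: Q_def)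
  have hi: "lo + int (M + 20) = e + 10" by (simp add: e_def s_def)
  have lo: "lo + 10 \<le> s" "s \<le> e" by (auto simp: s_def e_def)
  define f' where "f' = f(b := y)"
  have im: "f' ` insert b V = insert y (f ` V)" using ab by (auto simp: f'_def)
  have "emb R (insert (a, b) A) (insert b V) {lo..<lo + int (M + 20)} f'"
    unfolding emb_def im hi
  proof (intro conjI ballI)
    show "inj_on f' (insert b V)" using f(1) y ab unfolding emb_def f'_def by (auto simp: inj_on_def)
    show "insert y (f ` V) \<subseteq> {lo..<e + 10}" using f(1) y p lo unfolding emb_def by auto
    fix x assume "x \<in> insert (a, b) A"
    then show "case x of (u, v) \<Rightarrow> R (f' u) (f' v)"
      using f(1) y ab A unfolding emb_def f'_def p_def by (cases x) auto
  qed
  moreover have "sparse (insert y (f ` V)) lo (e + 10)"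
    unfolding sparse_def
  proof (intro conjI allI impI)
    show "insert y (f ` V) \<subseteq> {lo..<e + 10}" using f(1) y p lo unfolding emb_def by auto
    fix i assume i: "lo \<le> i \<and> i \<le> e + 10"
    have ins: "10 * int (card (insert y (f ` V) \<inter> I)) \<le> 10 * int (card (f ` V \<inter> I)) + (if y \<in> I then 10 else 0)" for I
      using fin by (auto simp: card_insert_if)
    show "10 * int (card (insert y (f ` V) \<inter> {lo..<i})) \<le> i - lo + 9"
      using ins[of "{lo..<i}"] sparse_prefix[OF f(2) lo(2), of lo i] lo i y p by (auto split: if_splits)
    show "10 * int (card (insert y (f ` V) \<inter> {i..<e + 10})) \<le> e + 10 - i + 9"
      using ins[of "{i..<e + 10}"] sparse_suffix[OF f(2) lo(2), of "e + 10" i] lo i y p by (auto split: if_splits)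
  qed
  ultimately show "\<exists>f. emb R (insert (a, b) A) (insert b V) {lo..<lo + int (M + 20)} f \<and> sparse (f ` insert b V) lo (lo + int (M + 20))"
    by (intro exI[of _ f']) (simp only: im hi simp_thms)
qed

lemma cluster_in:
  assumes R: "rtour R" and c: "cluster R M V A" and ab: "a \<in> V" "b \<notin> V" and A: "A \<subseteq> V \<times> V"
  shows "cluster R (M + 20) (insert b V) (insert (b, a) A)"
proof -
  have "cluster (mir R) (M + 20) (insert b V) (insert (a, b) (A\<inverse>))"
    by (rule cluster_out[OF rtour_mir[OF R] cluster_mir[OF c] ab]) (use A in auto)
  moreover have "(insert (a, b) (A\<inverse>))\<inverse> = insert (b, a) A" by auto
  ultimately show ?thesis using cluster_mir[of "mir R" "M + 20" "insert b V" "insert (a, b) (A\<inverse>)"] by (simp only: mir_mir)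
qed

text \<open>The whole image is taken as \<open>F\<close>, so a set \<open>G\<close> disjoint from
  \<open>F\<close> cannot disturb the embedding, whatever its size.\<close>

lemma cluster_good: "cluster R M V A \<Longrightarrow> good R M g V A V"
  unfolding good_def
proof (intro allI impI)
  fix lo assume "cluster R M V A" "med R lo (lo + int M)"
  then obtain f where f: "emb R A V {lo..<lo + int M} f" "sparse (f ` V) lo (lo + int M)"
    unfolding cluster_def by blast
  show "\<exists>\<phi> F. sparse F lo (lo + int M) \<and> \<phi> ` V \<subseteq> F \<and>
       (\<forall>G. G \<inter> F = {} \<and> card (G \<inter> {lo..<lo + int M}) \<le> g \<longrightarrow>
         (\<exists>f. emb R A V ({lo..<lo + int M} - G) f \<and> (\<forall>s\<in>V. f s = \<phi> s)))"
    using f by (intro exI[of _ f] exI[of _ "f ` V"] conjI allI impI) (auto simp: emb_def)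
qed

section \<open>Directed paths between embedded pieces\<close>

lemma link_from:
  assumes R: "rtour R" and m: "med R lo hi" and F: "sparse F s e" "lo \<le> s" "e + 11 < hi" and p: "p \<in> F"
  shows "\<exists>u v. u \<noteq> v \<and> u \<in> {p<..<e + 11} - F \<and> v \<in> {p<..<e + 11} - F \<and> R p u \<and> R u v \<and> R v (e + 11)"
proof -
  have p': "s \<le> p" "p < e" using p F by (auto simp: sparse_def)
  have "F \<inter> {p..<e} = insert p (F \<inter> {p<..<e + 11})" using p p' F by (auto simp: sparse_def)
  then have "card (F \<inter> {p..<e}) = Suc (card (F \<inter> {p<..<e + 11}))" using sparse_finite[OF F(1)] by simp
  then have "10 * int (Suc (card (F \<inter> {p<..<e + 11}))) \<le> e - p + 9"
    using F(1) p' unfolding sparse_def by (metis less_imp_le)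
  \<comment> \<open>Since \<open>p\<close> itself lies in \<open>F\<close>, it absorbs the rounding
    term, and 11 positions behind the sparse block give exactly what \<open>link\<close>
    requires.\<close>
  then show ?thesis by (intro link[OF R m]) (use p' F in auto)
qed

text \<open>The counterpart of \<open>link_from\<close> at the right end, now with up to
  \<open>g\<close> unknown deletions between \<open>p\<close> and \<open>c\<close>; they account for
  the \<open>10 * g\<close> in the gap.\<close>

lemma link_to:
  assumes R: "rtour R" and m: "med R lo hi" and F: "sparse F s hi" and c: "c \<in> F"
    and G: "card (G \<inter> {p<..<c}) \<le> g" and p: "lo \<le> p" "p + 10 * int g + 12 \<le> s"
  shows "\<exists>u v. u \<noteq> v \<and> u \<in> {p<..<c} - (F \<union> G) \<and> v \<in> {p<..<c} - (F \<union> G) \<and> R p u \<and> R u v \<and> R v c"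
proof -
  have c': "s \<le> c" "c < hi" using c F by (auto simp: sparse_def)
  have "F \<inter> {s..<c + 1} = insert c (F \<inter> {p<..<c})" using c c' p F by (auto simp: sparse_def)
  then have "card (F \<inter> {s..<c + 1}) = Suc (card (F \<inter> {p<..<c}))" using sparse_finite[OF F] by simp
  then have "10 * int (Suc (card (F \<inter> {p<..<c}))) \<le> c + 1 - s + 9"
    using F c' unfolding sparse_def by (metis zle_add1_eq_le add.commute le_add_same_cancel2 order_trans zero_le_one zless_imp_add1_zle)
  moreover have "card ((F \<union> G) \<inter> {p<..<c}) \<le> card (F \<inter> {p<..<c}) + g"
    using card_Un_le[of "F \<inter> {p<..<c}" "G \<inter> {p<..<c}"] G by (simp add: Int_Un_distrib2)
  ultimately show ?thesis by (intro link[OF R m]) (use c' p in auto)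
qed

lemma card_sub_le: "card (G \<inter> {lo..<hi}) \<le> g \<Longrightarrow> I \<subseteq> {lo..<hi} \<Longrightarrow> card (G \<inter> I) \<le> g" for lo hi :: int
  using card_mono[of "G \<inter> {lo..<hi}" "G \<inter> I"] by fastforce

lemma card_sub2_le: "card (G \<inter> {lo..<hi}) \<le> g \<Longrightarrow> I \<subseteq> {lo..<hi} \<Longrightarrow> card ((G \<union> {u, v}) \<inter> I) \<le> g + 2" for lo hi :: int
proof -
  assume a: "card (G \<inter> {lo..<hi}) \<le> g" "I \<subseteq> {lo..<hi}"
  have "card ((G \<union> {u, v}) \<inter> I) \<le> card ((G \<inter> I) \<union> {u, v})"
    by (rule card_mono) (use a finite_subset[of I "{lo..<hi}"] in auto)
  also have "\<dots> \<le> card (G \<inter> I) + card {u, v}" by (rule card_Un_le)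
  also have "\<dots> \<le> g + 2" using card_sub_le[OF a] card_insert_le_m1[of 2 "{v}" u] by (auto simp: card_insert_if)
  finally show ?thesis .
qed

text \<open>The first piece, a run starting at \<open>x0\<close>, and the second piece follow each
  other from left to right. The link from \<open>a\<close> to \<open>x0\<close> does not depend on
  \<open>G\<close>, so it is fixed in advance as part of \<open>F\<close>. The run and the link into
  \<open>c\<close> are chosen afterwards, because the end of the run depends on \<open>G\<close>.
  Each link may pass through the interval of a piece, which therefore has to avoid two more
  positions. The links take four vertices of \<open>ps\<close>, and the run at least one.\<close>

lemma long_merge:
  assumes R: "rtour R" and g1: "good R M1 (g + 2) V1 A1 S1" and g2: "good R M2 (g + 2) V2 A2 S2"
    and A: "A1 \<subseteq> V1 \<times> V1" "A2 \<subseteq> V2 \<times> V2" and S: "S1 \<subseteq> V1" "S2 \<subseteq> V2" "a \<in> S1" "c \<in> S2"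
    and dj: "V1 \<inter> V2 = {}" "set ps \<inter> (V1 \<union> V2) = {}" "distinct ps" and len: "5 \<le> length ps"
  shows "good R (M1 + M2 + length ps + 56 + 12 * g) g (V1 \<union> V2 \<union> set ps)
           (A1 \<union> A2 \<union> arcs_of (replicate (Suc (length ps)) True) (a # ps @ [c])) (S1 \<union> S2)"
    (is "good R ?M g ?V ?A ?S")
  unfolding good_def
proof (intro allI impI)
  fix lo assume m: "med R lo (lo + int ?M)"
  define r where "r = length ps - 4"
  \<comment> \<open>These 20 positions pay for the two link vertices that may fall into the first
    piece; this is the padding of \<open>sparse_join\<close> for \<open>k = 2\<close>.\<close>
  define s1 where "s1 = lo + 20"
  define e1 where "e1 = s1 + int M1"
  define x0 where "x0 = e1 + 11"
  \<comment> \<open>The run may end \<open>2 * g\<close> positions late and \<open>link_to\<close>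
    needs a gap of \<open>10 * g + 12\<close>. Moreover \<open>sparse_join\<close> asks for 30
    positions behind \<open>x0\<close>; here 29 suffices because \<open>1 \<le> r\<close>.\<close>
  define s2 where "s2 = x0 + int r + 12 * int g + 29"
  define hi where "hi = s2 + int M2"
  have r: "1 \<le> r" "length ps = r + 4" using len by (auto simp: r_def)
  have hi_eq: "lo + int ?M = hi" by (simp add: hi_def s2_def x0_def e1_def s1_def r)
  have m: "med R lo hi" using m by (simp only: hi_eq)
  have ord: "lo \<le> s1" "s1 \<le> e1" "e1 + 11 = x0" "x0 + 30 \<le> s2" "s2 \<le> hi" using r by (auto simp: s1_def e1_def x0_def s2_def hi_def)
  have "med R s1 (s1 + int M1)" by (rule med_sub[OF m]) (use ord in \<open>auto simp flip: e1_def\<close>)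
  then obtain \<phi>1 F1 where F1: "sparse F1 s1 (s1 + int M1)" "\<phi>1 ` S1 \<subseteq> F1"
    and ex1: "\<And>G. G \<inter> F1 = {} \<Longrightarrow> card (G \<inter> {s1..<s1 + int M1}) \<le> g + 2 \<Longrightarrow>
         \<exists>f. emb R A1 V1 ({s1..<s1 + int M1} - G) f \<and> (\<forall>s\<in>S1. f s = \<phi>1 s)"
    by (rule goodE[OF g1]) (rule that)
  have "med R s2 (s2 + int M2)" by (rule med_sub[OF m]) (use ord in \<open>auto simp flip: hi_def\<close>)
  then obtain \<phi>2 F2 where F2: "sparse F2 s2 (s2 + int M2)" "\<phi>2 ` S2 \<subseteq> F2"
    and ex2: "\<And>G. G \<inter> F2 = {} \<Longrightarrow> card (G \<inter> {s2..<s2 + int M2}) \<le> g + 2 \<Longrightarrow>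
         \<exists>f. emb R A2 V2 ({s2..<s2 + int M2} - G) f \<and> (\<forall>s\<in>S2. f s = \<phi>2 s)"
    by (rule goodE[OF g2]) (rule that)
  note F1 = F1[folded e1_def] and F2 = F2[folded hi_def] and ex1 = ex1[folded e1_def] and ex2 = ex2[folded hi_def]
  have F1s: "F1 \<subseteq> {s1..<e1}" and F2s: "F2 \<subseteq> {s2..<hi}" using F1 F2 by (auto simp: sparse_def)
  define p where "p = \<phi>1 a"
  define c' where "c' = \<phi>2 c"
  have pF: "p \<in> F1" and cF: "c' \<in> F2" using F1(2) F2(2) S by (auto simp: p_def c'_def)
  have pc: "s1 \<le> p" "p < e1" "s2 \<le> c'" "c' < hi" using pF cF F1s F2s by auto
  obtain u u' where u: "u \<noteq> u'" "u \<in> {p<..<x0} - F1" "u' \<in> {p<..<x0} - F1" "R p u" "R u u'" "R u' x0"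
    using link_from[OF R m F1(1) _ _ pF] ord by auto
  define F where "F = F1 \<union> F2 \<union> {u, u', x0}"
  have Fsp: "sparse F lo hi"
    unfolding F_def
  proof (rule sparse_join[OF F1(1) F2(1), where m = x0 and k = 2])
    have "{u, u', x0} \<inter> {..<x0} = {u, u'}" using u by auto
    then show "card ({u, u', x0} \<inter> {..<x0}) \<le> 2" using u by simp
    show "card {u, u', x0} \<le> 2 + 1" by (auto simp: card_insert_if)
  qed (use u pc ord in \<open>auto simp: s1_def\<close>)
  show "\<exists>\<phi> F. sparse F lo (lo + int ?M) \<and> \<phi> ` ?S \<subseteq> F \<and>
       (\<forall>G. G \<inter> F = {} \<and> card (G \<inter> {lo..<lo + int ?M}) \<le> g \<longrightarrow>
         (\<exists>f. emb R ?A ?V ({lo..<lo + int ?M} - G) f \<and> (\<forall>s\<in>?S. f s = \<phi> s)))"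
    unfolding hi_eq
  proof (rule exI[of _ "\<lambda>v. if v \<in> V1 then \<phi>1 v else \<phi>2 v"], rule exI[of _ F], intro conjI allI impI)
    show "sparse F lo hi" by (rule Fsp)
    show "(\<lambda>v. if v \<in> V1 then \<phi>1 v else \<phi>2 v) ` ?S \<subseteq> F"
      using F1(2) F2(2) S dj(1) unfolding F_def by auto
    fix G assume G: "G \<inter> F = {} \<and> card (G \<inter> {lo..<hi}) \<le> g"
    then have Gc: "card (G \<inter> {lo..<hi}) \<le> g" and GF: "G \<inter> F1 = {}" "G \<inter> F2 = {}" "x0 \<notin> G" "u \<notin> G" "u' \<notin> G"
      by (auto simp: F_def)
    have c1: "card (G \<inter> {x0<..<s2}) \<le> g" by (rule card_sub_le[OF Gc]) (use ord in auto)
    have "\<exists>zs. length zs = r \<and> hd zs = x0 \<and> sorted_wrt (<) zs \<and> set zs \<subseteq> {x0..<s2} - G \<and> successively R zs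
      \<and> last zs \<le> x0 + int r - 1 + 2 * int (card (G \<inter> {x0<..<s2}))"
      by (rule run[OF R med_sub[OF m, of lo s2]]) (use ord r GF c1 in \<open>auto simp: s2_def\<close>)
    then obtain zs where zs: "length zs = r" "hd zs = x0" "sorted_wrt (<) zs" "set zs \<subseteq> {x0..<s2} - G" "successively R zs"
      "last zs \<le> x0 + int r - 1 + 2 * int (card (G \<inter> {x0<..<s2}))" by blast
    have zne: "zs \<noteq> []" using zs r by auto
    define p' where "p' = last zs"
    have p'in: "p' \<in> set zs" using zne by (simp add: p'_def)
    have p': "p' \<le> x0 + int r - 1 + 2 * int g" "x0 \<le> p'" "p' < s2" using zs(4,6) c1 p'in by (auto simp: p'_def)
    have zle: "z \<le> p'" if "z \<in> set zs" for z
    proof -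
      have "sorted zs" using zs(3) by (simp add: strict_sorted_iff)
      then show ?thesis using that zne unfolding p'_def
        by (metis in_set_conv_nth last_conv_nth length_greater_0_conv sorted_nth_mono Suc_pred' less_Suc_eq_le diff_less zero_less_one)
    qed
    have c2: "card (G \<inter> {p'<..<c'}) \<le> g" by (rule card_sub_le[OF Gc]) (use ord p' pc in auto)
    obtain w w' where w: "w \<noteq> w'" "w \<in> {p'<..<c'} - (F2 \<union> G)" "w' \<in> {p'<..<c'} - (F2 \<union> G)" "R p' w" "R w w'" "R w' c'"
      using link_to[OF R m F2(1) cF c2] p' ord by (auto simp: s2_def)
    have "\<exists>f. emb R A1 V1 ({s1..<e1} - (G \<union> {u, u'})) f \<and> (\<forall>s\<in>S1. f s = \<phi>1 s)"
      by (rule ex1, use GF u in blast, rule card_sub2_le[OF Gc], use ord in auto)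
    then obtain f1 where f1: "emb R A1 V1 ({s1..<e1} - (G \<union> {u, u'})) f1" "\<forall>s\<in>S1. f1 s = \<phi>1 s" by blast
    have "\<exists>f. emb R A2 V2 ({s2..<hi} - (G \<union> {w, w'})) f \<and> (\<forall>s\<in>S2. f s = \<phi>2 s)"
      by (rule ex2, use GF w in blast, rule card_sub2_le[OF Gc], use ord in auto)
    then obtain f2 where f2: "emb R A2 V2 ({s2..<hi} - (G \<union> {w, w'})) f2" "\<forall>s\<in>S2. f2 s = \<phi>2 s" by blast
    have im: "f1 ` V1 \<subseteq> {s1..<e1} - (G \<union> {u, u'})" "f2 ` V2 \<subseteq> {s2..<hi} - (G \<union> {w, w'})"
      using f1(1) f2(1) unfolding emb_def by blast+
    define qs where "qs = [u, u'] @ zs @ [w, w']"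
    have zr: "x0 \<le> z \<and> z \<le> p' \<and> z \<notin> G" if "z \<in> set zs" for z using that zs(4) zle by auto
    have ur: "p < u" "u < x0" "p < u'" "u' < x0" "p' < w" "w < c'" "p' < w'" "w' < c'" "w \<notin> G" "w' \<notin> G"
      using u w by auto
    have dz: "distinct zs" using zs(3) by (simp add: strict_sorted_iff)
    have dqs: "distinct qs" unfolding qs_def using dz u(1) w(1) zr ur p' by force
    have lqs: "length qs = length ps" by (simp add: qs_def zs r)
    have d1: "set qs \<inter> f1 ` V1 = {}" using im(1) zr ur p' ord unfolding qs_def by fastforce
    have d2: "set qs \<inter> f2 ` V2 = {}" using im(2) zr ur p' ord unfolding qs_def by fastforce
    have sq: "set qs \<subseteq> {lo..<hi} - G" using zr ur p' ord pc GF unfolding qs_def by force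
    obtain f where f: "\<forall>v\<in>V1. f v = f1 v" "\<forall>v\<in>V2. f v = f2 v" "map f ps = qs"
      and em: "\<And>ds xs. walk R ds (map f xs) \<Longrightarrow> emb R (A1 \<union> A2 \<union> arcs_of ds xs) ?V ({lo..<hi} - G) f"
      by (rule emb_glue[OF f1(1) f2(1) A dj lqs dqs _ d1 d2 _ _ sq]) (use ord in auto)
    have fac: "f a = p" "f c = c'" using f(1,2) f1(2) f2(2) S by (auto simp: p_def c'_def)
    have "successively R (p # qs @ [c'])"
      unfolding qs_def using u w zs zne by (auto simp: successively_append_iff successively_Cons p'_def)
    then have "walk R (replicate (Suc (length ps)) True) (map f (a # ps @ [c]))"
      by (simp only: walk_True) (simp add: f(3) fac lqs)
    then have "emb R ?A ?V ({lo..<hi} - G) f" by (rule em)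
    moreover have "\<forall>s\<in>?S. f s = (if s \<in> V1 then \<phi>1 s else \<phi>2 s)"
      using f(1,2) f1(2) f2(2) S dj(1) by auto
    ultimately show "\<exists>f. emb R ?A ?V ({lo..<hi} - G) f \<and> (\<forall>s\<in>?S. f s = (if s \<in> V1 then \<phi>1 s else \<phi>2 s))" by blast
  qed
qed

text \<open>Two rounding terms occur in the sum and only one is allowed; the gap of 9 makes up for
  the other.\<close>

lemma sparse_Un:
  assumes F1: "sparse F1 lo e1" and F2: "sparse F2 s2 hi" and ord: "lo \<le> e1" "e1 + 9 \<le> s2" "s2 \<le> hi"
  shows "sparse (F1 \<union> F2) lo hi"
  unfolding sparse_def
proof (intro conjI allI impI)
  show "F1 \<union> F2 \<subseteq> {lo..<hi}" using assms by (auto simp: sparse_def)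
  fix i assume i: "lo \<le> i \<and> i \<le> hi"
  have split: "int (card ((F1 \<union> F2) \<inter> I)) \<le> int (card (F1 \<inter> I)) + int (card (F2 \<inter> I))" for I
    using card_Un_le[of "F1 \<inter> I" "F2 \<inter> I"] by (simp add: Int_Un_distrib2)
  have lo: "lo \<le> lo" "lo \<le> s2" "e1 \<le> hi" using ord by auto
  show "10 * int (card ((F1 \<union> F2) \<inter> {lo..<i})) \<le> i - lo + 9"
    using split[of "{lo..<i}"] sparse_prefix[OF F1 ord(1) lo(1), of i] sparse_prefix[OF F2 ord(3) lo(2), of i] ord i
    by (auto split: if_splits simp: min_def)
  show "10 * int (card ((F1 \<union> F2) \<inter> {i..<hi})) \<le> hi - i + 9"
    using split[of "{i..<hi}"] sparse_suffix[OF F1 ord(1) lo(3), of i] sparse_suffix[OF F2 ord(3), of hi i] ord i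
    by (auto split: if_splits simp: max_def)
qed

lemma emb_empty: "emb R {} {} I f"
  by (simp add: emb_def)

text \<open>The construction of \<open>long_merge\<close> without the second piece: at least half of
  the positions behind the end of the run are out-neighbours of it, and the
  \<open>2 * g + 2 * \<alpha>\<close> positions reserved beyond its latest possible end leave
  \<open>\<alpha>\<close> of them outside \<open>G\<close>.\<close>

lemma port_long_out:
  assumes R: "rtour R" and g1: "good R M1 (g + 2) V1 A1 S1"
    and A: "A1 \<subseteq> V1 \<times> V1" and S: "S1 \<subseteq> V1" "a \<in> S1"
    and dj: "set ps \<inter> V1 = {}" "distinct ps" and len: "3 \<le> length ps"
  shows "port R (M1 + length ps + 59 + 4 * g + 2 * \<alpha>) g (V1 \<union> set ps)
           (A1 \<union> arcs_of (replicate (length ps) True) (a # ps)) S1 (last ps) True \<alpha>"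
    (is "port R ?M g ?V ?A _ _ _ _")
  unfolding port_def
proof (intro allI impI)
  fix lo assume m: "med R lo (lo + int ?M)"
  define r where "r = length ps - 2"
  define s1 where "s1 = lo + 20"
  define e1 where "e1 = s1 + int M1"
  define x0 where "x0 = e1 + 11"
  define hi where "hi = x0 + int r + 4 * int g + 2 * int \<alpha> + 30"
  have r: "1 \<le> r" "length ps = r + 2" using len by (auto simp: r_def)
  have hi_eq: "lo + int ?M = hi" by (simp add: hi_def x0_def e1_def s1_def r)
  have m: "med R lo hi" using m by (simp only: hi_eq)
  have ord: "lo \<le> s1" "s1 \<le> e1" "e1 + 11 = x0" "x0 + 30 \<le> hi" using r by (auto simp: s1_def e1_def x0_def hi_def)
  have "med R s1 (s1 + int M1)" by (rule med_sub[OF m]) (use ord in \<open>auto simp flip: e1_def\<close>)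
  then obtain \<phi>1 F1 where F1: "sparse F1 s1 (s1 + int M1)" "\<phi>1 ` S1 \<subseteq> F1"
    and ex1: "\<And>G. G \<inter> F1 = {} \<Longrightarrow> card (G \<inter> {s1..<s1 + int M1}) \<le> g + 2 \<Longrightarrow>
         \<exists>f. emb R A1 V1 ({s1..<s1 + int M1} - G) f \<and> (\<forall>s\<in>S1. f s = \<phi>1 s)"
    by (rule goodE[OF g1]) (rule that)
  note F1 = F1[folded e1_def] and ex1 = ex1[folded e1_def]
  have F1s: "F1 \<subseteq> {s1..<e1}" using F1 by (auto simp: sparse_def)
  define p where "p = \<phi>1 a"
  have pF: "p \<in> F1" using F1(2) S by (auto simp: p_def)
  have pc: "s1 \<le> p" "p < e1" using pF F1s by auto
  obtain u u' where u: "u \<noteq> u'" "u \<in> {p<..<x0} - F1" "u' \<in> {p<..<x0} - F1" "R p u" "R u u'" "R u' x0"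
    using link_from[OF R m F1(1) _ _ pF] ord by auto
  define F where "F = F1 \<union> {} \<union> {u, u', x0}"
  have Fsp: "sparse F lo hi"
    unfolding F_def
  proof (rule sparse_join[OF F1(1), of "{}" hi, where m = x0 and k = 2])
    show "sparse {} hi hi" by (rule sparse_empty) simp
    have "{u, u', x0} \<inter> {..<x0} = {u, u'}" using u by auto
    then show "card ({u, u', x0} \<inter> {..<x0}) \<le> 2" using u by simp
    show "card {u, u', x0} \<le> 2 + 1" by (auto simp: card_insert_if)
  qed (use u pc ord in \<open>auto simp: s1_def\<close>)
  show "\<exists>\<phi> F. sparse F lo (lo + int ?M) \<and> \<phi> ` S1 \<subseteq> F \<and>
       (\<forall>G. G \<inter> F = {} \<and> card (G \<inter> {lo..<lo + int ?M}) \<le> g \<longrightarrow>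
         (\<exists>f X. emb R ?A ?V ({lo..<lo + int ?M} - G) f \<and> (\<forall>s\<in>S1. f s = \<phi> s) \<and> X \<subseteq> {lo..<lo + int ?M} - G - f ` ?V
            \<and> card X = \<alpha> \<and> (\<forall>x\<in>X. if True then R (f (last ps)) x else R x (f (last ps)))))"
    unfolding hi_eq
  proof (rule exI[of _ \<phi>1], rule exI[of _ F], intro conjI allI impI)
    show "sparse F lo hi" by (rule Fsp)
    show "\<phi>1 ` S1 \<subseteq> F" using F1(2) unfolding F_def by auto
    fix G assume G: "G \<inter> F = {} \<and> card (G \<inter> {lo..<hi}) \<le> g"
    then have Gc: "card (G \<inter> {lo..<hi}) \<le> g" and GF: "G \<inter> F1 = {}" "x0 \<notin> G" "u \<notin> G" "u' \<notin> G"
      by (auto simp: F_def)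
    have c1: "card (G \<inter> {x0<..<hi}) \<le> g" by (rule card_sub_le[OF Gc]) (use ord in auto)
    have "\<exists>zs. length zs = r \<and> hd zs = x0 \<and> sorted_wrt (<) zs \<and> set zs \<subseteq> {x0..<hi} - G \<and> successively R zs
      \<and> last zs \<le> x0 + int r - 1 + 2 * int (card (G \<inter> {x0<..<hi}))"
      by (rule run[OF R m]) (use ord r GF c1 in \<open>auto simp: hi_def\<close>)
    then obtain zs where zs: "length zs = r" "hd zs = x0" "sorted_wrt (<) zs" "set zs \<subseteq> {x0..<hi} - G" "successively R zs"
      "last zs \<le> x0 + int r - 1 + 2 * int (card (G \<inter> {x0<..<hi}))" by blast
    have zne: "zs \<noteq> []" using zs r by auto
    define p' where "p' = last zs"
    have p'in: "p' \<in> set zs" using zne by (simp add: p'_def)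
    have p': "p' \<le> x0 + int r - 1 + 2 * int g" "x0 \<le> p'" "p' < hi" using zs(4,6) c1 p'in by (auto simp: p'_def)
    have zle: "z \<le> p'" if "z \<in> set zs" for z
    proof -
      have "sorted zs" using zs(3) by (simp add: strict_sorted_iff)
      then show ?thesis using that zne unfolding p'_def
        by (metis in_set_conv_nth last_conv_nth length_greater_0_conv sorted_nth_mono Suc_pred' less_Suc_eq_le diff_less zero_less_one)
    qed
    define Q where "Q = {y\<in>{p'<..hi - 1}. R p' y}"
    have "card {p'<..hi - 1} \<le> 2 * card Q" unfolding Q_def by (rule med_out_half[OF R m]) (use p' ord in auto)
    moreover have "int (card {p'<..hi - 1}) = hi - 1 - p'" using p' by auto
    ultimately have Qc: "g + \<alpha> \<le> card Q" using p' unfolding hi_def by linarith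
    have finQ: "finite Q" by (rule finite_subset[of _ "{p'<..hi - 1}"]) (auto simp: Q_def)
    have "card (G \<inter> {p'<..<hi}) \<le> g" by (rule card_sub_le[OF Gc]) (use ord p' in auto)
    moreover have "card (Q - G) \<ge> card Q - card (G \<inter> {p'<..<hi})"
    proof -
      have "Q - G = Q - (G \<inter> {p'<..<hi})" by (auto simp: Q_def)
      then show ?thesis using diff_card_le_card_Diff[of "G \<inter> {p'<..<hi}" Q] by simp
    qed
    ultimately have "\<alpha> \<le> card (Q - G)" using Qc by linarith
    then obtain X where X: "X \<subseteq> Q - G" "card X = \<alpha>" by (rule obtain_subset_card)
    have "\<exists>f. emb R A1 V1 ({s1..<e1} - (G \<union> {u, u'})) f \<and> (\<forall>s\<in>S1. f s = \<phi>1 s)"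
      by (rule ex1, use GF u in blast, rule card_sub2_le[OF Gc], use ord in auto)
    then obtain f1 where f1: "emb R A1 V1 ({s1..<e1} - (G \<union> {u, u'})) f1" "\<forall>s\<in>S1. f1 s = \<phi>1 s" by blast
    have im: "f1 ` V1 \<subseteq> {s1..<e1} - (G \<union> {u, u'})" using f1(1) unfolding emb_def by blast
    define qs where "qs = [u, u'] @ zs"
    have zr: "x0 \<le> z \<and> z \<le> p' \<and> z \<notin> G" if "z \<in> set zs" for z using that zs(4) zle by auto
    have ur: "p < u" "u < x0" "p < u'" "u' < x0" using u by auto
    have dz: "distinct zs" using zs(3) by (simp add: strict_sorted_iff)
    have dqs: "distinct qs" unfolding qs_def using dz u(1) zr ur p' by force
    have lqs: "length qs = length ps" by (simp add: qs_def zs r)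
    have d1: "set qs \<inter> f1 ` V1 = {}" using im zr ur p' ord unfolding qs_def by fastforce
    have sq: "set qs \<subseteq> {lo..<hi} - G" using zr ur p' ord pc GF unfolding qs_def by force
    obtain f where f: "\<forall>v\<in>V1. f v = f1 v" "map f ps = qs" "f ` (V1 \<union> {} \<union> set ps) = f1 ` V1 \<union> f1 ` {} \<union> set qs"
      and em: "\<And>ds xs. walk R ds (map f xs) \<Longrightarrow> emb R (A1 \<union> {} \<union> arcs_of ds xs) (V1 \<union> {} \<union> set ps) ({lo..<hi} - G) f"
      by (rule emb_glue[OF f1(1) emb_empty[of R "{}" f1] A _ _ _ dj(2) lqs dqs _ d1 _ _ _ sq])
        (use ord dj in auto)
    have fac: "f a = p" using f(1) f1(2) S by (auto simp: p_def)
    have "successively R (p # qs)"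
      unfolding qs_def using u zs zne by (auto simp: successively_append_iff successively_Cons)
    then have "walk R (replicate (length ps) True) (map f (a # ps))"
      by (simp only: walk_True) (simp add: f(2) fac lqs)
    then have "emb R (A1 \<union> {} \<union> arcs_of (replicate (length ps) True) (a # ps)) (V1 \<union> {} \<union> set ps) ({lo..<hi} - G) f" by (rule em)
    then have e: "emb R ?A ?V ({lo..<hi} - G) f" by simp
    have fl: "f (last ps) = p'"
      using f(2) zne len by (metis last_appendR last_map length_0_conv not_numeral_le_zero p'_def qs_def)
    have fs: "\<forall>s\<in>S1. f s = \<phi>1 s" using f(1) f1(2) S by auto
    have "f ` ?V = f1 ` V1 \<union> set qs" using f(3) by simp
    moreover have "set qs \<subseteq> {..p'}" using zle ur p' by (auto simp: qs_def)
    moreover have "{s1..<e1} \<subseteq> {..p'}" using p' ord by auto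
    ultimately have "f ` ?V \<subseteq> {..p'}" using im by blast
    moreover have "X \<subseteq> {p'<..<hi} - G" using X(1) by (auto simp: Q_def)
    moreover have "{p'<..<hi} \<inter> {..p'} = {}" "{p'<..<hi} \<subseteq> {lo..<hi}" using p' ord by auto
    ultimately have Xs: "X \<subseteq> {lo..<hi} - G - f ` ?V" by blast
    have "\<forall>x\<in>X. if True then R (f (last ps)) x else R x (f (last ps))" using X(1) unfolding fl Q_def by auto
    with e fs Xs X(2) show "\<exists>f X. emb R ?A ?V ({lo..<hi} - G) f \<and> (\<forall>s\<in>S1. f s = \<phi>1 s) \<and> X \<subseteq> {lo..<hi} - G - f ` ?V
            \<and> card X = \<alpha> \<and> (\<forall>x\<in>X. if True then R (f (last ps)) x else R x (f (last ps)))" by blast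
  qed
qed

lemma port_long:
  assumes R: "rtour R" and g1: "good R M1 (g + 2) V1 A1 S1"
    and A: "A1 \<subseteq> V1 \<times> V1" and S: "S1 \<subseteq> V1" "a \<in> S1"
    and dj: "set ps \<inter> V1 = {}" "distinct ps" and len: "3 \<le> length ps"
  shows "port R (M1 + length ps + 59 + 4 * g + 2 * \<alpha>) g (V1 \<union> set ps)
           (A1 \<union> arcs_of (replicate (length ps) \<sigma>) (a # ps)) S1 (last ps) \<sigma> \<alpha>"
proof (cases \<sigma>)
  case True
  then show ?thesis using port_long_out[OF assms] by simp
next
  case False
  have "port (mir R) (M1 + length ps + 59 + 4 * g + 2 * \<alpha>) g (V1 \<union> set ps)
           (A1\<inverse> \<union> arcs_of (replicate (length ps) True) (a # ps)) S1 (last ps) True \<alpha>"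
    by (rule port_long_out[OF rtour_mir[OF R] good_mir[OF g1] _ S dj len]) (use A in auto)
  from port_mir[OF this] have "port R (M1 + length ps + 59 + 4 * g + 2 * \<alpha>) g (V1 \<union> set ps)
           (A1 \<union> (arcs_of (replicate (length ps) True) (a # ps))\<inverse>) S1 (last ps) False \<alpha>" by (simp add: converse_Un)
  moreover have "(arcs_of (replicate (length ps) True) (a # ps))\<inverse> = arcs_of (replicate (length ps) False) (a # ps)"
    using arcs_of_Not[of "replicate (length ps) True" "a # ps"] by simp
  ultimately show ?thesis using False by simp
qed

lemma port_star:
  assumes g1: "good R M g (V \<union> D) A S" and D: "finite D" "D \<inter> V = {}" and A: "A' \<subseteq> A" "A' \<subseteq> V \<times> V"
    and a: "a \<in> V" "\<forall>d\<in>D. (if \<sigma> then (a, d) else (d, a)) \<in> A" and S: "S' \<subseteq> S" "S' \<subseteq> V"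
  shows "port R M g V A' S' a \<sigma> (card D)"
  unfolding port_def
proof (intro allI impI)
  fix lo assume m: "med R lo (lo + int M)"
  then obtain \<phi> F where F: "sparse F lo (lo + int M)" "\<phi> ` S \<subseteq> F"
    and ex: "\<And>G. G \<inter> F = {} \<Longrightarrow> card (G \<inter> {lo..<lo + int M}) \<le> g \<Longrightarrow>
         \<exists>f. emb R A (V \<union> D) ({lo..<lo + int M} - G) f \<and> (\<forall>s\<in>S. f s = \<phi> s)"
    by (rule goodE[OF g1]) (rule that)
  show "\<exists>\<phi> F. sparse F lo (lo + int M) \<and> \<phi> ` S' \<subseteq> F \<and>
       (\<forall>G. G \<inter> F = {} \<and> card (G \<inter> {lo..<lo + int M}) \<le> g \<longrightarrow>
         (\<exists>f X. emb R A' V ({lo..<lo + int M} - G) f \<and> (\<forall>s\<in>S'. f s = \<phi> s) \<and> X \<subseteq> {lo..<lo + int M} - G - f ` V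
            \<and> card X = card D \<and> (\<forall>x\<in>X. if \<sigma> then R (f a) x else R x (f a))))"
  proof (rule exI[of _ \<phi>], rule exI[of _ F], intro conjI allI impI)
    show "sparse F lo (lo + int M)" by (rule F)
    show "\<phi> ` S' \<subseteq> F" using F S by blast
    fix G assume "G \<inter> F = {} \<and> card (G \<inter> {lo..<lo + int M}) \<le> g"
    then obtain f where f: "emb R A (V \<union> D) ({lo..<lo + int M} - G) f" "\<forall>s\<in>S. f s = \<phi> s"
      using ex[of G] by blast
    have inj: "inj_on f (V \<union> D)" and im: "f ` (V \<union> D) \<subseteq> {lo..<lo + int M} - G" and ar: "\<And>u v. (u, v) \<in> A \<Longrightarrow> R (f u) (f v)"
      using f(1) by (auto simp: emb_def)
    have "emb R A' V ({lo..<lo + int M} - G) f"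
      unfolding emb_def using inj_on_subset[OF inj] im ar A(1) by auto
    moreover have "\<forall>s\<in>S'. f s = \<phi> s" using f(2) S by blast
    moreover have "f ` D \<subseteq> {lo..<lo + int M} - G - f ` V"
      using im inj D(2) unfolding inj_on_def by fastforce
    moreover have "card (f ` D) = card D" by (rule card_image) (rule inj_on_subset[OF inj], simp)
    moreover have "\<forall>x\<in>f ` D. if \<sigma> then R (f a) x else R x (f a)" using a(2) ar by (auto split: if_splits)
    ultimately show "\<exists>f X. emb R A' V ({lo..<lo + int M} - G) f \<and> (\<forall>s\<in>S'. f s = \<phi> s) \<and> X \<subseteq> {lo..<lo + int M} - G - f ` V
            \<and> card X = card D \<and> (\<forall>x\<in>X. if \<sigma> then R (f a) x else R x (f a))" by blast
  qed
qed

section \<open>Bent paths starting at ports\<close>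

lemma bent_path_inner:
  assumes R: "rtour R" and p1: "port R M1 g V1 A1 S1 t1 \<sigma>1 \<alpha>1" and p2: "port R M2 g V2 A2 S2 t2 \<sigma>2 \<alpha>2"
    and A: "A1 \<subseteq> V1 \<times> V1" "A2 \<subseteq> V2 \<times> V2" and S: "S1 \<subseteq> V1" "S2 \<subseteq> V2" "t1 \<in> V1" "t2 \<in> V2"
    and dj: "V1 \<inter> V2 = {}" "set ps \<inter> (V1 \<union> V2) = {}" "distinct ps"
    and bs: "2 \<le> length bs" "\<forall>b\<in>set bs. 0 < b" "length ps = Suc (sum_list bs)" "hd bs + 3 \<le> \<alpha>1" "last bs + 3 \<le> \<alpha>2"
  shows "good R (M1 + M2 + length ps + 10 + g) g (V1 \<union> V2 \<union> set ps)
           (A1 \<union> A2 \<union> arcs_of (\<sigma>1 # pat d bs @ [\<not> \<sigma>2]) (t1 # ps @ [t2])) (S1 \<union> S2)"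
    (is "good R ?M g ?V ?A ?S")
  unfolding good_def
proof (intro allI impI)
  fix lo assume m: "med R lo (lo + int ?M)"
  define e1 where "e1 = lo + int M1"
  define s2 where "s2 = e1 + int (length ps) + 10 + int g"
  define hi where "hi = s2 + int M2"
  have hi_eq: "lo + int ?M = hi" by (simp add: hi_def s2_def e1_def)
  have m: "med R lo hi" using m by (simp only: hi_eq)
  have ord: "lo \<le> e1" "e1 + 10 \<le> s2" "s2 \<le> hi" by (auto simp: e1_def s2_def hi_def)
  have "med R lo (lo + int M1)" by (rule med_sub[OF m]) (use ord in \<open>auto simp flip: e1_def\<close>)
  then obtain \<phi>1 F1 where F1: "sparse F1 lo (lo + int M1)" "\<phi>1 ` S1 \<subseteq> F1"
    and ex1: "\<And>G. G \<inter> F1 = {} \<Longrightarrow> card (G \<inter> {lo..<lo + int M1}) \<le> g \<Longrightarrow>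
         \<exists>f X. emb R A1 V1 ({lo..<lo + int M1} - G) f \<and> (\<forall>s\<in>S1. f s = \<phi>1 s) \<and> X \<subseteq> {lo..<lo + int M1} - G - f ` V1
            \<and> card X = \<alpha>1 \<and> (\<forall>x\<in>X. if \<sigma>1 then R (f t1) x else R x (f t1))"
    by (rule portE[OF p1]) (rule that)
  have "med R s2 (s2 + int M2)" by (rule med_sub[OF m]) (use ord in \<open>auto simp flip: hi_def\<close>)
  then obtain \<phi>2 F2 where F2: "sparse F2 s2 (s2 + int M2)" "\<phi>2 ` S2 \<subseteq> F2"
    and ex2: "\<And>G. G \<inter> F2 = {} \<Longrightarrow> card (G \<inter> {s2..<s2 + int M2}) \<le> g \<Longrightarrow>
         \<exists>f X. emb R A2 V2 ({s2..<s2 + int M2} - G) f \<and> (\<forall>s\<in>S2. f s = \<phi>2 s) \<and> X \<subseteq> {s2..<s2 + int M2} - G - f ` V2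
            \<and> card X = \<alpha>2 \<and> (\<forall>x\<in>X. if \<sigma>2 then R (f t2) x else R x (f t2))"
    by (rule portE[OF p2]) (rule that)
  note F1 = F1[folded e1_def] and F2 = F2[folded hi_def] and ex1 = ex1[folded e1_def] and ex2 = ex2[folded hi_def]
  define F where "F = F1 \<union> F2"
  have Fsp: "sparse F lo hi"
    unfolding F_def by (rule sparse_Un[OF F1(1) F2(1)]) (use ord in auto)
  show "\<exists>\<phi> F. sparse F lo (lo + int ?M) \<and> \<phi> ` ?S \<subseteq> F \<and>
       (\<forall>G. G \<inter> F = {} \<and> card (G \<inter> {lo..<lo + int ?M}) \<le> g \<longrightarrow>
         (\<exists>f. emb R ?A ?V ({lo..<lo + int ?M} - G) f \<and> (\<forall>s\<in>?S. f s = \<phi> s)))"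
    unfolding hi_eq
  proof (rule exI[of _ "\<lambda>v. if v \<in> V1 then \<phi>1 v else \<phi>2 v"], rule exI[of _ F], intro conjI allI impI)
    show "sparse F lo hi" by (rule Fsp)
    show "(\<lambda>v. if v \<in> V1 then \<phi>1 v else \<phi>2 v) ` ?S \<subseteq> F"
      using F1(2) F2(2) S dj(1) unfolding F_def by auto
    fix G assume G: "G \<inter> F = {} \<and> card (G \<inter> {lo..<hi}) \<le> g"
    then have Gc: "card (G \<inter> {lo..<hi}) \<le> g" and GF: "G \<inter> F1 = {}" "G \<inter> F2 = {}" by (auto simp: F_def)
    have "card (G \<inter> {lo..<e1}) \<le> g" by (rule card_sub_le[OF Gc]) (use ord in auto)
    from ex1[OF GF(1) this] obtain f1 X where f1: "emb R A1 V1 ({lo..<e1} - G) f1" "\<forall>s\<in>S1. f1 s = \<phi>1 s"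
      "X \<subseteq> {lo..<e1} - G - f1 ` V1" "card X = \<alpha>1" "\<forall>x\<in>X. if \<sigma>1 then R (f1 t1) x else R x (f1 t1)" by (elim exE conjE)
    have "card (G \<inter> {s2..<hi}) \<le> g" by (rule card_sub_le[OF Gc]) (use ord in auto)
    from ex2[OF GF(2) this] obtain f2 Y where f2: "emb R A2 V2 ({s2..<hi} - G) f2" "\<forall>s\<in>S2. f2 s = \<phi>2 s"
      "Y \<subseteq> {s2..<hi} - G - f2 ` V2" "card Y = \<alpha>2" "\<forall>x\<in>Y. if \<sigma>2 then R (f2 t2) x else R x (f2 t2)" by (elim exE conjE)
    have im: "f1 ` V1 \<subseteq> {lo..<e1} - G" "f2 ` V2 \<subseteq> {s2..<hi} - G" using f1(1) f2(1) unfolding emb_def by blast+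
    define B where "B = {e1..<s2} - G"
    have "card (G \<inter> {e1..<s2}) \<le> g" by (rule card_sub_le[OF Gc]) (use ord in auto)
    moreover have "card {e1..<s2} - card (G \<inter> {e1..<s2}) \<le> card ({e1..<s2} - (G \<inter> {e1..<s2}))"
      by (rule diff_card_le_card_Diff) auto
    moreover have "B = {e1..<s2} - (G \<inter> {e1..<s2})" by (auto simp: B_def)
    moreover have "card {e1..<s2} = length ps + 10 + g" by (simp add: s2_def)
    ultimately have cB: "length ps + 10 \<le> card B" by simp
    have fin: "finite X" "finite Y" "finite B" using f1(3) f2(3) finite_subset by (auto simp: B_def intro: finite_subset[of X "{lo..<e1}"] finite_subset[of Y "{s2..<hi}"])
    \<comment> \<open>The gap between the pieces supplies the vertices of the path: its
      \<open>10 + g\<close> extra positions leave the surplus 11 over \<open>sum_list bs\<close>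
      once \<open>G\<close> is removed. The order of positions no longer matters, so the path may
      wander through all of \<open>B\<close>, \<open>X\<close> and \<open>Y\<close>.\<close>
    have "link_cond R bs (B \<union> X \<union> Y) X Y"
      unfolding link_cond_def
    proof (intro conjI R bs)
      show "X \<inter> Y = {}" using f1(3) f2(3) ord by fastforce
      have "card B \<le> card (B \<union> X \<union> Y)" by (rule card_mono) (use fin in auto)
      then show "sum_list bs + 11 \<le> card (B \<union> X \<union> Y)" using cB bs(3) by linarith
    qed (use fin bs f1(4) f2(4) in auto)
    then obtain qs where qs: "walk R (pat d bs) qs" "distinct qs" "set qs \<subseteq> B \<union> X \<union> Y" "hd qs \<in> X" "last qs \<in> Y"
      using two_ended[of R bs "B \<union> X \<union> Y" X Y d] unfolding linked_def by blast
    have lqs: "length qs = length ps" using walk_length[OF qs(1)] bs(3) by simp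
    have d1: "set qs \<inter> f1 ` V1 = {}"
    proof -
      have "B \<inter> f1 ` V1 = {}" "Y \<inter> f1 ` V1 = {}" "X \<inter> f1 ` V1 = {}" using im f1(3) f2(3) ord unfolding B_def by fastforce+
      then show ?thesis using qs(3) by blast
    qed
    have d2: "set qs \<inter> f2 ` V2 = {}"
    proof -
      have "B \<inter> f2 ` V2 = {}" "Y \<inter> f2 ` V2 = {}" "X \<inter> f2 ` V2 = {}" using im f1(3) f2(3) ord unfolding B_def by fastforce+
      then show ?thesis using qs(3) by blast
    qed
    have sq: "set qs \<subseteq> {lo..<hi} - G"
    proof -
      have "B \<subseteq> {lo..<hi} - G" "X \<subseteq> {lo..<hi} - G" "Y \<subseteq> {lo..<hi} - G" using f1(3) f2(3) ord unfolding B_def by fastforce+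
      then show ?thesis using qs(3) by blast
    qed
    obtain f where f: "\<forall>v\<in>V1. f v = f1 v" "\<forall>v\<in>V2. f v = f2 v" "map f ps = qs"
      and em: "\<And>ds xs. walk R ds (map f xs) \<Longrightarrow> emb R (A1 \<union> A2 \<union> arcs_of ds xs) ?V ({lo..<hi} - G) f"
      by (rule emb_glue[OF f1(1) f2(1) A dj lqs qs(2) _ d1 d2 _ _ sq]) (use ord in auto)
    have ft: "f t1 = f1 t1" "f t2 = f2 t2" using f(1,2) S by auto
    have qne: "qs \<noteq> []" by (rule walk_nonempty[OF qs(1)])
    have "walk R (pat d bs @ (\<not> \<sigma>2) # []) (qs @ [f2 t2])"
      by (rule walk_join[OF qs(1)]) (use f2(5) qs(5) in auto)
    then have "walk R ([] @ \<sigma>1 # (pat d bs @ [\<not> \<sigma>2])) ([f1 t1] @ (qs @ [f2 t2]))"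
      by (rule walk_join[rotated 2]) (use f1(5) qs(4) qne in auto)
    then have "walk R (\<sigma>1 # pat d bs @ [\<not> \<sigma>2]) (map f (t1 # ps @ [t2]))" using f(3) ft by simp
    then have "emb R ?A ?V ({lo..<hi} - G) f" by (rule em)
    moreover have "\<forall>s\<in>?S. f s = (if s \<in> V1 then \<phi>1 s else \<phi>2 s)"
      using f(1,2) f1(2) f2(2) S dj(1) by auto
    ultimately show "\<exists>f. emb R ?A ?V ({lo..<hi} - G) f \<and> (\<forall>s\<in>?S. f s = (if s \<in> V1 then \<phi>1 s else \<phi>2 s))" by blast
  qed
qed

text \<open>The far end is free, so any \<open>last bs + 3\<close> positions of the gap serve as the
  second end set and no second port has to be built. This is why a path to a leaf is
  cheaper.\<close>

lemma bent_path_leaf: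
  assumes R: "rtour R" and p1: "port R M1 g V1 A1 S1 t1 \<sigma>1 \<alpha>1"
    and A: "A1 \<subseteq> V1 \<times> V1" and S: "S1 \<subseteq> V1" "t1 \<in> V1"
    and dj: "set ps \<inter> V1 = {}" "distinct ps"
    and bs: "2 \<le> length bs" "\<forall>b\<in>set bs. 0 < b" "length ps = Suc (sum_list bs)" "hd bs + 3 \<le> \<alpha>1"
  shows "good R (M1 + length ps + 10 + g) g (V1 \<union> set ps) (A1 \<union> arcs_of (\<sigma>1 # pat d bs) (t1 # ps)) S1"
    (is "good R ?M g ?V ?A ?S")
  unfolding good_def
proof (intro allI impI)
  fix lo assume m: "med R lo (lo + int ?M)"
  define e1 where "e1 = lo + int M1"
  define hi where "hi = e1 + int (length ps) + 10 + int g"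
  have hi_eq: "lo + int ?M = hi" by (simp add: hi_def e1_def)
  have m: "med R lo hi" using m by (simp only: hi_eq)
  have ord: "lo \<le> e1" "e1 + 10 \<le> hi" by (auto simp: e1_def hi_def)
  have "med R lo (lo + int M1)" by (rule med_sub[OF m]) (use ord in \<open>auto simp flip: e1_def\<close>)
  then obtain \<phi>1 F1 where F1: "sparse F1 lo (lo + int M1)" "\<phi>1 ` S1 \<subseteq> F1"
    and ex1: "\<And>G. G \<inter> F1 = {} \<Longrightarrow> card (G \<inter> {lo..<lo + int M1}) \<le> g \<Longrightarrow>
         \<exists>f X. emb R A1 V1 ({lo..<lo + int M1} - G) f \<and> (\<forall>s\<in>S1. f s = \<phi>1 s) \<and> X \<subseteq> {lo..<lo + int M1} - G - f ` V1
            \<and> card X = \<alpha>1 \<and> (\<forall>x\<in>X. if \<sigma>1 then R (f t1) x else R x (f t1))"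
    by (rule portE[OF p1]) (rule that)
  note F1 = F1[folded e1_def] and ex1 = ex1[folded e1_def]
  show "\<exists>\<phi> F. sparse F lo (lo + int ?M) \<and> \<phi> ` ?S \<subseteq> F \<and>
       (\<forall>G. G \<inter> F = {} \<and> card (G \<inter> {lo..<lo + int ?M}) \<le> g \<longrightarrow>
         (\<exists>f. emb R ?A ?V ({lo..<lo + int ?M} - G) f \<and> (\<forall>s\<in>?S. f s = \<phi> s)))"
    unfolding hi_eq
  proof (rule exI[of _ \<phi>1], rule exI[of _ F1], intro conjI allI impI)
    show "sparse F1 lo hi" by (rule sparse_extend[OF F1(1)]) (use ord in auto)
    show "\<phi>1 ` ?S \<subseteq> F1" by (rule F1)
    fix G assume G: "G \<inter> F1 = {} \<and> card (G \<inter> {lo..<hi}) \<le> g"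
    then have Gc: "card (G \<inter> {lo..<hi}) \<le> g" and GF: "G \<inter> F1 = {}" by auto
    have "card (G \<inter> {lo..<e1}) \<le> g" by (rule card_sub_le[OF Gc]) (use ord in auto)
    from ex1[OF GF(1) this] obtain f1 X where f1: "emb R A1 V1 ({lo..<e1} - G) f1" "\<forall>s\<in>S1. f1 s = \<phi>1 s"
      "X \<subseteq> {lo..<e1} - G - f1 ` V1" "card X = \<alpha>1" "\<forall>x\<in>X. if \<sigma>1 then R (f1 t1) x else R x (f1 t1)" by (elim exE conjE)
    have im: "f1 ` V1 \<subseteq> {lo..<e1} - G" using f1(1) unfolding emb_def by blast
    define B where "B = {e1..<hi} - G"
    have "card (G \<inter> {e1..<hi}) \<le> g" by (rule card_sub_le[OF Gc]) (use ord in auto)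
    moreover have "card {e1..<hi} - card (G \<inter> {e1..<hi}) \<le> card ({e1..<hi} - (G \<inter> {e1..<hi}))"
      by (rule diff_card_le_card_Diff) auto
    moreover have "B = {e1..<hi} - (G \<inter> {e1..<hi})" by (auto simp: B_def)
    moreover have "card {e1..<hi} = length ps + 10 + g" by (simp add: hi_def)
    ultimately have cB: "length ps + 10 \<le> card B" by simp
    have fin: "finite X" "finite B" using f1(3) finite_subset by (auto simp: B_def intro: finite_subset[of X "{lo..<e1}"])
    have "bs \<noteq> []" using bs(1) by auto
    then have "last bs \<le> sum_list bs" by (simp add: member_le_sum_list)
    then have "last bs + 3 \<le> card B" using cB bs(3) by linarith
    then obtain Y where Y: "Y \<subseteq> B" "card Y = last bs + 3" by (rule obtain_subset_card)
    have "link_cond R bs (B \<union> X) X Y"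
      unfolding link_cond_def
    proof (intro conjI R bs)
      show "X \<inter> Y = {}" using f1(3) Y ord unfolding B_def by fastforce
      have "card B \<le> card (B \<union> X)" by (rule card_mono) (use fin in auto)
      then show "sum_list bs + 11 \<le> card (B \<union> X)" using cB bs(3) by linarith
    qed (use fin bs f1(4) Y in auto)
    then obtain qs where qs: "walk R (pat d bs) qs" "distinct qs" "set qs \<subseteq> B \<union> X" "hd qs \<in> X"
      using two_ended[of R bs "B \<union> X" X Y d] unfolding linked_def by blast
    have lqs: "length qs = length ps" using walk_length[OF qs(1)] bs(3) by simp
    have d1: "set qs \<inter> f1 ` V1 = {}"
    proof -
      have "B \<inter> f1 ` V1 = {}" "X \<inter> f1 ` V1 = {}" using im f1(3) ord unfolding B_def by fastforce+
      then show ?thesis using qs(3) by blast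
    qed
    have sq: "set qs \<subseteq> {lo..<hi} - G"
    proof -
      have "B \<subseteq> {lo..<hi} - G" "X \<subseteq> {lo..<hi} - G" using f1(3) ord unfolding B_def by fastforce+
      then show ?thesis using qs(3) by blast
    qed
    obtain f where f: "\<forall>v\<in>V1. f v = f1 v" "map f ps = qs"
      and em: "\<And>ds xs. walk R ds (map f xs) \<Longrightarrow> emb R (A1 \<union> {} \<union> arcs_of ds xs) (V1 \<union> {} \<union> set ps) ({lo..<hi} - G) f"
      by (rule emb_glue[OF f1(1) emb_empty[of R "{}" f1] A _ _ _ dj(2) lqs qs(2) _ d1 _ _ _ sq])
        (use ord dj in auto)
    have ft: "f t1 = f1 t1" using f(1) S by auto
    have "walk R ([] @ \<sigma>1 # pat d bs) ([f1 t1] @ qs)"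
      by (rule walk_join[OF _ _ qs(1)]) (use f1(5) qs(4) in auto)
    then have "walk R (\<sigma>1 # pat d bs) (map f (t1 # ps))" using f(2) ft by simp
    from em[OF this] have "emb R ?A ?V ({lo..<hi} - G) f" by simp
    moreover have "\<forall>s\<in>?S. f s = \<phi>1 s" using f(1) f1(2) S by auto
    ultimately show "\<exists>f. emb R ?A ?V ({lo..<hi} - G) f \<and> (\<forall>s\<in>?S. f s = \<phi>1 s)" by blast
  qed
qed

section \<open>Trees of paths\<close>

lemma arcs_of_append:
  "length ds1 = length xs \<Longrightarrow> arcs_of (ds1 @ ds2) (xs @ v # ys) = arcs_of ds1 (xs @ [v]) \<union> arcs_of ds2 (v # ys)"
proof (induction ds1 arbitrary: xs)
  case (Cons d ds1)
  then obtain x xs' where xs: "xs = x # xs'" by (cases xs) auto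
  then show ?case using Cons.IH[of xs'] Cons.prems by (cases xs') auto
qed simp

lemma arcs_of_rev:
  "length xs = Suc (length ds) \<Longrightarrow> arcs_of (rev (map Not ds)) (rev xs) = arcs_of ds xs"
proof (induction ds arbitrary: xs)
  case (Cons d ds)
  then obtain x y zs where xs: "xs = x # y # zs" by (cases xs; cases "tl xs") auto
  have "arcs_of (rev (map Not ds) @ [\<not> d]) (rev zs @ y # [x]) = arcs_of (rev (map Not ds)) (rev zs @ [y]) \<union> arcs_of [\<not> d] [y, x]"
    by (rule arcs_of_append) (use Cons.prems xs in simp)
  then show ?case using Cons.IH[of "y # zs"] Cons.prems by (auto simp: xs)
qed simp

text \<open>The edge \<open>(a, ps, c, ds)\<close> stands for an oriented path from node \<open>a\<close> to node \<open>c\<close> with inner vertices \<open>ps\<close>; an entry \<open>True\<close> of \<open>ds\<close> is an arc directed towards \<open>c\<close>.\<close>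

type_synonym 'v edge = "'v \<times> 'v list \<times> 'v \<times> bool list"

definition VV :: "'v set \<Rightarrow> 'v edge set \<Rightarrow> 'v set" where
  "VV N E = N \<union> (\<Union>(a, ps, c, ds)\<in>E. set ps)"

definition AA :: "'v edge set \<Rightarrow> ('v \<times> 'v) set" where
  "AA E = (\<Union>(a, ps, c, ds)\<in>E. arcs_of ds (a # ps @ [c]))"

lemma VV_simps [simp]: "VV N {} = N" "VV N (insert (a, ps, c, ds) E) = VV N E \<union> set ps" "VV (N1 \<union> N2) (E1 \<union> E2) = VV N1 E1 \<union> VV N2 E2"
  by (auto simp: VV_def)

lemma AA_simps [simp]: "AA {} = {}" "AA (insert (a, ps, c, ds) E) = arcs_of ds (a # ps @ [c]) \<union> AA E" "AA (E1 \<union> E2) = AA E1 \<union> AA E2"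
  by (auto simp: AA_def)

definition joins :: "'v set \<Rightarrow> 'v edge set \<Rightarrow> 'v set \<Rightarrow> 'v edge set \<Rightarrow> 'v \<Rightarrow> 'v list \<Rightarrow> 'v \<Rightarrow> bool list \<Rightarrow> bool" where
  "joins N1 E1 N2 E2 a ps c ds \<longleftrightarrow> a \<in> N1 \<and> c \<in> N2 \<and> VV N1 E1 \<inter> VV N2 E2 = {} \<and>
     set ps \<inter> (VV N1 E1 \<union> VV N2 E2) = {} \<and> distinct ps \<and> length ds = Suc (length ps)"

text \<open>Joining two arbitrary trees, instead of attaching a path to one tree, makes the notion
  symmetric enough that every path can be regarded as the last one joined.\<close>

inductive ltree :: "'v set \<Rightarrow> 'v edge set \<Rightarrow> bool" where
  single: "ltree {v} {}"
| join: "ltree N1 E1 \<Longrightarrow> ltree N2 E2 \<Longrightarrow> joins N1 E1 N2 E2 a ps c ds \<Longrightarrow> ltree (N1 \<union> N2) (insert (a, ps, c, ds) (E1 \<union> E2))"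

lemma VV_sup: "N \<subseteq> VV N E" by (auto simp: VV_def)

lemma ltree_basic:
  "ltree N E \<Longrightarrow> finite N \<and> finite E \<and> card N = Suc (card E) \<and> AA E \<subseteq> VV N E \<times> VV N E \<and>
     (\<forall>(a, ps, c, ds)\<in>E. a \<in> N \<and> c \<in> N \<and> a \<noteq> c \<and> set ps \<inter> N = {} \<and> length ds = Suc (length ps) \<and> distinct ps) \<and>
     finite (VV N E) \<and> card (VV N E) = Suc (\<Sum>(a, ps, c, ds)\<in>E. length ds)"
proof (induction rule: ltree.induct)
  case (single v)
  then show ?case by simp
next
  case (join N1 E1 N2 E2 a ps c ds)
  have j: "a \<in> N1" "c \<in> N2" "VV N1 E1 \<inter> VV N2 E2 = {}" "set ps \<inter> (VV N1 E1 \<union> VV N2 E2) = {}" "distinct ps" "length ds = Suc (length ps)"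
    using join.hyps unfolding joins_def by auto
  have N: "N1 \<inter> N2 = {}" "set ps \<inter> (N1 \<union> N2) = {}" using j VV_sup[of N1 E1] VV_sup[of N2 E2] by blast+
  have e1: "x \<in> N1 \<and> y \<in> N1" if "(x, qs, y, es) \<in> E1" for x qs y es using join.IH(1) that by auto
  have e2: "x \<in> N2 \<and> y \<in> N2" if "(x, qs, y, es) \<in> E2" for x qs y es using join.IH(2) that by auto
  have E12: "E1 \<inter> E2 = {}" using e1 e2 N(1) by fastforce
  have e: "(a, ps, c, ds) \<notin> E1 \<union> E2" using e1 e2 N(1) j(1,2) by blast
  have fin: "finite N1" "finite N2" "finite E1" "finite E2" "finite (VV N1 E1)" "finite (VV N2 E2)" using join.IH by auto
  have c1: "card (insert (a, ps, c, ds) (E1 \<union> E2)) = Suc (card E1 + card E2)"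
    using e fin E12 by (simp add: card_Un_disjoint)
  have c2: "card (N1 \<union> N2) = card N1 + card N2" using fin N by (simp add: card_Un_disjoint)
  have "card (VV N1 E1 \<union> VV N2 E2 \<union> set ps) = card (VV N1 E1) + card (VV N2 E2) + card (set ps)"
    using fin j by (simp add: card_Un_disjoint Int_commute)
  then have c3: "card (VV N1 E1 \<union> VV N2 E2 \<union> set ps) = card (VV N1 E1) + card (VV N2 E2) + length ps"
    using j(5) by (simp add: distinct_card)
  have c4: "(\<Sum>(a, ps, c, ds)\<in>insert (a, ps, c, ds) (E1 \<union> E2). length ds)
     = length ds + ((\<Sum>(a, ps, c, ds)\<in>E1. length ds) + (\<Sum>(a, ps, c, ds)\<in>E2. length ds))"
    using e fin E12 by (simp add: sum.union_disjoint)
  have a1: "AA E1 \<subseteq> VV N1 E1 \<times> VV N1 E1" "AA E2 \<subseteq> VV N2 E2 \<times> VV N2 E2" using join.IH by auto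
  have "set (a # ps @ [c]) \<subseteq> VV N1 E1 \<union> VV N2 E2 \<union> set ps" using j VV_sup[of N1 E1] VV_sup[of N2 E2] by auto
  with arcs_of_sub[of ds "a # ps @ [c]"] a1
  have a2: "AA (insert (a, ps, c, ds) (E1 \<union> E2)) \<subseteq> VV (N1 \<union> N2) (insert (a, ps, c, ds) (E1 \<union> E2)) \<times> VV (N1 \<union> N2) (insert (a, ps, c, ds) (E1 \<union> E2))"
    unfolding AA_simps VV_simps by blast
  have f: "\<forall>(x, qs, y, es)\<in>insert (a, ps, c, ds) (E1 \<union> E2). x \<in> N1 \<union> N2 \<and> y \<in> N1 \<union> N2 \<and> x \<noteq> y \<and> set qs \<inter> (N1 \<union> N2) = {} \<and> length es = Suc (length qs) \<and> distinct qs"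
  proof (clarify, elim insertE UnE)
    fix x qs y es assume "(x, qs, y, es) = (a, ps, c, ds)"
    then show "x \<in> N1 \<union> N2 \<and> y \<in> N1 \<union> N2 \<and> x \<noteq> y \<and> set qs \<inter> (N1 \<union> N2) = {} \<and> length es = Suc (length qs) \<and> distinct qs"
      using j N by auto
  next
    fix x qs y es assume q: "(x, qs, y, es) \<in> E1"
    then have "set qs \<subseteq> VV N1 E1" by (auto simp: VV_def)
    then have "set qs \<inter> N2 = {}" using j(3) VV_sup[of N2 E2] by blast
    then show "x \<in> N1 \<union> N2 \<and> y \<in> N1 \<union> N2 \<and> x \<noteq> y \<and> set qs \<inter> (N1 \<union> N2) = {} \<and> length es = Suc (length qs) \<and> distinct qs"
      using join.IH(1) q by fastforce
  next
    fix x qs y es assume q: "(x, qs, y, es) \<in> E2"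
    then have "set qs \<subseteq> VV N2 E2" by (auto simp: VV_def)
    then have "set qs \<inter> N1 = {}" using j(3) VV_sup[of N1 E1] by blast
    then show "x \<in> N1 \<union> N2 \<and> y \<in> N1 \<union> N2 \<and> x \<noteq> y \<and> set qs \<inter> (N1 \<union> N2) = {} \<and> length es = Suc (length qs) \<and> distinct qs"
      using join.IH(2) q by fastforce
  qed
  show ?case
  proof (intro conjI a2 f)
    show "card (N1 \<union> N2) = Suc (card (insert (a, ps, c, ds) (E1 \<union> E2)))" using join.IH c1 c2 by simp
    show "card (VV (N1 \<union> N2) (insert (a, ps, c, ds) (E1 \<union> E2))) = Suc (\<Sum>(a, ps, c, ds)\<in>insert (a, ps, c, ds) (E1 \<union> E2). length ds)"
      using join.IH c3 c4 j(6) unfolding VV_simps by simp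
  qed (use fin in auto)
qed

lemma ltree_edge: "ltree N E \<Longrightarrow> (a, ps, c, ds) \<in> E \<Longrightarrow> a \<in> N \<and> c \<in> N \<and> a \<noteq> c \<and> set ps \<inter> N = {} \<and> length ds = Suc (length ps) \<and> distinct ps"
  using ltree_basic by fastforce

text \<open>If the path lies in one of the two joined trees, that tree is cut by induction, and the
  last join is repeated with the half that contains its end.\<close>

lemma ltree_cut:
  assumes "ltree N E" "(a, ps, c, ds) \<in> E"
  shows "\<exists>N1 E1 N2 E2. ltree N1 E1 \<and> ltree N2 E2 \<and> joins N1 E1 N2 E2 a ps c ds \<and> N = N1 \<union> N2 \<and> E = insert (a, ps, c, ds) (E1 \<union> E2)"
  using assms
proof (induction rule: ltree.induct)
  case (join N1 E1 N2 E2 a' ps' c' ds')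
  have j: "a' \<in> N1" "c' \<in> N2" "VV N1 E1 \<inter> VV N2 E2 = {}" "set ps' \<inter> (VV N1 E1 \<union> VV N2 E2) = {}" "distinct ps'" "length ds' = Suc (length ps')"
    using join.hyps unfolding joins_def by auto
  consider "(a, ps, c, ds) = (a', ps', c', ds')" | "(a, ps, c, ds) \<in> E1" | "(a, ps, c, ds) \<in> E2" using join.prems by blast
  then show ?case
  proof cases
    case 1
    then show ?thesis using join.hyps by blast
  next
    case 2
    then obtain N3 E3 N4 E4 where r: "ltree N3 E3" "ltree N4 E4" "joins N3 E3 N4 E4 a ps c ds" "N1 = N3 \<union> N4" "E1 = insert (a, ps, c, ds) (E3 \<union> E4)"
      using join.IH(1) by blast
    have V1: "VV N1 E1 = VV N3 E3 \<union> VV N4 E4 \<union> set ps" unfolding r(4,5) by simp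
    show ?thesis
    proof (cases "a' \<in> N3")
      case True
      have "joins N3 E3 N2 E2 a' ps' c' ds'" unfolding joins_def using j True V1 by auto
      then have "ltree (N3 \<union> N2) (insert (a', ps', c', ds') (E3 \<union> E2))" by (rule ltree.join[OF r(1) join.hyps(2)])
      moreover have "joins (N3 \<union> N2) (insert (a', ps', c', ds') (E3 \<union> E2)) N4 E4 a ps c ds"
        using r(3) j V1 unfolding joins_def VV_simps by blast
      ultimately show ?thesis using r(2)
        by (intro exI[of _ "N3 \<union> N2"] exI[of _ "insert (a', ps', c', ds') (E3 \<union> E2)"] exI[of _ N4] exI[of _ E4]) (simp add: r(4,5) Un_ac insert_commute)
    next
      case False
      then have a4: "a' \<in> N4" using j r(4) by blast
      have "joins N4 E4 N2 E2 a' ps' c' ds'" unfolding joins_def using j a4 V1 by auto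
      then have "ltree (N4 \<union> N2) (insert (a', ps', c', ds') (E4 \<union> E2))" by (rule ltree.join[OF r(2) join.hyps(2)])
      moreover have "joins N3 E3 (N4 \<union> N2) (insert (a', ps', c', ds') (E4 \<union> E2)) a ps c ds"
        using r(3) j V1 unfolding joins_def VV_simps by blast
      ultimately show ?thesis using r(1)
        by (intro exI[of _ N3] exI[of _ E3] exI[of _ "N4 \<union> N2"] exI[of _ "insert (a', ps', c', ds') (E4 \<union> E2)"]) (simp add: r(4,5) Un_ac insert_commute)
    qed
  next
    case 3
    then obtain N3 E3 N4 E4 where r: "ltree N3 E3" "ltree N4 E4" "joins N3 E3 N4 E4 a ps c ds" "N2 = N3 \<union> N4" "E2 = insert (a, ps, c, ds) (E3 \<union> E4)"
      using join.IH(2) by blast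
    have V2: "VV N2 E2 = VV N3 E3 \<union> VV N4 E4 \<union> set ps" unfolding r(4,5) by simp
    show ?thesis
    proof (cases "c' \<in> N3")
      case True
      have "joins N1 E1 N3 E3 a' ps' c' ds'" unfolding joins_def using j True V2 by auto
      then have "ltree (N1 \<union> N3) (insert (a', ps', c', ds') (E1 \<union> E3))" by (rule ltree.join[OF join.hyps(1) r(1)])
      moreover have "joins (N1 \<union> N3) (insert (a', ps', c', ds') (E1 \<union> E3)) N4 E4 a ps c ds"
        using r(3) j V2 unfolding joins_def VV_simps by blast
      ultimately show ?thesis using r(2)
        by (intro exI[of _ "N1 \<union> N3"] exI[of _ "insert (a', ps', c', ds') (E1 \<union> E3)"] exI[of _ N4] exI[of _ E4]) (simp add: r(4,5) Un_ac insert_commute)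
    next
      case False
      then have a4: "c' \<in> N4" using j r(4) by blast
      have "joins N1 E1 N4 E4 a' ps' c' ds'" unfolding joins_def using j a4 V2 by auto
      then have "ltree (N1 \<union> N4) (insert (a', ps', c', ds') (E1 \<union> E4))" by (rule ltree.join[OF join.hyps(1) r(2)])
      moreover have "joins N3 E3 (N1 \<union> N4) (insert (a', ps', c', ds') (E1 \<union> E4)) a ps c ds"
        using r(3) j V2 unfolding joins_def VV_simps by blast
      ultimately show ?thesis using r(1)
        by (intro exI[of _ N3] exI[of _ E3] exI[of _ "N1 \<union> N4"] exI[of _ "insert (a', ps', c', ds') (E1 \<union> E4)"]) (simp add: r(4,5) Un_ac insert_commute)
    qed
  qed
qed simp

definition inc :: "'v edge set \<Rightarrow> 'v \<Rightarrow> 'v edge set" where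
  "inc E v = {(a, ps, c, ds)\<in>E. v = a \<or> v = c}"

lemma inc_iff: "(a, ps, c, ds) \<in> inc E v \<longleftrightarrow> (a, ps, c, ds) \<in> E \<and> (v = a \<or> v = c)"
  by (auto simp: inc_def)

lemma ltree_isolated: "ltree N E \<Longrightarrow> v \<in> N \<Longrightarrow> inc E v = {} \<Longrightarrow> N = {v} \<and> E = {}"
proof (induction rule: ltree.induct)
  case (join N1 E1 N2 E2 a ps c ds)
  have i: "inc E1 v = {}" "inc E2 v = {}" "v \<noteq> a" "v \<noteq> c" using join.prems(2) by (auto simp: inc_def)
  have "a \<in> N1" "c \<in> N2" using join.hyps unfolding joins_def by auto
  then show ?case using join.IH join.prems(1) i by blast
qed simp

text \<open>The node \<open>v\<close> may be either end of the stored path. If it is the first one,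
  the path is read backwards with all directions negated, so that \<open>v\<close> always lies in
  the second part.\<close>

lemma ltree_cut_at:
  assumes t: "ltree N E" and e: "e \<in> inc E v"
  obtains N1 E1 N2 a ps ds E2 where "ltree N1 E1" "ltree N2 E2" "joins N1 E1 N2 E2 a ps v ds" "N = N1 \<union> N2" "E = insert e (E1 \<union> E2)"
    "e = (a, ps, v, ds) \<or> e = (v, rev ps, a, rev (map Not ds))"
    "AA {e} = arcs_of ds (a # ps @ [v])"
proof -
  obtain a ps c ds where ee: "e = (a, ps, c, ds)" by (cases e) auto
  have eE: "(a, ps, c, ds) \<in> E" and vac: "v = a \<or> v = c" using e by (auto simp: ee inc_iff)
  obtain N1 E1 N2 E2 where r: "ltree N1 E1" "ltree N2 E2" "joins N1 E1 N2 E2 a ps c ds" "N = N1 \<union> N2" "E = insert (a, ps, c, ds) (E1 \<union> E2)"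
    using ltree_cut[OF t eE] by blast
  show ?thesis
  proof (cases "v = c")
    case True
    show ?thesis by (rule that[OF r(1,2) r(3)[folded True] r(4)]) (use r True in \<open>auto simp: ee\<close>)
  next
    case False
    then have va: "v = a" using vac by blast
    have j: "joins N2 E2 N1 E1 c (rev ps) v (rev (map Not ds))" using r(3) unfolding joins_def va by auto
    have l: "length ds = Suc (length ps)" using r(3) unfolding joins_def by blast
    have "arcs_of (rev (map Not ds)) (rev (v # ps @ [c])) = arcs_of ds (v # ps @ [c])"
      by (rule arcs_of_rev) (simp add: l)
    then show ?thesis
      by (intro that[OF r(2,1) j]) (use r va in \<open>auto simp: ee rev_map o_def\<close>)
  qed
qed

text \<open>A node of degree 2 is suppressed: the first cut leaves it with one path, the second cut
  isolates it, and the two remaining trees are joined by the concatenated path with \<open>v\<close>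
  as an inner vertex.\<close>

lemma ltree_eliminate:
  assumes t: "ltree N E" and v: "v \<in> N" "card (inc E v) = 2"
  obtains E' where "ltree (N - {v}) E'" "VV (N - {v}) E' = VV N E" "AA E' = AA E"
proof -
  obtain e1 e2 where e12: "inc E v = {e1, e2}" "e1 \<noteq> e2" using v(2) by (auto simp: card_2_iff)
  then have e1: "e1 \<in> inc E v" by blast
  obtain N1 E1 N2 a ps ds E2 where c1: "ltree N1 E1" "ltree N2 E2" "joins N1 E1 N2 E2 a ps v ds"
    "N = N1 \<union> N2" "E = insert e1 (E1 \<union> E2)" "e1 = (a, ps, v, ds) \<or> e1 = (v, rev ps, a, rev (map Not ds))" "AA {e1} = arcs_of ds (a # ps @ [v])"
    by (rule ltree_cut_at[OF t e1]) (rule that)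
  have vN: "v \<in> N2" "v \<notin> N1" "N1 \<inter> N2 = {}" using c1(3) VV_sup[of N1 E1] VV_sup[of N2 E2] unfolding joins_def by blast+
  have i1: "inc E1 v = {}" using ltree_edge[OF c1(1)] vN by (auto simp: inc_def)
  have iu: "inc E v = inc {e1} v \<union> inc E1 v \<union> inc E2 v" unfolding c1(5) by (auto simp: inc_def)
  have "inc {e1} v \<subseteq> {e1}" by (auto simp: inc_def)
  then have "inc E2 v \<subseteq> {e1, e2}" "e2 \<in> inc E2 v" using e12 iu unfolding i1 by blast+
  moreover have "e1 \<notin> E2"
  proof
    assume "e1 \<in> E2"
    then have "a \<in> N2" using c1(6) ltree_edge[OF c1(2)] by blast
    then show False using c1(3) vN unfolding joins_def by blast
  qed
  then have "e1 \<notin> inc E2 v" by (auto simp: inc_def)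
  ultimately have i2: "inc E2 v = {e2}" "e2 \<in> inc E2 v" by auto
  obtain N3 E3 N4 b qs es E4 where c2: "ltree N3 E3" "ltree N4 E4" "joins N3 E3 N4 E4 b qs v es"
    "N2 = N3 \<union> N4" "E2 = insert e2 (E3 \<union> E4)" "e2 = (b, qs, v, es) \<or> e2 = (v, rev qs, b, rev (map Not es))" "AA {e2} = arcs_of es (b # qs @ [v])"
    by (rule ltree_cut_at[OF c1(2) i2(2)]) (rule that)
  have vN4: "v \<in> N4" "v \<notin> N3" "N3 \<inter> N4 = {}" using c2(3) VV_sup[of N3 E3] VV_sup[of N4 E4] unfolding joins_def by blast+
  have "e2 \<notin> E4"
  proof
    assume "e2 \<in> E4"
    then have "b \<in> N4" using c2(6) ltree_edge[OF c2(2)] by blast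
    then show False using c2(3) vN4 unfolding joins_def by blast
  qed
  then have "inc E4 v = {}" using i2(1) unfolding c2(5) by (auto simp: inc_def)
  then have N4: "N4 = {v}" "E4 = {}" using ltree_isolated[OF c2(2) vN4(1)] by auto
  have l: "length ds = Suc (length ps)" "length es = Suc (length qs)" using c1(3) c2(3) unfolding joins_def by auto
  have VV2: "VV N2 E2 = VV N3 E3 \<union> {v} \<union> set qs" unfolding c2(4,5) N4 using c2(6) by (auto simp: VV_def)
  define e where "e = (a, ps @ v # rev qs, b, ds @ rev (map Not es))"
  have "joins N1 E1 N3 E3 a (ps @ v # rev qs) b (ds @ rev (map Not es))"
    using c1(3) c2(3) l unfolding joins_def VV2 N4 by auto
  then have lt: "ltree (N1 \<union> N3) (insert e (E1 \<union> E3))" unfolding e_def by (rule ltree.join[OF c1(1) c2(1)])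
  have N: "N - {v} = N1 \<union> N3" unfolding c1(4) c2(4) N4 using vN vN4 by auto
  have ins: "VV M (insert x Z) = VV M Z \<union> VV {} {x}" "AA (insert x Z) = AA {x} \<union> AA Z" for M :: "'a set" and x Z
    by (auto simp: VV_def AA_def)
  have V: "VV (N1 \<union> N3) (insert e (E1 \<union> E3)) = VV N E"
  proof -
    have "VV {} {e1} = set ps" using c1(6) by (elim disjE) (simp_all add: VV_def)
    moreover have "VV N E = VV N (E1 \<union> E2) \<union> VV {} {e1}" unfolding c1(5) by (rule ins(1))
    moreover have "VV N (E1 \<union> E2) = VV N1 E1 \<union> VV N2 E2" unfolding c1(4) by (rule VV_simps)
    ultimately have "VV N E = VV N1 E1 \<union> VV N2 E2 \<union> set ps" by (simp only:)
    moreover have "VV (N1 \<union> N3) (insert e (E1 \<union> E3)) = VV N1 E1 \<union> VV N3 E3 \<union> (set ps \<union> {v} \<union> set qs)" by (simp add: e_def)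
    ultimately show ?thesis unfolding VV2 by blast
  qed
  have "arcs_of (ds @ rev (map Not es)) ((a # ps) @ v # (rev qs @ [b])) = arcs_of ds ((a # ps) @ [v]) \<union> arcs_of (rev (map Not es)) (v # rev qs @ [b])"
    by (rule arcs_of_append) (simp add: l)
  moreover have "arcs_of (rev (map Not es)) (rev (b # qs @ [v])) = arcs_of es (b # qs @ [v])" by (rule arcs_of_rev) (simp add: l)
  ultimately have ae: "AA {e} = AA {e1} \<union> AA {e2}" unfolding c1(7) c2(7) by (simp add: e_def AA_def)
  have "AA (insert e (E1 \<union> E3)) = AA E"
  proof -
    have "AA (insert e (E1 \<union> E3)) = AA {e} \<union> AA (E1 \<union> E3)" "AA E = AA {e1} \<union> AA (E1 \<union> E2)" "AA E2 = AA {e2} \<union> AA (E3 \<union> E4)"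
      unfolding c1(5) c2(5) by (rule ins(2))+
    then show ?thesis unfolding ae AA_simps N4 by blast
  qed
  then show ?thesis using that[of "insert e (E1 \<union> E3)"] lt N V by simp
qed

lemma handshake:
  assumes "ltree N E"
  shows "(\<Sum>v\<in>N. card (inc E v)) = 2 * card E"
proof -
  have fin: "finite N" "finite E" using ltree_basic[OF assms] by auto
  define P where "P v e = (case e of (a, ps, c, ds) \<Rightarrow> v = a \<or> v = c)" for v :: 'a and e :: "'a edge"
  have "inc E v = {e\<in>E. P v e}" for v by (auto simp: inc_def P_def)
  then have "(\<Sum>v\<in>N. card (inc E v)) = (\<Sum>e\<in>E. card {v\<in>N. P v e})"
    using sum_card_swap[OF fin, of "\<lambda>e v. P v e"] by simp
  also have "\<dots> = (\<Sum>e\<in>E. 2)"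
  proof (rule sum.cong[OF refl])
    fix e assume "e \<in> E"
    obtain a ps c ds where e: "e = (a, ps, c, ds)" by (cases e) auto
    have "{v\<in>N. P v e} = {a, c}" "a \<noteq> c" using ltree_edge[OF assms, of a ps c ds] \<open>e \<in> E\<close> by (auto simp: P_def e)
    then show "card {v\<in>N. P v e} = 2" by simp
  qed
  finally show ?thesis by simp
qed

section \<open>Trees grown vertex by vertex, and their clusters\<close>

inductive vtree :: "'v \<Rightarrow> 'v set \<Rightarrow> ('v \<times> 'v) set \<Rightarrow> bool" for r where
  vtree_root: "vtree r {r} {}"
| vtree_out: "vtree r V A \<Longrightarrow> a \<in> V \<Longrightarrow> b \<notin> V \<Longrightarrow> vtree r (insert b V) (insert (a, b) A)"
| vtree_in: "vtree r V A \<Longrightarrow> a \<in> V \<Longrightarrow> b \<notin> V \<Longrightarrow> vtree r (insert b V) (insert (b, a) A)"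

lemma vtree_path:
  "vtree r V A \<Longrightarrow> a \<in> V \<Longrightarrow> set ps \<inter> V = {} \<Longrightarrow> distinct ps \<Longrightarrow> length ds = length ps \<Longrightarrow> vtree r (V \<union> set ps) (A \<union> arcs_of ds (a # ps))"
proof (induction ps arbitrary: V A a ds)
  case (Cons p ps)
  then obtain d ds' where ds: "ds = d # ds'" by (cases ds) auto
  have "vtree r (insert p V) (insert (if d then (a, p) else (p, a)) A)"
    using Cons.prems by (auto intro: vtree_out vtree_in)
  then have "vtree r (insert p V \<union> set ps) (insert (if d then (a, p) else (p, a)) A \<union> arcs_of ds' (p # ps))"
    by (rule Cons.IH) (use Cons.prems ds in auto)
  then show ?case by (simp add: ds)
qed simp

text \<open>The growth of the second tree is replayed from its root \<open>s\<close>, which is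
  already present; for this purpose the root is kept as a parameter.\<close>

lemma vtree_graft:
  assumes "vtree r V A" "s \<in> V"
  shows "vtree s V' A' \<Longrightarrow> V \<inter> V' = {s} \<Longrightarrow> vtree r (V \<union> V') (A \<union> A')"
proof (induction rule: vtree.induct)
  case vtree_root
  then show ?case using assms by (simp add: insert_absorb)
next
  case (vtree_out V' A' a b)
  have s: "s \<in> V'" using vtree_out(1) by (induction rule: vtree.induct) auto
  then have i: "V \<inter> V' = {s}" "b \<notin> V" using vtree_out by auto
  show ?case using vtree.vtree_out[OF vtree_out.IH[OF i(1)], of a b] vtree_out i by simp
next
  case (vtree_in V' A' a b)
  have s: "s \<in> V'" using vtree_in(1) by (induction rule: vtree.induct) auto
  then have i: "V \<inter> V' = {s}" "b \<notin> V" using vtree_in by auto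
  show ?case using vtree.vtree_in[OF vtree_in.IH[OF i(1)], of a b] vtree_in i by simp
qed

text \<open>The root is arbitrary because the induction needs it at a prescribed vertex of the other
  tree: the connecting path is grown up to its far end, and that tree is grafted there.\<close>

lemma ltree_vt: "ltree N E \<Longrightarrow> r \<in> N \<Longrightarrow> vtree r (VV N E) (AA E)"
proof (induction arbitrary: r rule: ltree.induct)
  case (single v)
  then show ?case by (auto intro: vtree_root)
next
  case (join N1 E1 N2 E2 a ps c ds)
  have j: "a \<in> N1" "c \<in> N2" "VV N1 E1 \<inter> VV N2 E2 = {}" "set ps \<inter> (VV N1 E1 \<union> VV N2 E2) = {}" "distinct ps" "length ds = Suc (length ps)"
    using join.hyps unfolding joins_def by auto
  have ac: "a \<in> VV N1 E1" "c \<in> VV N2 E2" using j VV_sup[of N1 E1] VV_sup[of N2 E2] by blast+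
  show ?case
  proof (cases "r \<in> N1")
    case True
    have "vtree r (VV N1 E1 \<union> set (ps @ [c])) (AA E1 \<union> arcs_of ds (a # ps @ [c]))"
      by (rule vtree_path[OF join.IH(1)[OF True]]) (use j ac in auto)
    then have "vtree r (VV N1 E1 \<union> set (ps @ [c]) \<union> VV N2 E2) (AA E1 \<union> arcs_of ds (a # ps @ [c]) \<union> AA E2)"
      by (rule vtree_graft[OF _ _ join.IH(2)[OF j(2)]]) (use j ac in auto)
    moreover have "VV N1 E1 \<union> set (ps @ [c]) \<union> VV N2 E2 = VV N1 E1 \<union> VV N2 E2 \<union> set ps"
      "AA E1 \<union> arcs_of ds (a # ps @ [c]) \<union> AA E2 = arcs_of ds (a # ps @ [c]) \<union> (AA E1 \<union> AA E2)" using ac by auto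
    ultimately show ?thesis by simp
  next
    case False
    then have r2: "r \<in> N2" using join.prems by blast
    have "vtree r (VV N2 E2 \<union> set (rev ps @ [a])) (AA E2 \<union> arcs_of (rev (map Not ds)) (c # rev ps @ [a]))"
      by (rule vtree_path[OF join.IH(2)[OF r2]]) (use j ac in auto)
    then have "vtree r (VV N2 E2 \<union> set (rev ps @ [a]) \<union> VV N1 E1) (AA E2 \<union> arcs_of (rev (map Not ds)) (c # rev ps @ [a]) \<union> AA E1)"
      by (rule vtree_graft[OF _ _ join.IH(1)[OF j(1)]]) (use j ac in auto)
    moreover have "arcs_of (rev (map Not ds)) (c # rev ps @ [a]) = arcs_of ds (a # ps @ [c])"
      using arcs_of_rev[of "a # ps @ [c]" ds] j(6) by simp
    moreover have "VV N2 E2 \<union> set (rev ps @ [a]) \<union> VV N1 E1 = VV N1 E1 \<union> VV N2 E2 \<union> set ps" using ac by auto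
    moreover have "AA E2 \<union> arcs_of ds (a # ps @ [c]) \<union> AA E1 = arcs_of ds (a # ps @ [c]) \<union> (AA E1 \<union> AA E2)" by auto
    ultimately show ?thesis by simp
  qed
qed

lemma vtree_clus:
  assumes "rtour R"
  shows "vtree r V A \<Longrightarrow> finite V \<and> V \<noteq> {} \<and> A \<subseteq> V \<times> V \<and> cluster R (1 + 20 * (card V - 1)) V A"
proof (induction rule: vtree.induct)
  case vtree_root
  then show ?case using cluster_single[of R r] by simp
next
  case (vtree_out V A a b)
  then have "cluster R (1 + 20 * (card V - 1) + 20) (insert b V) (insert (a, b) A)" by (intro cluster_out assms) auto
  moreover have "1 + 20 * (card V - 1) + 20 = 1 + 20 * (card (insert b V) - 1)"
    using vtree_out by (cases "card V") auto
  ultimately have "cluster R (1 + 20 * (card (insert b V) - 1)) (insert b V) (insert (a, b) A)" by (simp only:)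
  moreover have "finite (insert b V)" "insert b V \<noteq> {}" "insert (a, b) A \<subseteq> insert b V \<times> insert b V" using vtree_out by auto
  ultimately show ?case by blast
next
  case (vtree_in V A a b)
  then have "cluster R (1 + 20 * (card V - 1) + 20) (insert b V) (insert (b, a) A)" by (intro cluster_in assms) auto
  moreover have "1 + 20 * (card V - 1) + 20 = 1 + 20 * (card (insert b V) - 1)"
    using vtree_in by (cases "card V") auto
  ultimately have "cluster R (1 + 20 * (card (insert b V) - 1)) (insert b V) (insert (b, a) A)" by (simp only:)
  moreover have "finite (insert b V)" "insert b V \<noteq> {}" "insert (b, a) A \<subseteq> insert b V \<times> insert b V" using vtree_in by auto
  ultimately show ?case by blast
qed

lemma ltree_clus:
  assumes "rtour R" "ltree N E"
  shows "cluster R (1 + 20 * (\<Sum>(a, ps, c, ds)\<in>E. length ds)) (VV N E) (AA E)"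
proof -
  have "N \<noteq> {}" using ltree_basic[OF assms(2)] by auto
  then obtain r where r: "r \<in> N" by blast
  have "cluster R (1 + 20 * (card (VV N E) - 1)) (VV N E) (AA E)"
    using vtree_clus[OF assms(1) ltree_vt[OF assms(2) r]] by (elim conjE)
  then show ?thesis using ltree_basic[OF assms(2)] by simp
qed

section \<open>Attaching a long path\<close>

lemma port_mono_S:
  assumes "port R M g V A S t \<sigma> \<alpha>" "S' \<subseteq> S"
  shows "port R M g V A S' t \<sigma> \<alpha>"
  unfolding port_def
proof (intro allI impI)
  fix lo assume m: "med R lo (lo + int M)"
  then obtain \<phi> F where F: "sparse F lo (lo + int M)" "\<phi> ` S \<subseteq> F"
    and ex: "\<And>G. G \<inter> F = {} \<Longrightarrow> card (G \<inter> {lo..<lo + int M}) \<le> g \<Longrightarrow>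
         \<exists>f X. emb R A V ({lo..<lo + int M} - G) f \<and> (\<forall>s\<in>S. f s = \<phi> s) \<and> X \<subseteq> {lo..<lo + int M} - G - f ` V
            \<and> card X = \<alpha> \<and> (\<forall>x\<in>X. if \<sigma> then R (f t) x else R x (f t))"
    by (rule portE[OF assms(1)]) (rule that)
  show "\<exists>\<phi> F. sparse F lo (lo + int M) \<and> \<phi> ` S' \<subseteq> F \<and>
       (\<forall>G. G \<inter> F = {} \<and> card (G \<inter> {lo..<lo + int M}) \<le> g \<longrightarrow>
         (\<exists>f X. emb R A V ({lo..<lo + int M} - G) f \<and> (\<forall>s\<in>S'. f s = \<phi> s) \<and> X \<subseteq> {lo..<lo + int M} - G - f ` V
            \<and> card X = \<alpha> \<and> (\<forall>x\<in>X. if \<sigma> then R (f t) x else R x (f t))))"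
  proof (rule exI[of _ \<phi>], rule exI[of _ F], intro conjI allI impI)
    show "sparse F lo (lo + int M)" by (rule F)
    show "\<phi> ` S' \<subseteq> F" using F assms(2) by blast
    fix G assume G: "G \<inter> F = {} \<and> card (G \<inter> {lo..<lo + int M}) \<le> g"
    from ex[OF G[THEN conjunct1] G[THEN conjunct2]] obtain f X where f: "emb R A V ({lo..<lo + int M} - G) f" "\<forall>s\<in>S. f s = \<phi> s"
      "X \<subseteq> {lo..<lo + int M} - G - f ` V" "card X = \<alpha>" "\<forall>x\<in>X. if \<sigma> then R (f t) x else R x (f t)" by (elim exE conjE)
    have "\<forall>s\<in>S'. f s = \<phi> s" using f(2) assms(2) by blast
    then show "\<exists>f X. emb R A V ({lo..<lo + int M} - G) f \<and> (\<forall>s\<in>S'. f s = \<phi> s) \<and> X \<subseteq> {lo..<lo + int M} - G - f ` V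
            \<and> card X = \<alpha> \<and> (\<forall>x\<in>X. if \<sigma> then R (f t) x else R x (f t))"
      using f(1,3,4,5) by (intro exI[of _ f] exI[of _ X] conjI)
  qed
qed

text \<open>\<open>D\<close> is a set of dummy leaves at \<open>a\<close>. If the first block is short, the dummies themselves provide the \<open>b + 3\<close> neighbours; otherwise a single dummy becomes the first vertex of \<open>ps\<close>, and the directed path is continued from there to the end of the block.\<close>

lemma port_side:
  fixes V1 :: "nat set"
  assumes R: "rtour R"
    and star: "\<And>\<sigma> D. finite D \<Longrightarrow> D \<inter> V1 = {} \<Longrightarrow> D \<inter> Lf = {} \<Longrightarrow>
      good R (B1 + 20 * card D) (g + 2) (V1 \<union> D) (A1 \<union> (\<lambda>x. if \<sigma> then (a, x) else (x, a)) ` D) (S1 \<union> D)"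
    and fin: "finite V1" "finite Lf" and S: "S1 \<subseteq> V1" "a \<in> S1" and A: "A1 \<subseteq> V1 \<times> V1"
    and ps: "distinct ps" "set ps \<inter> V1 = {}" "hd ps \<notin> Lf" "b < length ps" and b: "0 < b"
  obtains i b' \<sigma>' T M' where "b' + i = b" "0 < b'" "\<sigma> # replicate i d = T @ [\<sigma>']" "M' \<le> B1 + i + 140 + 4 * g"
    "port R M' g (V1 \<union> set (take i ps)) (A1 \<union> arcs_of T (a # take i ps)) S1 (last (a # take i ps)) \<sigma>' (b' + 3)"
proof (cases "b \<le> 4")
  case True
  \<comment> \<open>Fresh dummies always exist because vertices are natural numbers. At most seven
    are used, which gives the constant 140.\<close>
  have "infinite (- (V1 \<union> Lf))" using fin by (simp add: Compl_eq_Diff_UNIV)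
  then obtain D where D: "finite D" "card D = b + 3" "D \<subseteq> - (V1 \<union> Lf)"
    using infinite_arbitrarily_large by metis
  have "good R (B1 + 20 * card D) (g + 2) (V1 \<union> D) (A1 \<union> (\<lambda>x. if \<sigma> then (a, x) else (x, a)) ` D) (S1 \<union> D)"
    by (rule star) (use D in auto)
  then have "good R (B1 + 20 * card D) g (V1 \<union> D) (A1 \<union> (\<lambda>x. if \<sigma> then (a, x) else (x, a)) ` D) (S1 \<union> D)"
    by (rule good_mono) auto
  then have "port R (B1 + 20 * card D) g V1 A1 S1 a \<sigma> (card D)"
    by (rule port_star) (use D S A in auto)
  then show ?thesis
    using True b D(2) by (intro that[of b 0 "[]" \<sigma> "B1 + 20 * card D"]) auto
next
  case False
  obtain p1 qs where pq: "ps = p1 # qs" using ps(4) by (cases ps) auto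
  \<comment> \<open>The list \<open>rs\<close> must have three elements for
    \<open>port_long\<close>, hence the case split at 4. Only \<open>b' = 1\<close> is left of the
    block, so \<open>4 = 1 + 3\<close> offered neighbours are enough.\<close>
  define rs where "rs = take (b - 2) qs"
  have rs: "length rs = b - 2" "set rs \<subseteq> set qs" "distinct rs" using ps pq by (auto simp: rs_def dest: in_set_takeD)
  have t: "take (b - 1) ps = p1 # rs" using False by (cases "b - 1") (auto simp: pq rs_def numeral_2_eq_2 diff_Suc split: nat.splits)
  have "good R (B1 + 20 * card {p1}) (g + 2) (V1 \<union> {p1}) (A1 \<union> (\<lambda>x. if \<sigma> then (a, x) else (x, a)) ` {p1}) (S1 \<union> {p1})"
    by (rule star) (use ps pq in auto)
  then have "port R (B1 + 20 * card {p1} + length rs + 59 + 4 * g + 2 * 4) g (V1 \<union> {p1} \<union> set rs)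
      (A1 \<union> (\<lambda>x. if \<sigma> then (a, x) else (x, a)) ` {p1} \<union> arcs_of (replicate (length rs) d) (p1 # rs)) (S1 \<union> {p1}) (last rs) d 4"
    by (rule port_long[OF R]) (use False rs ps pq A S in auto)
  then have "port R (B1 + 20 * card {p1} + length rs + 59 + 4 * g + 2 * 4) g (V1 \<union> {p1} \<union> set rs)
      (A1 \<union> (\<lambda>x. if \<sigma> then (a, x) else (x, a)) ` {p1} \<union> arcs_of (replicate (length rs) d) (p1 # rs)) S1 (last rs) d 4"
    by (rule port_mono_S) auto
  moreover have "V1 \<union> {p1} \<union> set rs = V1 \<union> set (take (b - 1) ps)" unfolding t by auto
  moreover have "A1 \<union> (\<lambda>x. if \<sigma> then (a, x) else (x, a)) ` {p1} \<union> arcs_of (replicate (length rs) d) (p1 # rs)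
      = A1 \<union> arcs_of (\<sigma> # replicate (b - 2) d) (a # take (b - 1) ps)" unfolding t rs(1) by auto
  moreover have "last rs = last (a # take (b - 1) ps)" unfolding t using rs(1) False by auto
  ultimately have P: "port R (B1 + 20 * card {p1} + length rs + 59 + 4 * g + 2 * 4) g (V1 \<union> set (take (b - 1) ps))
      (A1 \<union> arcs_of (\<sigma> # replicate (b - 2) d) (a # take (b - 1) ps)) S1 (last (a # take (b - 1) ps)) d (1 + 3)" by simp
  have "b - 1 = Suc (b - 2)" using False by simp
  then have "\<sigma> # replicate (b - 1) d = (\<sigma> # replicate (b - 2) d) @ [d]" by (simp add: replicate_append_same)
  then show ?thesis
    using P False rs(1)
    by (intro that[of 1 "b - 1" "\<sigma> # replicate (b - 2) d" d "B1 + 20 * card {p1} + length rs + 59 + 4 * g + 2 * 4"]) simp_all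
qed

lemma good_eq: "good R M g V A S \<Longrightarrow> V = V' \<Longrightarrow> A = A' \<Longrightarrow> M \<le> M' \<Longrightarrow> S' \<subseteq> S \<Longrightarrow> good R M' g V' A' S'"
  using good_mono[of R M g V A S M' g S'] by simp

lemma arcs_of_flip:
  "arcs_of (replicate (Suc (length mid)) False) (p # mid @ [q]) = arcs_of (replicate (Suc (length mid)) True) (q # rev mid @ [p])"
  using arcs_of_rev[of "q # rev mid @ [p]" "replicate (Suc (length mid)) True"] by (simp add: replicate_append_same)

lemma arcs_of_mid:
  assumes "length mid = length Q - 1" "Q \<noteq> []"
  shows "arcs_of (d1 # Q @ [dL]) (a # p # mid @ q # [c]) =
    insert (if d1 then (a, p) else (p, a)) (insert (if dL then (q, c) else (c, q)) (arcs_of Q (p # mid @ [q])))"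
proof -
  have "arcs_of (Q @ [dL]) ((p # mid) @ q # [c]) = arcs_of Q ((p # mid) @ [q]) \<union> arcs_of [dL] (q # [c])"
    by (rule arcs_of_append) (use assms in \<open>cases Q; simp\<close>)
  then show ?thesis by auto
qed

text \<open>Blocks are counted without the first and the last arc, which are realised with the help
  of dummies and may point either way. If the rest is directed, \<open>p\<close> and
  \<open>q\<close> are hung on as single dummies and \<open>long_merge\<close> joins them; otherwise
  two ports are joined by a bent path. The second case determines the constant:
  \<open>140 + 140 + 10\<close> is at most 300.\<close>

lemma attach_inner:
  fixes V1 :: "nat set"
  assumes R: "rtour R"
    and star1: "\<And>\<sigma> D. finite D \<Longrightarrow> D \<inter> V1 = {} \<Longrightarrow> D \<inter> Lf = {} \<Longrightarrow>
      good R (B1 + 20 * card D) (g + 2) (V1 \<union> D) (A1 \<union> (\<lambda>x. if \<sigma> then (a, x) else (x, a)) ` D) (S1 \<union> D)"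
    and star2: "\<And>\<sigma> D. finite D \<Longrightarrow> D \<inter> V2 = {} \<Longrightarrow> D \<inter> Lf = {} \<Longrightarrow>
      good R (B2 + 20 * card D) (g + 2) (V2 \<union> D) (A2 \<union> (\<lambda>x. if \<sigma> then (c, x) else (x, c)) ` D) (S2 \<union> D)"
    and fin: "finite V1" "finite V2" "finite Lf" and S: "S1 \<subseteq> V1" "a \<in> S1" "S2 \<subseteq> V2" "c \<in> S2"
    and A: "A1 \<subseteq> V1 \<times> V1" "A2 \<subseteq> V2 \<times> V2"
    and dj: "V1 \<inter> V2 = {}" "set ps \<inter> (V1 \<union> V2) = {}" "distinct ps" "set ps \<inter> Lf = {}"
    and len: "length ds = Suc (length ps)" "8 \<le> length ds"
  shows "good R (B1 + B2 + length ps + 300 + 12 * g) g (V1 \<union> V2 \<union> set ps) (A1 \<union> A2 \<union> arcs_of ds (a # ps @ [c])) (S1 \<union> S2)"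
proof -
  obtain p ps' where p: "ps = p # ps'" "ps' \<noteq> []" using len by (cases ps; cases "tl ps") auto
  then obtain mid q where pm: "ps = p # mid @ [q]" by (metis rev_exhaust)
  obtain d1 ds' where d1: "ds = d1 # ds'" "ds' \<noteq> []" using len by (cases ds; cases "tl ds") auto
  then obtain Q dL where dQ: "ds = d1 # Q @ [dL]" by (metis rev_exhaust)
  have lQ: "length Q = Suc (length mid)" "5 \<le> length mid" "length ps = length mid + 2" using len by (auto simp: pm dQ)
  obtain d bs where bs: "Q = pat d bs" "\<forall>b\<in>set bs. 0 < b" using ex_pat[of Q] by blast
  have bne: "bs \<noteq> []" using bs(1) lQ by auto
  show ?thesis
  proof (cases "length bs = 1")
    case True
    then obtain n where "bs = [n]" by (auto simp: length_Suc_conv)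
    then have Q: "Q = replicate (Suc (length mid)) d" using bs(1) lQ by auto
    have g1: "good R (B1 + 20 * card {p}) (g + 2) (V1 \<union> {p}) (A1 \<union> (\<lambda>x. if d1 then (a, x) else (x, a)) ` {p}) (S1 \<union> {p})"
      by (rule star1) (use dj pm in auto)
    have g2: "good R (B2 + 20 * card {q}) (g + 2) (V2 \<union> {q}) (A2 \<union> (\<lambda>x. if \<not> dL then (c, x) else (x, c)) ` {q}) (S2 \<union> {q})"
      by (rule star2) (use dj pm in auto)
    have am: "arcs_of ds (a # ps @ [c]) = insert (if d1 then (a, p) else (p, a)) (insert (if dL then (q, c) else (c, q)) (arcs_of Q (p # mid @ [q])))"
    proof -
      have "length mid = length Q - 1" "Q \<noteq> []" using lQ by auto
      from arcs_of_mid[OF this, of d1 dL a p q c] show ?thesis unfolding dQ pm by simp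
    qed
    show ?thesis
    proof (cases d)
      case True
      have "good R ((B1 + 20 * card {p}) + (B2 + 20 * card {q}) + length mid + 56 + 12 * g) g ((V1 \<union> {p}) \<union> (V2 \<union> {q}) \<union> set mid)
           ((A1 \<union> (\<lambda>x. if d1 then (a, x) else (x, a)) ` {p}) \<union> (A2 \<union> (\<lambda>x. if \<not> dL then (c, x) else (x, c)) ` {q})
             \<union> arcs_of (replicate (Suc (length mid)) True) (p # mid @ [q])) ((S1 \<union> {p}) \<union> (S2 \<union> {q}))"
        by (rule long_merge[OF R g1 g2]) (use dj pm A S lQ in auto)
      then show ?thesis
        by (rule good_eq) (use pm lQ True Q am in auto)
    next
      \<comment> \<open>The middle path is now directed from \<open>q\<close> to \<open>p\<close>,
        so the two pieces change places on the line.\<close>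
      case False
      have "good R ((B2 + 20 * card {q}) + (B1 + 20 * card {p}) + length (rev mid) + 56 + 12 * g) g ((V2 \<union> {q}) \<union> (V1 \<union> {p}) \<union> set (rev mid))
           ((A2 \<union> (\<lambda>x. if \<not> dL then (c, x) else (x, c)) ` {q}) \<union> (A1 \<union> (\<lambda>x. if d1 then (a, x) else (x, a)) ` {p})
             \<union> arcs_of (replicate (Suc (length (rev mid))) True) (q # rev mid @ [p])) ((S2 \<union> {q}) \<union> (S1 \<union> {p}))"
        by (rule long_merge[OF R g2 g1]) (use dj pm A S lQ in auto)
      moreover have "arcs_of Q (p # mid @ [q]) = arcs_of (replicate (Suc (length (rev mid))) True) (q # rev mid @ [p])"
        using False Q arcs_of_flip[of mid p q] by simp
      ultimately show ?thesis
        by (elim good_eq) (use pm lQ am in auto)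
    qed
  next
    case False
    then obtain b ms bl where bs_eq: "bs = b # ms @ [bl]"
      using bne by (cases bs) (auto, metis rev_exhaust)
    define e where "e = (if even (length (b # ms)) then d else \<not> d)"
    have patb: "pat d (x # ms @ [y]) = replicate x d @ pat (\<not> d) ms @ replicate y e" for x y
      using pat_snoc[of d "x # ms" y] by (simp add: e_def)
    have lps: "length ps = Suc (b + sum_list ms + bl)" using lQ bs(1) bs_eq by simp
    have pos: "0 < b" "0 < bl" "\<forall>x\<in>set ms. 0 < x" using bs(2) bs_eq by auto
    have h1: "set ps \<inter> V1 = {}" "hd ps \<notin> Lf" "b < length ps"
      and h2: "distinct (rev ps)" "set (rev ps) \<inter> V2 = {}" "hd (rev ps) \<notin> Lf" "bl < length (rev ps)"
      using dj pm lps by auto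
    obtain i1 b1 \<sigma>1 T1 M1 where s1: "b1 + i1 = b" "0 < b1" "d1 # replicate i1 d = T1 @ [\<sigma>1]" "M1 \<le> B1 + i1 + 140 + 4 * g"
      "port R M1 g (V1 \<union> set (take i1 ps)) (A1 \<union> arcs_of T1 (a # take i1 ps)) S1 (last (a # take i1 ps)) \<sigma>1 (b1 + 3)"
      by (rule port_side[OF R _ fin(1,3) S(1,2) A(1) dj(3) h1 pos(1), where d = d and \<sigma> = d1]) ((rule star1; assumption), (rule that))
    obtain i2 b2 \<sigma>2 T2 M2 where s2: "b2 + i2 = bl" "0 < b2" "(\<not> dL) # replicate i2 (\<not> e) = T2 @ [\<sigma>2]" "M2 \<le> B2 + i2 + 140 + 4 * g"
      "port R M2 g (V2 \<union> set (take i2 (rev ps))) (A2 \<union> arcs_of T2 (c # take i2 (rev ps))) S2 (last (c # take i2 (rev ps))) \<sigma>2 (b2 + 3)"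
      by (rule port_side[OF R _ fin(2,3) S(3,4) A(2) h2 pos(2), where d = "\<not> e" and \<sigma> = "\<not> dL"]) ((rule star2; assumption), (rule that))
    define P1 where "P1 = take i1 ps"
    define mid' where "mid' = take (length ps - i1 - i2) (drop i1 ps)"
    define P3 where "P3 = drop (length ps - i2) ps"
    have i12: "i1 + i2 \<le> length ps" using s1(1) s2(1) lps by simp
    have ps3: "ps = P1 @ mid' @ P3"
    proof -
      have "drop (length ps - i1 - i2) (drop i1 ps) = P3" unfolding P3_def drop_drop using i12 by (simp add: algebra_simps)
      then have "drop i1 ps = mid' @ P3" unfolding mid'_def by (metis append_take_drop_id)
      then show ?thesis unfolding P1_def by (metis append_take_drop_id)
    qed
    have tr: "take i2 (rev ps) = rev P3" by (simp add: P3_def take_rev)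
    have lP: "length P1 = i1" "length P3 = i2" using i12 by (auto simp: P1_def P3_def)
    have lmid: "length mid' = Suc (b1 + sum_list ms + b2)" 
      using arg_cong[OF ps3, of length] lP lps s1(1) s2(1) by simp
    define t1 where "t1 = last (a # P1)"
    define t2 where "t2 = last (c # rev P3)"
    define U where "U = butlast (a # P1)"
    define Z where "Z = butlast (c # rev P3)"
    have UZ: "a # P1 = U @ [t1]" "c # rev P3 = Z @ [t2]" unfolding U_def Z_def t1_def t2_def
      by (rule append_butlast_last_id[symmetric]; simp)+
    have lT: "length T1 = i1" "length T2 = i2" using arg_cong[OF s1(3), of length] arg_cong[OF s2(3), of length] by auto
    have lU: "length U = i1" using arg_cong[OF UZ(1), of length] lP by simp
    define X where "X = \<sigma>1 # pat d (b1 # ms @ [b2]) @ [\<not> \<sigma>2]"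
    \<comment> \<open>The port at \<open>c\<close> is built along the reversed path, so its
      directions \<open>T2\<close> reappear reversed and negated; \<open>X\<close> is the part of
      the pattern between the two ports.\<close>
    have dsX: "ds = T1 @ X @ rev (map Not T2)"
    proof -
      have r1: "replicate b d = replicate i1 d @ replicate b1 d" using s1(1) by (metis add.commute replicate_add)
      have r2: "replicate bl e = replicate b2 e @ replicate i2 e" using s2(1) by (metis replicate_add)
      have "rev (map Not (T2 @ [\<sigma>2])) = rev (map Not ((\<not> dL) # replicate i2 (\<not> e)))" using s2(3) by simp
      then have r3: "replicate i2 e @ [dL] = (\<not> \<sigma>2) # rev (map Not T2)" by simp
      have "ds = d1 # replicate b d @ pat (\<not> d) ms @ replicate bl e @ [dL]" unfolding dQ bs(1) bs_eq patb by simp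
      also have "\<dots> = (d1 # replicate i1 d) @ replicate b1 d @ pat (\<not> d) ms @ replicate b2 e @ (replicate i2 e @ [dL])" unfolding r1 r2 by simp
      also have "\<dots> = T1 @ X @ rev (map Not T2)" unfolding s1(3) r3 X_def patb by simp
      finally show ?thesis .
    qed
    have psX: "a # ps @ [c] = U @ t1 # (mid' @ t2 # rev Z)"
    proof -
      have "P3 @ [c] = rev (Z @ [t2])" using UZ(2) by (metis rev.simps(2) rev_rev_ident)
      then have "a # ps @ [c] = (a # P1) @ mid' @ rev (Z @ [t2])" using arg_cong[OF ps3, of "\<lambda>z. a # z @ [c]"] by simp
      then show ?thesis unfolding UZ(1) by simp
    qed
    have lX: "length X = length (t1 # mid')" by (simp add: X_def lmid)
    have arcs: "arcs_of ds (a # ps @ [c]) = arcs_of T1 (a # P1) \<union> arcs_of X (t1 # mid' @ [t2]) \<union> arcs_of T2 (c # rev P3)"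
    proof -
      have "arcs_of (T1 @ (X @ rev (map Not T2))) (U @ t1 # (mid' @ t2 # rev Z))
        = arcs_of T1 (U @ [t1]) \<union> arcs_of (X @ rev (map Not T2)) (t1 # (mid' @ t2 # rev Z))"
        by (rule arcs_of_append) (simp add: lT lU)
      moreover have "arcs_of (X @ rev (map Not T2)) ((t1 # mid') @ t2 # rev Z) = arcs_of X ((t1 # mid') @ [t2]) \<union> arcs_of (rev (map Not T2)) (t2 # rev Z)"
        by (rule arcs_of_append[OF lX])
      moreover have "arcs_of (rev (map Not T2)) (rev (Z @ [t2])) = arcs_of T2 (Z @ [t2])"
        by (rule arcs_of_rev) (use arg_cong[OF UZ(2), of length] lT lP in simp)
      ultimately show ?thesis unfolding dsX psX UZ by auto
    qed
    have pr1: "port R M1 g (V1 \<union> set P1) (A1 \<union> arcs_of T1 (a # P1)) S1 t1 \<sigma>1 (b1 + 3)"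
      using s1(5) unfolding P1_def[symmetric] t1_def by simp
    have pr2: "port R M2 g (V2 \<union> set (rev P3)) (A2 \<union> arcs_of T2 (c # rev P3)) S2 t2 \<sigma>2 (b2 + 3)"
      using s2(5) unfolding tr t2_def by simp
    have t12: "t1 \<in> V1 \<union> set P1" "t2 \<in> V2 \<union> set (rev P3)"
      using last_in_set[of "a # P1"] last_in_set[of "c # rev P3"] S by (auto simp: t1_def t2_def)
    have sps: "set ps = set P1 \<union> set mid' \<union> set P3" "set P1 \<inter> set P3 = {}" "set mid' \<inter> (set P1 \<union> set P3) = {}" "distinct mid'"
      using dj(3) unfolding ps3 by auto
    have "A1 \<union> arcs_of T1 (a # P1) \<subseteq> (V1 \<union> set P1) \<times> (V1 \<union> set P1)"
      using A S arcs_of_sub[of T1 "a # P1"] by fastforce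
    moreover have "A2 \<union> arcs_of T2 (c # rev P3) \<subseteq> (V2 \<union> set (rev P3)) \<times> (V2 \<union> set (rev P3))"
      using A S arcs_of_sub[of T2 "c # rev P3"] by fastforce
    ultimately have "good R (M1 + M2 + length mid' + 10 + g) g ((V1 \<union> set P1) \<union> (V2 \<union> set (rev P3)) \<union> set mid')
       ((A1 \<union> arcs_of T1 (a # P1)) \<union> (A2 \<union> arcs_of T2 (c # rev P3)) \<union> arcs_of X (t1 # mid' @ [t2])) (S1 \<union> S2)"
      unfolding X_def
      by (intro bent_path_inner[OF R pr1 pr2]) (use S t12 dj sps s1(2) s2(2) pos lmid in auto)
    then show ?thesis
    proof (rule good_eq)
      show "V1 \<union> set P1 \<union> (V2 \<union> set (rev P3)) \<union> set mid' = V1 \<union> V2 \<union> set ps" using sps(1) by auto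
      show "A1 \<union> arcs_of T1 (a # P1) \<union> (A2 \<union> arcs_of T2 (c # rev P3)) \<union> arcs_of X (t1 # mid' @ [t2]) = A1 \<union> A2 \<union> arcs_of ds (a # ps @ [c])"
        unfolding arcs by auto
      have "length ps = i1 + length mid' + i2" using arg_cong[OF ps3, of length] lP by simp
      then show "M1 + M2 + length mid' + 10 + g \<le> B1 + B2 + length ps + 300 + 12 * g" using s1(4) s2(4) by linarith
    qed simp
  qed
qed

text \<open>The last arc is counted among the blocks here, since nothing else is attached to
  \<open>c\<close> and its position need not be fixed. One port at \<open>a\<close> and ten spare
  positions give \<open>140 + 10\<close>, which is at most 160.\<close>

lemma attach_leaf:
  fixes V1 :: "nat set"
  assumes R: "rtour R"
    and star1: "\<And>\<sigma> D. finite D \<Longrightarrow> D \<inter> V1 = {} \<Longrightarrow> D \<inter> Lf = {} \<Longrightarrow>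
      good R (B1 + 20 * card D) (g + 2) (V1 \<union> D) (A1 \<union> (\<lambda>x. if \<sigma> then (a, x) else (x, a)) ` D) (S1 \<union> D)"
    and fin: "finite V1" "finite Lf" and S: "S1 \<subseteq> V1" "a \<in> S1"
    and A: "A1 \<subseteq> V1 \<times> V1"
    and dj: "c \<notin> V1" "set ps \<inter> insert c V1 = {}" "distinct ps" "set ps \<inter> Lf = {}"
    and len: "length ds = Suc (length ps)" "8 \<le> length ds"
  shows "good R (B1 + 1 + length ps + 160 + 12 * g) g (V1 \<union> {c} \<union> set ps) (A1 \<union> arcs_of ds (a # ps @ [c])) S1"
proof -
  obtain p mid where pm: "ps = p # mid" using len by (cases ps) auto
  obtain d1 Q where dQ: "ds = d1 # Q" using len by (cases ds) auto
  have lQ: "length Q = Suc (length mid)" "6 \<le> length mid" "length ps = length mid + 1" using len by (auto simp: pm dQ)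
  obtain d bs where bs: "Q = pat d bs" "\<forall>b\<in>set bs. 0 < b" using ex_pat[of Q] by blast
  have bne: "bs \<noteq> []" using bs(1) lQ by auto
  show ?thesis
  proof (cases "length bs = 1")
    case True
    then obtain n where "bs = [n]" by (auto simp: length_Suc_conv)
    then have Q: "Q = replicate (Suc (length mid)) d" using bs(1) lQ by auto
    have g1: "good R (B1 + 20 * card {p}) (g + 2) (V1 \<union> {p}) (A1 \<union> (\<lambda>x. if d1 then (a, x) else (x, a)) ` {p}) (S1 \<union> {p})"
      by (rule star1) (use dj pm in auto)
    have g2: "good R 1 (g + 2) {c} {} {c}" by (rule cluster_good[OF cluster_single])
    have am: "arcs_of ds (a # ps @ [c]) = insert (if d1 then (a, p) else (p, a)) (arcs_of Q (p # mid @ [c]))"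
      unfolding dQ pm by simp
    show ?thesis
    proof (cases d)
      case True
      have "good R ((B1 + 20 * card {p}) + 1 + length mid + 56 + 12 * g) g ((V1 \<union> {p}) \<union> {c} \<union> set mid)
           ((A1 \<union> (\<lambda>x. if d1 then (a, x) else (x, a)) ` {p}) \<union> {}
             \<union> arcs_of (replicate (Suc (length mid)) True) (p # mid @ [c])) ((S1 \<union> {p}) \<union> {c})"
        by (rule long_merge[OF R g1 g2]) (use dj pm A S lQ in auto)
      then show ?thesis
        by (rule good_eq) (use pm lQ True Q am in auto)
    next
      case False
      have "good R (1 + (B1 + 20 * card {p}) + length (rev mid) + 56 + 12 * g) g ({c} \<union> (V1 \<union> {p}) \<union> set (rev mid))
           ({} \<union> (A1 \<union> (\<lambda>x. if d1 then (a, x) else (x, a)) ` {p})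
             \<union> arcs_of (replicate (Suc (length (rev mid))) True) (c # rev mid @ [p])) ({c} \<union> (S1 \<union> {p}))"
        by (rule long_merge[OF R g2 g1]) (use dj pm A S lQ in auto)
      moreover have "arcs_of Q (p # mid @ [c]) = arcs_of (replicate (Suc (length (rev mid))) True) (c # rev mid @ [p])"
        using False Q arcs_of_flip[of mid p c] by simp
      ultimately show ?thesis
        by (elim good_eq) (use pm lQ am in auto)
    qed
  next
    case False
    then obtain b ms where bs_eq: "bs = b # ms" "ms \<noteq> []"
      using bne by (cases bs) auto
    define qs where "qs = ps @ [c]"
    have lqs: "length qs = Suc (b + sum_list ms)" using lQ bs(1) bs_eq by (simp add: qs_def)
    have pos: "0 < b" "\<forall>x\<in>set ms. 0 < x" using bs(2) bs_eq by auto
    have bq: "b < length qs" using lqs by simp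
    have qd: "distinct qs" "set qs \<inter> V1 = {}" "hd qs \<notin> Lf" using dj pm by (auto simp: qs_def)
    obtain i1 b1 \<sigma>1 T1 M1 where s1: "b1 + i1 = b" "0 < b1" "d1 # replicate i1 d = T1 @ [\<sigma>1]" "M1 \<le> B1 + i1 + 140 + 4 * g"
      "port R M1 g (V1 \<union> set (take i1 qs)) (A1 \<union> arcs_of T1 (a # take i1 qs)) S1 (last (a # take i1 qs)) \<sigma>1 (b1 + 3)"
      by (rule port_side[OF R _ fin S A qd bq pos(1), where d = d and \<sigma> = d1]) ((rule star1; assumption), (rule that))
    define P1 where "P1 = take i1 qs"
    define P2 where "P2 = drop i1 qs"
    have qs2: "qs = P1 @ P2" by (simp add: P1_def P2_def)
    have lP: "length P1 = i1" "length P2 = Suc (b1 + sum_list ms)" using s1(1) lqs by (auto simp: P1_def P2_def)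
    define t1 where "t1 = last (a # P1)"
    define U where "U = butlast (a # P1)"
    have UZ: "a # P1 = U @ [t1]" unfolding U_def t1_def
      by (rule append_butlast_last_id[symmetric]) simp
    have lT: "length T1 = i1" using arg_cong[OF s1(3), of length] by auto
    have lU: "length U = i1" using arg_cong[OF UZ(1), of length] lP by simp
    define X where "X = \<sigma>1 # pat d (b1 # ms)"
    have r1: "replicate b d = replicate i1 d @ replicate b1 d" using s1(1) by (metis add.commute replicate_add)
    have "ds = (d1 # replicate i1 d) @ replicate b1 d @ pat (\<not> d) ms" unfolding dQ bs(1) bs_eq by (simp add: r1)
    then have dsX: "ds = T1 @ X" unfolding s1(3) X_def by simp
    have "arcs_of (T1 @ X) (U @ t1 # P2) = arcs_of T1 (U @ [t1]) \<union> arcs_of X (t1 # P2)"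
      by (rule arcs_of_append) (simp add: lT lU)
    moreover have "a # ps @ [c] = U @ t1 # P2" using qs2 UZ unfolding qs_def by (metis append_Cons append_assoc append_Nil)
    ultimately have arcs: "arcs_of ds (a # ps @ [c]) = arcs_of T1 (a # P1) \<union> arcs_of X (t1 # P2)" unfolding dsX UZ by simp
    have pr1: "port R M1 g (V1 \<union> set P1) (A1 \<union> arcs_of T1 (a # P1)) S1 t1 \<sigma>1 (b1 + 3)"
      using s1(5) unfolding P1_def[symmetric] t1_def by simp
    have t12: "t1 \<in> V1 \<union> set P1" using last_in_set[of "a # P1"] S by (auto simp: t1_def)
    have sps: "set qs = set P1 \<union> set P2" "set P1 \<inter> set P2 = {}" "distinct P2" using qd(1) unfolding qs2 by auto
    have "A1 \<union> arcs_of T1 (a # P1) \<subseteq> (V1 \<union> set P1) \<times> (V1 \<union> set P1)"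
      using A S arcs_of_sub[of T1 "a # P1"] by fastforce
    then have "good R (M1 + length P2 + 10 + g) g ((V1 \<union> set P1) \<union> set P2)
       ((A1 \<union> arcs_of T1 (a # P1)) \<union> arcs_of X (t1 # P2)) S1"
      unfolding X_def
      by (intro bent_path_leaf[OF R pr1]) (use S t12 qd sps s1(2) pos lP bs_eq in \<open>auto simp: Suc_le_eq\<close>)
    then show ?thesis
    proof (rule good_eq)
      show "V1 \<union> set P1 \<union> set P2 = V1 \<union> {c} \<union> set ps" using sps(1) by (auto simp: qs_def)
      show "A1 \<union> arcs_of T1 (a # P1) \<union> arcs_of X (t1 # P2) = A1 \<union> arcs_of ds (a # ps @ [c])"
        unfolding arcs by auto
      have "length ps + 1 = i1 + length P2" using arg_cong[OF qs2, of length] lP by (simp add: qs_def)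
      then show "M1 + length P2 + 10 + g \<le> B1 + 1 + length ps + 160 + 12 * g" using s1(4) by linarith
    qed simp
  qed
qed

section \<open>The main induction\<close>

text \<open>Only the loss beyond one position per vertex is counted: a cluster takes 20 positions
  for each arc, 19 of them extra. The threshold 8 comes from \<open>long_merge\<close>, which needs
  five inner vertices besides the two dummies. A shorter path loses at most
  \<open>19 * 7 = 133\<close>, so every path that ends in \<open>Lf\<close>, long or short, loses at
  most 160.\<close>

definition cost :: "'v set \<Rightarrow> 'v edge \<Rightarrow> nat" where
  "cost Lf = (\<lambda>(a, ps, c, ds). if 8 \<le> length ds then if a \<in> Lf \<or> c \<in> Lf then 160 else 300 else 19 * length ds)"

definition long_edges :: "'v edge set \<Rightarrow> 'v edge set" where
  "long_edges E = {(a, ps, c, ds)\<in>E. 8 \<le> length ds}"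

text \<open>Every long path loses \<open>12 * g\<close> positions, and cutting it raises \<open>g\<close> by 2 for all remaining ones.\<close>

definition nesting_cost :: "nat \<Rightarrow> nat \<Rightarrow> nat" where
  "nesting_cost g l = 12 * (g * l + l * (l - 1))"

text \<open>The set \<open>Lf\<close> is meant to hold the leaves of the whole tree and is passed
  unchanged to all subtrees. Dummies and nodes that become leaves only by cutting stay outside it,
  because their positions have to be fixed in advance. The last condition guarantees that the other
  end of a path to a leaf can carry dummies.\<close>

definition leaf_admissible :: "'v set \<Rightarrow> 'v set \<Rightarrow> 'v edge set \<Rightarrow> bool" where
  "leaf_admissible Lf N E \<longleftrightarrow> finite Lf \<and> Lf \<inter> (VV N E - N) = {} \<and> (\<forall>v\<in>N \<inter> Lf. card (inc E v) \<le> 1) \<and>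
     (\<forall>(a, ps, c, ds)\<in>E. a \<notin> Lf \<or> c \<notin> Lf)"

definition bound :: "'v set \<Rightarrow> 'v set \<Rightarrow> 'v edge set \<Rightarrow> nat \<Rightarrow> nat" where
  "bound Lf N E g = card (VV N E) + (\<Sum>e\<in>E. cost Lf e) + nesting_cost g (card (long_edges E))"

text \<open>With \<open>g\<close> raised by 2 the quadratic part for \<open>m\<close> paths becomes
  \<open>m * m + m\<close>, and the claim reduces to
  \<open>m * m + n * n \<le> (m + n) * (m + n)\<close>, with equality when one side has no long
  path.\<close>

lemma nesting_cost_join: "nesting_cost (g + 2) m + nesting_cost (g + 2) n + 12 * g \<le> nesting_cost g (m + n + 1)"
proof -
  have e: "nesting_cost (g + 2) m = 12 * (g * m + (m * m + m))" for m
    unfolding nesting_cost_def by (cases m) simp_all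
  have "m * m + n * n \<le> (m + n) * (m + n)" by (simp add: distrib_right distrib_left)
  moreover have "nesting_cost g (m + n + 1) = 12 * (g * m + g * n + g + ((m + n) * (m + n) + (m + n)))"
    unfolding nesting_cost_def by (simp add: algebra_simps)
  ultimately show ?thesis unfolding e by (simp add: distrib_left)
qed

lemma long_edges_simps: "long_edges (A \<union> B) = long_edges A \<union> long_edges B"
  "long_edges (insert (a, ps, c, ds) E) = (if 8 \<le> length ds then insert (a, ps, c, ds) (long_edges E) else long_edges E)" "long_edges E \<subseteq> E" "long_edges {} = {}"
  by (auto simp: long_edges_def)

lemma joins_edges:
  assumes "ltree N1 E1" "ltree N2 E2" "joins N1 E1 N2 E2 a ps c ds"
  shows "(a, ps, c, ds) \<notin> E1 \<union> E2" "E1 \<inter> E2 = {}" "finite E1" "finite E2" "N1 \<inter> N2 = {}"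
    "a \<in> N1" "c \<in> N2" "set ps \<inter> (N1 \<union> N2) = {}"
    "card (VV N1 E1 \<union> VV N2 E2 \<union> set ps) = card (VV N1 E1) + card (VV N2 E2) + length ps"
proof -
  have j: "a \<in> N1" "c \<in> N2" "VV N1 E1 \<inter> VV N2 E2 = {}" "set ps \<inter> (VV N1 E1 \<union> VV N2 E2) = {}" "distinct ps"
    using assms(3) unfolding joins_def by auto
  show N: "N1 \<inter> N2 = {}" "set ps \<inter> (N1 \<union> N2) = {}" using j VV_sup[of N1 E1] VV_sup[of N2 E2] by blast+
  show "a \<in> N1" "c \<in> N2" by fact+
  note e1 = ltree_edge[OF assms(1)] and e2 = ltree_edge[OF assms(2)]
  show "(a, ps, c, ds) \<notin> E1 \<union> E2" using e1[of a ps c ds] e2[of a ps c ds] N(1) j(1,2) by blast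
  show "E1 \<inter> E2 = {}"
  proof (rule equals0I)
    fix e assume e: "e \<in> E1 \<inter> E2"
    obtain x qs y es where "e = (x, qs, y, es)" by (cases e) auto
    then show False using e1[of x qs y es] e2[of x qs y es] e N(1) by blast
  qed
  show "finite E1" "finite E2" using ltree_basic[OF assms(1)] ltree_basic[OF assms(2)] by auto
  have "finite (VV N1 E1)" "finite (VV N2 E2)" using ltree_basic[OF assms(1)] ltree_basic[OF assms(2)] by auto
  then have "card (VV N1 E1 \<union> VV N2 E2 \<union> set ps) = card (VV N1 E1) + card (VV N2 E2) + card (set ps)"
    using j by (simp add: card_Un_disjoint Int_commute)
  then show "card (VV N1 E1 \<union> VV N2 E2 \<union> set ps) = card (VV N1 E1) + card (VV N2 E2) + length ps"
    using j(5) by (simp add: distinct_card)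
qed

lemma ltree_star:
  assumes "ltree N E" "a \<in> N" "finite D" "D \<inter> VV N E = {}"
  shows "ltree (N \<union> D) (E \<union> (\<lambda>x. (a, [], x, [\<sigma>])) ` D)"
  using assms(3,4)
proof (induction D rule: finite_induct)
  case empty
  then show ?case using assms by simp
next
  case (insert x D)
  have V: "VV (N \<union> D) (E \<union> (\<lambda>x. (a, [], x, [\<sigma>])) ` D) = VV N E \<union> D" by (auto simp: VV_def)
  have "joins (N \<union> D) (E \<union> (\<lambda>x. (a, [], x, [\<sigma>])) ` D) {x} {} a [] x [\<sigma>]"
    using insert assms(2) unfolding joins_def V by auto
  from ltree.join[OF insert.IH ltree.single this] show ?case using insert.prems by (simp add: insert_commute)
qed

text \<open>A dummy leaf hangs on a path of length 1, which is short: it costs 20 positions and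
  leaves the number of long paths unchanged, so the induction hypothesis applies to the enlarged
  tree. The node \<open>a\<close> must lie outside \<open>Lf\<close>, since its degree
  grows.\<close>

lemma good_star:
  assumes IH: "\<And>N' E'. card (long_edges E') = card (long_edges E) \<Longrightarrow> ltree N' E' \<Longrightarrow> leaf_admissible Lf N' E' \<Longrightarrow>
      good R (bound Lf N' E' g) g (VV N' E') (AA E') (N' - Lf)"
    and t: "ltree N E" and leaf_admissible: "leaf_admissible Lf N E" and a: "a \<in> N" "a \<notin> Lf"
    and D: "finite D" "D \<inter> VV N E = {}" "D \<inter> Lf = {}"
  shows "good R (bound Lf N E g + 20 * card D) g (VV N E \<union> D) (AA E \<union> (\<lambda>x. if \<sigma> then (a, x) else (x, a)) ` D) ((N - Lf) \<union> D)"
proof -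
  define E' where "E' = E \<union> (\<lambda>x. (a, [], x, [\<sigma>])) ` D"
  have t': "ltree (N \<union> D) E'" unfolding E'_def by (rule ltree_star[OF t a(1) D(1,2)])
  have V: "VV (N \<union> D) E' = VV N E \<union> D" by (auto simp: VV_def E'_def)
  have A: "AA E' = AA E \<union> (\<lambda>x. if \<sigma> then (a, x) else (x, a)) ` D" by (auto simp: AA_def E'_def)
  have L: "long_edges E' = long_edges E" by (auto simp: long_edges_def E'_def)
  have NV: "N \<subseteq> VV N E" by (rule VV_sup)
  have dj: "E \<inter> (\<lambda>x. (a, [], x, [\<sigma>])) ` D = {}"
  proof (rule equals0I)
    fix e assume "e \<in> E \<inter> (\<lambda>x. (a, [], x, [\<sigma>])) ` D"
    then obtain x where x: "(a, [], x, [\<sigma>]) \<in> E" "x \<in> D" by auto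
    then show False using ltree_edge[OF t x(1)] D(2) NV by blast
  qed
  have "(\<Sum>e\<in>(\<lambda>x. (a, [], x, [\<sigma>])) ` D. cost Lf e) = (\<Sum>x\<in>D. 19)"
    by (subst sum.reindex) (auto simp: inj_on_def cost_def)
  then have C: "(\<Sum>e\<in>E'. cost Lf e) = (\<Sum>e\<in>E. cost Lf e) + 19 * card D"
    using ltree_basic[OF t] D(1) dj by (simp add: E'_def sum.union_disjoint)
  have "card (VV N E \<union> D) = card (VV N E) + card D"
    using ltree_basic[OF t] D by (intro card_Un_disjoint) auto
  then have B: "bound Lf (N \<union> D) E' g = bound Lf N E g + 20 * card D" by (simp add: bound_def V C L)
  have "leaf_admissible Lf (N \<union> D) E'"
    unfolding leaf_admissible_def V
  proof (intro conjI ballI)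
    show "finite Lf" using leaf_admissible by (simp add: leaf_admissible_def)
    show "Lf \<inter> (VV N E \<union> D - (N \<union> D)) = {}" using leaf_admissible by (auto simp: leaf_admissible_def)
    show "card (inc E' v) \<le> 1" if "v \<in> (N \<union> D) \<inter> Lf" for v
    proof -
      have "v \<in> N" "v \<notin> D" "v \<noteq> a" "v \<in> Lf" using that D a by auto
      moreover from this have "inc E' v = inc E v" by (auto simp: inc_def E'_def)
      ultimately show ?thesis using leaf_admissible by (auto simp: leaf_admissible_def)
    qed
    show "case e of (a, ps, c, ds) \<Rightarrow> a \<notin> Lf \<or> c \<notin> Lf" if "e \<in> E'" for e
      using that leaf_admissible a(2) by (auto simp: leaf_admissible_def E'_def)
  qed
  from IH[OF arg_cong[OF L] t' this] show ?thesis
    unfolding B V A by (rule good_eq) (use D in auto)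
qed

lemma leaf_admissible_sub:
  assumes "leaf_admissible Lf N E" "ltree N E" "E1 \<subseteq> E" "N1 \<subseteq> N" "VV N1 E1 \<inter> N \<subseteq> N1"
  shows "leaf_admissible Lf N1 E1"
  unfolding leaf_admissible_def
proof (intro conjI ballI)
  show "finite Lf" using assms by (simp add: leaf_admissible_def)
  have "VV N1 E1 \<subseteq> VV N E" using assms(3,4) unfolding VV_def by blast
  then show "Lf \<inter> (VV N1 E1 - N1) = {}" using assms(1,5) unfolding leaf_admissible_def by blast
  fix v assume v: "v \<in> N1 \<inter> Lf"
  have "finite (inc E v)" by (rule finite_subset[of _ E]) (use ltree_basic[OF assms(2)] in \<open>auto simp: inc_def\<close>)
  moreover have "inc E1 v \<subseteq> inc E v" using assms(3) by (auto simp: inc_def)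
  ultimately have "card (inc E1 v) \<le> card (inc E v)" by (rule card_mono)
  moreover have "card (inc E v) \<le> 1" using assms(1,4) v unfolding leaf_admissible_def by blast
  ultimately show "card (inc E1 v) \<le> 1" by simp
next
  fix e assume "e \<in> E1"
  then show "case e of (a, ps, c, ds) \<Rightarrow> a \<notin> Lf \<or> c \<notin> Lf" using assms(1,3) unfolding leaf_admissible_def by blast
qed

lemma leaf_admissible_joins:
  assumes leaf_admissible: "leaf_admissible Lf N E" and t: "ltree N E" "N = N1 \<union> N2" "E = insert e (E1 \<union> E2)" and j: "joins N1 E1 N2 E2 a ps c ds"
  shows "leaf_admissible Lf N1 E1" "leaf_admissible Lf N2 E2"
proof -
  have j': "VV N1 E1 \<inter> VV N2 E2 = {}" using j unfolding joins_def by blast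
  then have "VV N1 E1 \<inter> N2 = {}" "VV N2 E2 \<inter> N1 = {}" using VV_sup[of N1 E1] VV_sup[of N2 E2] by blast+
  then show "leaf_admissible Lf N1 E1" "leaf_admissible Lf N2 E2" using t(2,3) by (intro leaf_admissible_sub[OF leaf_admissible t(1)]; blast)+
qed

text \<open>The induction runs over the number of long paths and not over the size, since subtrees
  are enlarged by dummies before the hypothesis is applied; \<open>g\<close> is arbitrary because it
  rises by 2 with each cut. Leaves in \<open>Lf\<close> need no fixed position, hence
  \<open>N - Lf\<close>.\<close>

lemma ltree_good:
  fixes N :: "nat set"
  assumes R: "rtour R"
  shows "ltree N E \<Longrightarrow> leaf_admissible Lf N E \<Longrightarrow> good R (bound Lf N E g) g (VV N E) (AA E) (N - Lf)"
proof (induction "card (long_edges E)" arbitrary: N E g rule: less_induct)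
  case less
  note t = less.prems(1) and leaf_admissible = less.prems(2)
  note ba = ltree_basic[OF t]
  have finE: "finite E" "finite (long_edges E)" using ba finite_subset[OF long_edges_simps(3)] by auto
  have finL: "finite Lf" using leaf_admissible by (simp add: leaf_admissible_def)
  have LfV: "Lf \<inter> (VV N E - N) = {}" using leaf_admissible unfolding leaf_admissible_def by blast
  have star: "good R (bound Lf N1 E1 (g + 2) + 20 * card D) (g + 2) (VV N1 E1 \<union> D) (AA E1 \<union> (\<lambda>x. if \<sigma> then (b, x) else (x, b)) ` D) ((N1 - Lf) \<union> D)"
    if "card (long_edges E1) < card (long_edges E)" "ltree N1 E1" "leaf_admissible Lf N1 E1" "b \<in> N1" "b \<notin> Lf" "finite D" "D \<inter> VV N1 E1 = {}" "D \<inter> Lf = {}"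
    for N1 E1 b D \<sigma>
    by (rule good_star) (use less.hyps that in auto)
  show ?case
  proof (cases "long_edges E = {}")
    case True
    have "e \<in> E \<Longrightarrow> cost Lf e = (case e of (a, ps, c, ds) \<Rightarrow> 19 * length ds)" for e
      using True by (cases e) (auto simp: long_edges_def cost_def)
    then have "(\<Sum>e\<in>E. cost Lf e) = (\<Sum>(a, ps, c, ds)\<in>E. 19 * length ds)" by (rule sum.cong[OF refl])
    also have "\<dots> = 19 * (\<Sum>(a, ps, c, ds)\<in>E. length ds)" by (simp add: sum_distrib_left case_prod_unfold)
    finally have "bound Lf N E g = 1 + 20 * (\<Sum>(a, ps, c, ds)\<in>E. length ds)"
      using ba True by (simp add: bound_def nesting_cost_def)
    then have "cluster R (bound Lf N E g) (VV N E) (AA E)" using ltree_clus[OF R t] by simp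
    from cluster_good[OF this] show ?thesis by (rule good_mono) (use VV_sup[of N E] in auto)
  next
    case False
    then obtain a ps c ds where e: "(a, ps, c, ds) \<in> E" "8 \<le> length ds" by (auto simp: long_edges_def)
    have small: "card (long_edges E1) < card (long_edges E)" if "E = insert (a, ps, c, ds) E'" "(a, ps, c, ds) \<notin> E'" "E1 \<subseteq> E'" for E1 E'
    proof (rule psubset_card_mono[OF finE(2)])
      have "(a, ps, c, ds) \<in> long_edges E" "(a, ps, c, ds) \<notin> long_edges E1" using that e by (auto simp: long_edges_def)
      moreover have "long_edges E1 \<subseteq> long_edges E" using that by (auto simp: long_edges_def)
      ultimately show "long_edges E1 \<subset> long_edges E" by blast
    qed
    show ?thesis
    proof (cases "a \<in> Lf \<or> c \<in> Lf")
      case False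
      obtain N1 E1 N2 E2 where r: "ltree N1 E1" "ltree N2 E2" "joins N1 E1 N2 E2 a ps c ds" "N = N1 \<union> N2" "E = insert (a, ps, c, ds) (E1 \<union> E2)"
        using ltree_cut[OF t e(1)] by blast
      note je = joins_edges[OF r(1-3)]
      note ad = leaf_admissible_joins[OF leaf_admissible t r(4,5,3)]
      have j: "VV N1 E1 \<inter> VV N2 E2 = {}" "set ps \<inter> (VV N1 E1 \<union> VV N2 E2) = {}" "distinct ps" "length ds = Suc (length ps)"
        using r(3) unfolding joins_def by auto
      have V: "VV N E = VV N1 E1 \<union> VV N2 E2 \<union> set ps" "AA E = AA E1 \<union> AA E2 \<union> arcs_of ds (a # ps @ [c])" unfolding r(4,5) by auto
      have "set ps \<subseteq> VV N E" "set ps \<inter> N = {}" using V(1) je(8) r(4) by auto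
      then have psL: "set ps \<inter> Lf = {}" using LfV by blast
      have sm: "card (long_edges E1) < card (long_edges E)" "card (long_edges E2) < card (long_edges E)" using small[OF r(5) je(1)] by blast+
      have c: "(\<Sum>e\<in>E. cost Lf e) = 300 + (\<Sum>e\<in>E1. cost Lf e) + (\<Sum>e\<in>E2. cost Lf e)"
        unfolding r(5) using je(1-4) False e(2) by (simp add: sum.union_disjoint cost_def)
      have l: "card (long_edges E) = card (long_edges E1) + card (long_edges E2) + 1"
      proof -
        have "(a, ps, c, ds) \<notin> long_edges E1 \<union> long_edges E2" "long_edges E1 \<inter> long_edges E2 = {}" using je(1,2) long_edges_simps(3) by blast+
        moreover have "finite (long_edges E1)" "finite (long_edges E2)" using je(3,4) finite_subset[OF long_edges_simps(3)] by auto
        ultimately show ?thesis unfolding r(5) long_edges_simps using e(2) by (simp add: card_Un_disjoint)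
      qed
      have bd: "bound Lf N1 E1 (g + 2) + bound Lf N2 E2 (g + 2) + length ps + 300 + 12 * g \<le> bound Lf N E g"
        unfolding bound_def c l V(1) je(9) using nesting_cost_join[of g "card (long_edges E1)" "card (long_edges E2)"] by linarith
      have "good R (bound Lf N1 E1 (g + 2) + bound Lf N2 E2 (g + 2) + length ps + 300 + 12 * g) g (VV N1 E1 \<union> VV N2 E2 \<union> set ps)
          (AA E1 \<union> AA E2 \<union> arcs_of ds (a # ps @ [c])) ((N1 - Lf) \<union> (N2 - Lf))"
      proof (rule attach_inner[where Lf = Lf, OF R star[OF sm(1) r(1) ad(1)] star[OF sm(2) r(2) ad(2)]])
        show "AA E1 \<subseteq> VV N1 E1 \<times> VV N1 E1" "AA E2 \<subseteq> VV N2 E2 \<times> VV N2 E2" "finite (VV N1 E1)" "finite (VV N2 E2)"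
          using ltree_basic[OF r(1)] ltree_basic[OF r(2)] by auto
        show "N1 - Lf \<subseteq> VV N1 E1" "N2 - Lf \<subseteq> VV N2 E2" using VV_sup[of N1 E1] VV_sup[of N2 E2] by blast+
      qed (use j je False psL finL e in auto)
      then show ?thesis by (rule good_eq) (use V bd r(4) in auto)
    next
      \<comment> \<open>The leaf \<open>v\<close> has only this path, so the part of the cut that
        contains \<open>v\<close> is \<open>v\<close> alone, and dummies are needed only at the
        other end \<open>a'\<close>.\<close>
      case True
      then obtain v where v: "v \<in> Lf" "v = a \<or> v = c" by blast
      have ei: "(a, ps, c, ds) \<in> inc E v" using e v by (simp add: inc_iff)
      obtain N1 E1 N2 a' ps' ds' E2 where r: "ltree N1 E1" "ltree N2 E2" "joins N1 E1 N2 E2 a' ps' v ds'" "N = N1 \<union> N2"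
        "E = insert (a, ps, c, ds) (E1 \<union> E2)" "(a, ps, c, ds) = (a', ps', v, ds') \<or> (a, ps, c, ds) = (v, rev ps', a', rev (map Not ds'))"
        "AA {(a, ps, c, ds)} = arcs_of ds' (a' # ps' @ [v])"
        by (rule ltree_cut_at[OF t ei]) (rule that)
      note je = joins_edges[OF r(1-3)]
      have j: "VV N1 E1 \<inter> VV N2 E2 = {}" "set ps' \<inter> (VV N1 E1 \<union> VV N2 E2) = {}" "distinct ps'" "length ds' = Suc (length ps')"
        using r(3) unfolding joins_def by auto
      have len: "8 \<le> length ds'" "set ps = set ps'" using r(6) e(2) by auto
      have en: "(a, ps, c, ds) \<notin> E1 \<union> E2"
      proof
        assume "(a, ps, c, ds) \<in> E1 \<union> E2"
        then have "a \<in> N1 \<and> c \<in> N1 \<or> a \<in> N2 \<and> c \<in> N2" using ltree_edge[OF r(1), of a ps c ds] ltree_edge[OF r(2), of a ps c ds] by blast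
        then show False using r(6) je(5-7) by blast
      qed
      have vN: "v \<in> N" using r(4) je(7) by simp
      have "card (inc E v) \<le> 1" "inc E v \<subseteq> E" using leaf_admissible vN v(1) unfolding leaf_admissible_def by (auto simp: inc_def)
      then have "card (inc E v) \<le> 1" "finite (inc E v)" using finE(1) finite_subset by auto
      then have "inc E v = {(a, ps, c, ds)}" using ei card_le_Suc0_iff_eq[of "inc E v"] by auto
      moreover have "inc E2 v \<subseteq> inc E v" unfolding r(5) by (auto simp: inc_def)
      moreover have "(a, ps, c, ds) \<notin> inc E2 v" using en by (auto simp: inc_def)
      ultimately have "inc E2 v = {}" by (metis singletonI subset_singletonD)
      then have N2: "N2 = {v}" "E2 = {}" using ltree_isolated[OF r(2) je(7)] by auto
      have a': "a' \<notin> Lf" using leaf_admissible e(1) r(6) v(1) unfolding leaf_admissible_def by blast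
      note ad = leaf_admissible_joins[OF leaf_admissible t r(4,5,3)]
      have V: "VV N E = VV N1 E1 \<union> {v} \<union> set ps'" "AA E = AA E1 \<union> arcs_of ds' (a' # ps' @ [v])"
        using r(7) len(2) unfolding r(4,5) N2 by (auto simp: AA_def VV_def)
      have "set ps' \<subseteq> VV N E" "set ps' \<inter> N = {}" using V(1) je(8) r(4) by auto
      then have psL: "set ps' \<inter> Lf = {}" using LfV by blast
      have sm: "card (long_edges E1) < card (long_edges E)" using small[OF r(5) en] by blast
      have c: "(\<Sum>e\<in>E. cost Lf e) = 160 + (\<Sum>e\<in>E1. cost Lf e)"
        using en je(3) True e(2) unfolding r(5) N2 by (simp add: cost_def)
      have l: "card (long_edges E) = card (long_edges E1) + 0 + 1"
      proof -
        have "(a, ps, c, ds) \<notin> long_edges E1" using en long_edges_simps(3) by blast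
        moreover have "finite (long_edges E1)" using je(3) finite_subset[OF long_edges_simps(3)] by auto
        ultimately show ?thesis unfolding r(5) N2 long_edges_simps using e(2) by simp
      qed
      have cV: "card (VV N E) = card (VV N1 E1) + 1 + length ps'" using je(9) unfolding V N2 by simp
      have bd: "bound Lf N1 E1 (g + 2) + 1 + length ps' + 160 + 12 * g \<le> bound Lf N E g"
        unfolding bound_def c l cV using nesting_cost_join[of g "card (long_edges E1)" 0] by linarith
      have "good R (bound Lf N1 E1 (g + 2) + 1 + length ps' + 160 + 12 * g) g (VV N1 E1 \<union> {v} \<union> set ps')
          (AA E1 \<union> arcs_of ds' (a' # ps' @ [v])) (N1 - Lf)"
      proof (rule attach_leaf[where Lf = Lf, OF R star[OF sm r(1) ad(1)]])
        show "AA E1 \<subseteq> VV N1 E1 \<times> VV N1 E1" "finite (VV N1 E1)"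
          using ltree_basic[OF r(1)] by auto
        show "N1 - Lf \<subseteq> VV N1 E1" using VV_sup[of N1 E1] by blast
      qed (use j je a' psL finL len N2 in auto)
      then show ?thesis by (rule good_eq) (use V bd r(4) N2 v in auto)
    qed
  qed
qed

section \<open>Existence of median orders and the final count\<close>

text \<open>Any ranking with the most forward arcs will do: moving \<open>B\<close> to the front of
  an interval gives another ranking, and comparing the numbers of forward arcs is the exchange
  inequality. Outside the interval \<open>R\<close> is completed by \<open><\<close>, so that it is
  a tournament on all integers.\<close>

lemma ex_median_order:
  fixes T :: "'b \<Rightarrow> 'b \<Rightarrow> bool"
  assumes W: "finite W" and T: "\<And>x y. x \<in> W \<Longrightarrow> y \<in> W \<Longrightarrow> x \<noteq> y \<Longrightarrow> T x y = (\<not> T y x)"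
  obtains R h where "rtour R" "med R 0 (int (card W))" "inj_on h {0..<int (card W)}" "h ` {0..<int (card W)} \<subseteq> W"
    "\<And>x y. x \<in> {0..<int (card W)} \<Longrightarrow> y \<in> {0..<int (card W)} \<Longrightarrow> R x y \<Longrightarrow> T (h x) (h y)"
proof -
  define F where "F k = {(u, v)\<in>W \<times> W. k u < k v \<and> T u v}" for k :: "'b \<Rightarrow> int"
  define m where "m = int (card W)"
  have sub: "F k \<subseteq> W \<times> W" for k by (auto simp: F_def)
  have fF: "card (F k) \<le> card (W \<times> W)" for k
    by (rule card_mono[OF _ sub]) (simp add: W)
  obtain k0 :: "'b \<Rightarrow> int" where k0: "inj_on k0 W"
  proof -
    obtain g :: "'b \<Rightarrow> nat" where "inj_on g W" using finite_imp_inj_to_nat_seg[OF W] by blast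
    then show ?thesis by (intro that[of "\<lambda>x. int (g x)"]) (auto simp: inj_on_def)
  qed
  have "\<exists>k. inj_on k W \<and> (\<forall>k'. inj_on k' W \<longrightarrow> card (F k') \<le> card (F k))"
    by (rule ex_has_greatest_nat[where P = "\<lambda>k. inj_on k W" and f = "\<lambda>k. card (F k)" and b = "card (W \<times> W) + 1", OF k0]) (use fF in \<open>auto simp: less_Suc_eq_le\<close>)
  then obtain k where k: "inj_on k W" and best: "\<And>k'. inj_on k' W \<Longrightarrow> card (F k') \<le> card (F k)" by blast
  define L where "L = sorted_list_of_set (k ` W)"
  have L: "set L = k ` W" "sorted_wrt (<) L" "length L = card W"
    using W k by (simp_all add: L_def card_image)
  define h where "h x = inv_into W k (L ! nat x)" for x
  have Lin: "L ! nat x \<in> k ` W" if "x \<in> {0..<m}" for x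
    using that L(1) nth_mem[of "nat x" L] L(3) by (auto simp: m_def)
  have hW: "h x \<in> W" "k (h x) = L ! nat x" if "x \<in> {0..<m}" for x
    using inv_into_into[OF Lin[OF that]] f_inv_into_f[OF Lin[OF that]] by (auto simp: h_def)
  have less: "k (h x) < k (h y)" if "x \<in> {0..<m}" "y \<in> {0..<m}" "x < y" for x y
    using that sorted_wrt_nth_less[OF L(2), of "nat x" "nat y"] L(3) hW(2)[of x] hW(2)[of y] by (simp add: m_def)
  have less_iff: "k (h x) < k (h y) \<longleftrightarrow> x < y" if "x \<in> {0..<m}" "y \<in> {0..<m}" for x y
    using less[of x y] less[of y x] that by (cases x y rule: linorder_cases) auto
  have inj: "inj_on h {0..<m}"
  proof (rule inj_onI)
    fix x y assume "x \<in> {0..<m}" "y \<in> {0..<m}" "h x = h y"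
    then show "x = y" using less[of x y] less[of y x] by (cases x y rule: linorder_cases) auto
  qed
  have im: "h ` {0..<m} = W"
    by (rule card_subset_eq[OF W]) (use hW card_image[OF inj] in \<open>auto simp: m_def\<close>)
  define R where "R x y = (if x \<in> {0..<m} \<and> y \<in> {0..<m} then T (h x) (h y) else x < y)" for x y
  have Rr: "R x y = T (h x) (h y)" if "x \<in> {0..<m}" "y \<in> {0..<m}" for x y using that by (simp add: R_def)
  have "rtour R"
    unfolding rtour_def
  proof (intro allI impI)
    fix x y :: int assume "x \<noteq> y"
    then show "R x y = (\<not> R y x)"
      using T[of "h x" "h y"] hW inj_onD[OF inj, of x y] unfolding R_def by (cases "x \<in> {0..<m} \<and> y \<in> {0..<m}") auto
  qed
  moreover have "med R 0 m"
    unfolding med_def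
  proof (intro allI impI)
    fix i j B assume a: "0 \<le> i \<and> i \<le> j \<and> j \<le> m \<and> B \<subseteq> {i..<j}"
    define C where "C = {i..<j} - B"
    have P: "B \<subseteq> {0..<m}" "C \<subseteq> {0..<m}" "B \<inter> C = {}" and fin: "finite B" "finite C"
      using a finite_subset[of B "{i..<j}"] by (auto simp: C_def)
    define pos where "pos = inv_into {0..<m} h"
    have pos: "pos (h x) = x" if "x \<in> {0..<m}" for x using inv_into_f_f[OF inj that] by (simp add: pos_def)
    \<comment> \<open>Shifting by the length \<open>m\<close> of the order moves \<open>B\<close> in front of \<open>C\<close> and leaves all other comparisons unchanged.\<close>
    define w where "w p = (if p < i \<or> p \<in> B then p else if p < j then p + m else p + 2 * m)" for p
    have wl: "w p < w q \<longleftrightarrow> (if p \<in> C \<and> q \<in> B then False else if p \<in> B \<and> q \<in> C then True else p < q)"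
      if "p \<in> {0..<m}" "q \<in> {0..<m}" for p q
      using that a by (auto simp: w_def C_def)
    define k' where "k' u = w (pos u)" for u
    have k'h: "k' (h x) = w x" if "x \<in> {0..<m}" for x using pos[OF that] by (simp add: k'_def)
    have "inj_on k' W"
      unfolding im[symmetric]
    proof (rule inj_onI, elim imageE)
      fix u v p q assume p: "k' u = k' v" "u = h p" "v = h q" "p \<in> {0..<m}" "q \<in> {0..<m}"
      then have "w p = w q" using k'h by simp
      then have "p = q" using p(4,5) a by (auto simp: w_def split: if_splits)
      then show "u = v" using p by simp
    qed
    then have le: "card (F k') \<le> card (F k)" by (rule best)
    \<comment> \<open>\<open>K\<close> holds the arcs that are forward both before and after the
      move, \<open>X\<close> those that stop being forward, and \<open>Y\<close> those that become
      forward.\<close>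
    define K where "K = {(p, q)\<in>{0..<m} \<times> {0..<m}. p < q \<and> R p q \<and> \<not> (p \<in> C \<and> q \<in> B) \<and> \<not> (p \<in> B \<and> q \<in> C)}
       \<union> {(p, q)\<in>B \<times> C. R p q \<and> p < q}"
    define X where "X = {(x, y)\<in>C \<times> B. x < y \<and> R x y}"
    define Y where "Y = {(y, x)\<in>B \<times> C. x < y \<and> R y x}"
    have finK: "finite K" "finite X" "finite Y"
    proof -
      show "finite K" by (rule finite_subset[of _ "{0..<m} \<times> {0..<m}"]) (use P in \<open>auto simp: K_def\<close>)
      show "finite X" by (rule finite_subset[of _ "C \<times> B"]) (use fin in \<open>auto simp: X_def\<close>)
      show "finite Y" by (rule finite_subset[of _ "B \<times> C"]) (use fin in \<open>auto simp: Y_def\<close>)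
    qed
    have cF: "card (F l) = card {(p, q)\<in>{0..<m} \<times> {0..<m}. l (h p) < l (h q) \<and> R p q}" for l
    proof -
      have "F l = map_prod h h ` {(p, q)\<in>{0..<m} \<times> {0..<m}. l (h p) < l (h q) \<and> R p q}" (is "_ = _ ` ?Z")
        unfolding F_def im[symmetric] by (auto simp: Rr image_iff)
      moreover have "inj_on (map_prod h h) ?Z"
        by (rule inj_on_subset[OF map_prod_inj_on[OF inj inj]]) auto
      ultimately show ?thesis by (simp add: card_image)
    qed
    have "{(p, q)\<in>{0..<m} \<times> {0..<m}. k (h p) < k (h q) \<and> R p q} = {(p, q)\<in>{0..<m} \<times> {0..<m}. p < q \<and> R p q}"
      by (auto simp: less_iff)
    also have "\<dots> = K \<union> X" using P by (auto simp: K_def X_def)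
    finally have "{(p, q)\<in>{0..<m} \<times> {0..<m}. k (h p) < k (h q) \<and> R p q} = K \<union> X" .
    moreover have "K \<inter> X = {}" using P by (auto simp: K_def X_def)
    ultimately have 1: "card (F k) = card K + card X" unfolding cF using finK by (simp add: card_Un_disjoint)
    have "{(p, q)\<in>{0..<m} \<times> {0..<m}. k' (h p) < k' (h q) \<and> R p q} = K \<union> Y"
    proof (intro set_eqI, safe)
      fix p q assume pq: "p \<in> {0..<m}" "q \<in> {0..<m}" "k' (h p) < k' (h q)" "R p q" "(p, q) \<notin> Y"
      then have "w p < w q" using k'h by simp
      then show "(p, q) \<in> K" using pq wl[of p q] P by (auto simp: K_def Y_def split: if_splits)
    next
      fix p q assume "(p, q) \<in> K"
      then have pq: "p \<in> {0..<m}" "q \<in> {0..<m}" "R p q" "p < q" "\<not> (p \<in> C \<and> q \<in> B)" using P by (auto simp: K_def)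
      then show "p \<in> {0..<m}" "q \<in> {0..<m}" "R p q" "k' (h p) < k' (h q)" using wl[of p q] k'h by auto
    next
      fix p q assume "(p, q) \<in> Y"
      then have pq: "p \<in> {0..<m}" "q \<in> {0..<m}" "R p q" "p \<in> B" "q \<in> C" "p \<notin> C" using P by (auto simp: Y_def)
      then show "p \<in> {0..<m}" "q \<in> {0..<m}" "R p q" "k' (h p) < k' (h q)" using wl[of p q] k'h by auto
    qed
    moreover have "K \<inter> Y = {}" using P by (auto simp: K_def Y_def)
    ultimately have 2: "card (F k') = card K + card Y" unfolding cF using finK by (simp add: card_Un_disjoint)
    have "Y = (SIGMA y:B. {x\<in>C. x < y \<and> R y x})" by (auto simp: Y_def)
    then have 3: "card Y = (\<Sum>y\<in>B. card {x\<in>C. x < y \<and> R y x})" using fin by simp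
    have "X = prod.swap ` (SIGMA y:B. {x\<in>C. x < y \<and> R x y})" by (auto simp: X_def image_iff)
    then have "card X = card (SIGMA y:B. {x\<in>C. x < y \<and> R x y})" by (simp add: card_image)
    then have 4: "card X = (\<Sum>y\<in>B. card {x\<in>C. x < y \<and> R x y})" using fin by simp
    show "(\<Sum>y\<in>B. card {x\<in>{i..<j} - B. x < y \<and> R y x}) \<le> (\<Sum>y\<in>B. card {x\<in>{i..<j} - B. x < y \<and> R x y})"
      using le 1 2 3 4 unfolding C_def by simp
  qed
  ultimately show ?thesis
    using inj im by (intro that[of R h]) (auto simp: Rr simp flip: m_def)
qed

lemma good_emb:
  assumes "good R M g V A S" "med R 0 (int m)" "M \<le> m"
  shows "\<exists>f. emb R A V {0..<int m} f"
proof -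
  have "good R m g V A S" by (rule good_mono[OF assms(1,3)]) auto
  moreover have "med R 0 (0 + int m)" using assms(2) by simp
  ultimately obtain \<phi> F where "\<And>G. G \<inter> F = {} \<Longrightarrow> card (G \<inter> {0..<0 + int m}) \<le> g \<Longrightarrow>
         \<exists>f. emb R A V ({0..<0 + int m} - G) f \<and> (\<forall>s\<in>S. f s = \<phi> s)"
    by (rule goodE) (rule that)
  from this[of "{}"] show ?thesis by auto
qed

text \<open>This settles trees with two leaves. A path with a single block is part of a Hamiltonian
  path; otherwise any two disjoint sets of sufficient size serve as end sets in
  \<open>two_ended\<close>.\<close>

lemma path_emb:
  assumes R: "rtour R" and xs: "distinct xs" "length xs = Suc (length ds)" and m: "length xs + 140 \<le> m"
  shows "\<exists>f. emb R (arcs_of ds xs) (set xs) {0..<int m} f"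
proof -
  have "\<exists>ys. walk R ds ys \<and> distinct ys \<and> set ys \<subseteq> {0..<int m}"
  proof -
    obtain d bs where bs: "ds = pat d bs" "\<forall>b\<in>set bs. 0 < b" using ex_pat[of ds] by blast
    show ?thesis
    proof (cases "2 \<le> length bs")
      case False
      then have ds: "ds = replicate (length ds) d" using bs(1) by (cases bs; cases "tl bs") auto
      obtain zs where zs: "set zs \<subseteq> {0..<int m}" "distinct zs" "successively R zs" "length zs = length xs"
        using ham_sub[OF R, of "{0..<int m}" "length xs"] m by auto
      have "walk R (replicate (length ds) True) zs" "walk R (replicate (length ds) False) (rev zs)"
        using zs xs by (auto simp: walk_True walk_False)
      then have "walk R ds zs \<or> walk R ds (rev zs)" using ds by (cases d) auto
      then show ?thesis using zs by (elim disjE) (rule exI[of _ zs] exI[of _ "rev zs"], simp)+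
    next
      case True
      define b where "b = int (hd bs + 3)"
      have "bs = hd bs # butlast (tl bs) @ [last bs]" using True by (cases bs; cases "tl bs" rule: rev_cases) auto
      then have "sum_list bs = hd bs + (sum_list (butlast (tl bs)) + last bs)"
        by (metis sum_list.Cons sum_list.append sum_list.Nil add.right_neutral)
      moreover have "length ds = sum_list bs" by (simp add: bs(1))
      ultimately have "link_cond R bs {0..<int m} {0..<b} {b..<int m}"
        using R True bs(2) m xs(2) unfolding link_cond_def by (auto simp: b_def)
      from two_ended[OF this, of d] show ?thesis unfolding linked_def bs(1) by blast
    qed
  qed
  then obtain ys where ys: "walk R ds ys" "distinct ys" "set ys \<subseteq> {0..<int m}" by blast
  have ly: "length ys = length xs" using walk_length[OF ys(1)] xs(2) by simp
  obtain f where "map f xs = ys" and f: "\<And>es zs. walk R es (map f zs) \<Longrightarrow> emb R ({} \<union> {} \<union> arcs_of es zs) ({} \<union> {} \<union> set xs) {0..<int m} f"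
    by (rule emb_glue[OF emb_empty[of R "{}" "\<lambda>_. 0"] emb_empty[of R "{}" "\<lambda>_. 0"], where ps = xs and qs = ys and I = "{0..<int m}"]) (use xs ys ly that in auto)
  then show ?thesis using f[of ds xs] ys(1) by auto
qed

section \<open>Leaves, degrees and the final count\<close>

lemma arcs_of_head:
  assumes "v \<notin> set ys" "(u, v) \<in> arcs_of ds (v # ys) \<or> (v, u) \<in> arcs_of ds (v # ys)"
  shows "u = hd ys"
proof (cases ds; cases ys)
  fix d ds' y zs assume e: "ds = d # ds'" "ys = y # zs"
  have "arcs_of ds' (y # zs) \<subseteq> set (y # zs) \<times> set (y # zs)" by (rule arcs_of_sub)
  then show ?thesis using assms by (auto simp: e split: if_splits)
qed (use assms in auto)

text \<open>Each path at a node contributes only its vertex next to that node. The inequality is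
  enough to see that nodes of degree 1 are leaves of the tree.\<close>

lemma card_nbrs:
  assumes t: "ltree N E" and v: "v \<in> N"
  shows "card {u. (u, v) \<in> AA E \<or> (v, u) \<in> AA E} \<le> card (inc E v)"
proof -
  define nb where "nb = (\<lambda>(a, ps, c, ds :: bool list). if v = a then hd (ps @ [c]) else hd (rev ps @ [a]))"
  have fin: "finite (inc E v)" by (rule finite_subset[of _ E]) (use ltree_basic[OF t] in \<open>auto simp: inc_def\<close>)
  have "{u. (u, v) \<in> AA E \<or> (v, u) \<in> AA E} \<subseteq> nb ` inc E v"
  proof
    fix u assume "u \<in> {u. (u, v) \<in> AA E \<or> (v, u) \<in> AA E}"
    then obtain a ps c ds where e: "(a, ps, c, ds) \<in> E"
      and uv: "(u, v) \<in> arcs_of ds (a # ps @ [c]) \<or> (v, u) \<in> arcs_of ds (a # ps @ [c])" by (auto simp: AA_def)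
    note le = ltree_edge[OF t e]
    have "v \<in> set (a # ps @ [c])" using uv arcs_of_sub[of ds "a # ps @ [c]"] by blast
    then have vac: "v = a \<or> v = c" "v \<notin> set ps" using le v by auto
    have "u = nb (a, ps, c, ds)"
    proof (cases "v = a")
      case True
      have "u = hd (ps @ [c])" by (rule arcs_of_head[of v _ _ ds]) (use uv True vac le in auto)
      then show ?thesis using True by (simp add: nb_def)
    next
      case False
      have "arcs_of (rev (map Not ds)) (rev (a # ps @ [c])) = arcs_of ds (a # ps @ [c])"
        by (rule arcs_of_rev) (use le in simp)
      then have "u = hd (rev ps @ [a])"
        by (intro arcs_of_head[of v _ _ "rev (map Not ds)"]) (use uv False vac le in auto)
      then show ?thesis using False by (simp add: nb_def)
    qed
    moreover have "(a, ps, c, ds) \<in> inc E v" using e vac by (simp add: inc_iff)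
    ultimately show "u \<in> nb ` inc E v" by blast
  qed
  from surj_card_le[OF fin this] show ?thesis .
qed

lemma long_edges_bound: "finite E \<Longrightarrow> nesting_cost 0 (card (long_edges E)) \<le> 12 * (card E * (card E - 1))"
  unfolding nesting_cost_def using card_mono[OF _ long_edges_simps(3), of E] by (simp add: mult_le_mono diff_le_mono)

text \<open>Cutting the path isolates both of its ends, so each of the two parts is a single
  node.\<close>

lemma ltree_two_leaves:
  assumes t: "ltree N E" and e: "(a, ps, c, ds) \<in> E" and ac: "card (inc E a) \<le> 1" "card (inc E c) \<le> 1"
  shows "N = {a, c}" "E = {(a, ps, c, ds)}"
proof -
  obtain N1 E1 N2 E2 where r: "ltree N1 E1" "ltree N2 E2" "joins N1 E1 N2 E2 a ps c ds" "N = N1 \<union> N2" "E = insert (a, ps, c, ds) (E1 \<union> E2)"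
    using ltree_cut[OF t e] by blast
  note je = joins_edges[OF r(1-3)]
  have i: "inc E' v = {}" if "card (inc E v) \<le> 1" "v = a \<or> v = c" "E' \<subseteq> E" "(a, ps, c, ds) \<notin> E'" for v E'
  proof -
    have "finite (inc E v)" by (rule finite_subset[of _ E]) (use ltree_basic[OF t] in \<open>auto simp: inc_def\<close>)
    moreover have "(a, ps, c, ds) \<in> inc E v" using e that(2) by (simp add: inc_iff)
    ultimately have "\<forall>x\<in>inc E v. x = (a, ps, c, ds)" using that(1) card_le_Suc0_iff_eq[of "inc E v"] by auto
    moreover have "inc E' v \<subseteq> inc E v" "inc E' v \<subseteq> E'" using that(3) by (auto simp: inc_def)
    ultimately show ?thesis using that(4) by (metis equals0I subsetD)
  qed
  have "inc E1 a = {}" by (rule i[OF ac(1)]) (use r(5) je(1) in auto)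
  then have 1: "N1 = {a}" "E1 = {}" using ltree_isolated[OF r(1) je(6)] by auto
  have "inc E2 c = {}" by (rule i[OF ac(2)]) (use r(5) je(1) in auto)
  then have 2: "N2 = {c}" "E2 = {}" using ltree_isolated[OF r(2) je(7)] by auto
  show "N = {a, c}" "E = {(a, ps, c, ds)}" using 1 2 r(4,5) by auto
qed

text \<open>Each leaf is charged to its only path and no path is charged twice. As a charged path
  costs at most 160, its deduction of 140 keeps it within 300.\<close>

lemma sum_cost:
  assumes t: "ltree N E" and L: "L \<subseteq> N" "\<And>v. v \<in> L \<Longrightarrow> card (inc E v) = 1" and E: "\<forall>(a, ps, c, ds)\<in>E. a \<notin> L \<or> c \<notin> L"
  shows "(\<Sum>e\<in>E. cost L e) + 140 * card L \<le> 300 * card E"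
proof -
  have fin: "finite L" "finite E" using ltree_basic[OF t] finite_subset[OF L(1)] by auto
  define P where "P v e = (case e of (a, ps, c, ds) \<Rightarrow> v = a \<or> v = c)" for v :: 'a and e :: "'a edge"
  have "inc E v = {e\<in>E. P v e}" for v by (auto simp: inc_def P_def)
  then have "card L = (\<Sum>v\<in>L. card {e\<in>E. P v e})" using L(2) by simp
  also have "\<dots> = (\<Sum>e\<in>E. card {v\<in>L. P v e})" using sum_card_swap[OF fin, of "\<lambda>e v. P v e"] by simp
  finally have "(\<Sum>e\<in>E. cost L e) + 140 * card L = (\<Sum>e\<in>E. cost L e + 140 * card {v\<in>L. P v e})"
    by (simp add: sum.distrib sum_distrib_left)
  also have "\<dots> \<le> (\<Sum>e\<in>E. 300)"
  proof (rule sum_mono)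
    fix e assume e: "e \<in> E"
    obtain a ps c ds where ee: "e = (a, ps, c, ds)" by (cases e) auto
    have "a \<notin> L \<or> c \<notin> L" using E e ee by auto
    then consider "a \<notin> L" "c \<notin> L" | x where "x \<in> {a, c}" "x \<in> L" "{v\<in>L. P v e} = {x}"
      by (auto simp: P_def ee)
    then show "cost L e + 140 * card {v\<in>L. P v e} \<le> 300"
    proof cases
      case 1
      then have "{v\<in>L. P v e} = {}" by (auto simp: P_def ee)
      then have "card {v\<in>L. P v e} = 0" by (simp only: card.empty)
      moreover have "cost L e \<le> 300" unfolding ee by (auto simp: cost_def)
      ultimately show ?thesis by simp
    next
      case 2
      then show ?thesis unfolding ee by (auto simp: cost_def)
    qed
  qed
  finally show ?thesis by simp
qed

lemma final_count:
  fixes n k k' j B :: nat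
  assumes "3 \<le> k'" "k' \<le> k" "j + 3 \<le> 2 * k'" "B + 140 * k' \<le> n + 300 * j + 12 * (j * (j - 1))"
  shows "B \<le> nat (int n + 144 * (int k)\<^sup>2 - 280 * int k + 124)"
proof -
  obtain x where x: "k' = 3 + x" using assms(1) le_Suc_ex by blast
  obtain y where y: "k = 3 + x + y" using assms(2) le_Suc_ex x by blast
  have j: "j \<le> 2 * x + 3" using assms(3) x by simp
  then have "12 * (j * (j - 1)) \<le> 12 * ((2 * x + 3) * (2 * x + 2))" by (intro mult_le_mono) auto
  moreover have "300 * j \<le> 300 * (2 * x + 3)" using j by (rule mult_le_mono2)
  ultimately have "B + 140 * (3 + x) \<le> n + 300 * (2 * x + 3) + 12 * ((2 * x + 3) * (2 * x + 2))"
    using assms(4) unfolding x by (meson add_le_mono order_refl order_trans)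
  then have "int B + 140 * (3 + int x) \<le> int n + 300 * (2 * int x + 3) + 12 * ((2 * int x + 3) * (2 * int x + 2))"
    unfolding of_nat_le_iff[symmetric, where 'a = int] by (simp only: of_nat_add of_nat_mult of_nat_numeral)
  \<comment> \<open>The added polynomial is the slack. All its coefficients are nonnegative, and its
    constant term 28 is what remains for \<open>k = 3\<close>.\<close>
  moreover have "int n + 300 * (2 * int x + 3) + 12 * ((2 * int x + 3) * (2 * int x + 2)) + (96 * (int x * int x) + 4 * int x + 28 + 584 * int y + 144 * (int y * int y) + 288 * (int x * int y))
     = int n + 144 * (3 + int x + int y)\<^sup>2 - 280 * (3 + int x + int y) + 124 + 140 * (3 + int x)"
    by algebra
  moreover have "0 \<le> int x * int x" "0 \<le> int y * int y" "0 \<le> int x * int y" by simp_all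
  ultimately have "int B \<le> int n + 144 * (3 + int x + int y)\<^sup>2 - 280 * (3 + int x + int y) + 124" by linarith
  then have "int B \<le> int n + 144 * (int k)\<^sup>2 - 280 * int k + 124" by (simp add: y)
  then show ?thesis by simp
qed

text \<open>Among all representations of the tree by nodes and paths one with the fewest nodes is
  taken. By \<open>ltree_eliminate\<close> it has no node of degree 2, so the number of paths is
  bounded in terms of the leaves.\<close>

theorem ltree_emb:
  fixes N :: "nat set"
  assumes R: "rtour R" and t0: "ltree N0 E0" and V: "VV N0 E0 = V" "AA E0 = A"
    and n: "card V = n" "2 \<le> n" and k: "card {v\<in>V. card {u. (u, v) \<in> A \<or> (v, u) \<in> A} \<le> 1} = k"
    and m: "m = nat (int n + 144 * (int k)\<^sup>2 - 280 * int k + 124)" "med R 0 (int m)"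
  shows "\<exists>f :: nat \<Rightarrow> int. emb R A V {0..<int m} f"
proof -
  define P where "P N \<longleftrightarrow> (\<exists>E. ltree N E \<and> VV N E = V \<and> AA E = A)" for N
  have "P N0" unfolding P_def using t0 V by blast
  then obtain N where "P N" and mini: "\<And>N'. P N' \<Longrightarrow> card N \<le> card N'"
    using ex_has_least_nat[of P N0 card] by blast
  then obtain E where t: "ltree N E" and VE: "VV N E = V" "AA E = A" unfolding P_def by blast
  note ba = ltree_basic[OF t]
  have fN: "finite N" "finite E" "finite V" and cN: "card N = Suc (card E)" using ba VE by auto
  have no2: "card (inc E v) \<noteq> 2" if v: "v \<in> N" for v
  proof
    assume "card (inc E v) = 2"
    then obtain E' where "ltree (N - {v}) E'" "VV (N - {v}) E' = VV N E" "AA E' = AA E" by (rule ltree_eliminate[OF t v])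
    then have "P (N - {v})" unfolding P_def using VE by auto
    from mini[OF this] show False using fN v card_gt_0_iff[of N] by auto
  qed
  have fi: "finite (inc E v)" for v by (rule finite_subset[of _ E]) (use fN in \<open>auto simp: inc_def\<close>)
  have no0: "card (inc E v) \<noteq> 0" if v: "v \<in> N" for v
  proof
    assume "card (inc E v) = 0"
    then have "inc E v = {}" using fi by auto
    then have "N = {v}" "E = {}" using ltree_isolated[OF t v] by auto
    then show False using n VE by auto
  qed
  define L where "L = {v\<in>N. card (inc E v) \<le> 1}"
  define k' where "k' = card L"
  have L1: "L \<subseteq> N" "finite L" using fN by (auto simp: L_def)
  have Lc: "card (inc E v) = 1" if "v \<in> L" for v using that no0[of v] by (auto simp: L_def)
  have "L \<subseteq> {v\<in>V. card {u. (u, v) \<in> A \<or> (v, u) \<in> A} \<le> 1}"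
  proof
    fix v assume "v \<in> L"
    then have "v \<in> N" "card (inc E v) \<le> 1" by (auto simp: L_def)
    then show "v \<in> {v\<in>V. card {u. (u, v) \<in> A \<or> (v, u) \<in> A} \<le> 1}"
      using card_nbrs[OF t, of v] VV_sup[of N E] VE by auto
  qed
  then have kk: "k' \<le> k" unfolding k'_def k[symmetric] using fN by (intro card_mono) auto
  have "2 * card E = (\<Sum>v\<in>N. card (inc E v))" using handshake[OF t] by simp
  also have "\<dots> = (\<Sum>v\<in>L. card (inc E v)) + (\<Sum>v\<in>N - L. card (inc E v))"
    using sum.subset_diff[OF L1(1) fN(1), of "\<lambda>v. card (inc E v)"] by simp
  also have "(\<Sum>v\<in>L. card (inc E v)) = k'" using Lc by (simp add: k'_def)
  finally have s: "2 * card E = k' + (\<Sum>v\<in>N - L. card (inc E v))" .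
  have "3 \<le> card (inc E v)" if "v \<in> N - L" for v using that no0[of v] no2[of v] by (auto simp: L_def)
  then have "3 * card (N - L) \<le> (\<Sum>v\<in>N - L. card (inc E v))"
    using sum_mono[of "N - L" "\<lambda>_. 3" "\<lambda>v. card (inc E v)"] by simp
  moreover have "card (N - L) + k' = card N" using card_mono[OF fN(1) L1(1)] card_Diff_subset[OF L1(2,1)] by (simp add: k'_def)
  \<comment> \<open>Nodes outside \<open>L\<close> have degree at least 3, so
    \<open>2 * card E \<ge> k' + 3 * (card N - k')\<close>, where
    \<open>card N = card E + 1\<close>.\<close>
  ultimately have jE: "card E + 3 \<le> 2 * k'" using s cN by linarith
  show ?thesis
  proof (cases "\<exists>(a, ps, c, ds)\<in>E. a \<in> L \<and> c \<in> L")
    case True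
    then obtain a ps c ds where e: "(a, ps, c, ds) \<in> E" "a \<in> L" "c \<in> L" by blast
    then have NE: "N = {a, c}" "E = {(a, ps, c, ds)}" using ltree_two_leaves[OF t e(1)] by (auto simp: L_def)
    note le = ltree_edge[OF t e(1)]
    have VA: "V = set (a # ps @ [c])" "A = arcs_of ds (a # ps @ [c])" using VE unfolding NE by auto
    have d: "distinct (a # ps @ [c])" using le by auto
    then have len: "length (a # ps @ [c]) = n" using n VA distinct_card by metis
    have "2 \<le> k'" using jE NE by simp
    \<comment> \<open>The number of positions beyond \<open>n\<close> is 140 for
      \<open>k = 2\<close> and grows with \<open>k\<close>.\<close>
    then obtain y where y: "k = 2 + y" using kk le_Suc_ex le_trans by blast
    have "144 * (int k)\<^sup>2 - 280 * int k + 124 = 140 + 296 * int y + 144 * (int y * int y)"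
      by (simp add: y power2_eq_square algebra_simps)
    moreover have "0 \<le> int y * int y" by simp
    ultimately have "n + 140 \<le> m" unfolding m(1) by linarith
    then show ?thesis unfolding VA
      by (intro path_emb[OF R d]) (use le len in auto)
  next
    case False
    then have LE: "\<forall>(a, ps, c, ds)\<in>E. a \<notin> L \<or> c \<notin> L" by blast
    obtain v where "v \<in> N" using cN by fastforce
    then have "inc E v \<noteq> {}" using no0[of v] by auto
    then have "E \<noteq> {}" by (auto simp: inc_def)
    \<comment> \<open>With fewer than three leaf nodes there would be a single path with leaves at
      both ends, which is the case already excluded.\<close>
    have k3: "3 \<le> k'"
    proof (rule ccontr)
      assume "\<not> 3 \<le> k'"
      then have "k' = 2" "card E = 1" using jE \<open>E \<noteq> {}\<close> fN card_gt_0_iff[of E] by auto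
      then obtain e where e: "E = {e}" by (auto simp: card_1_singleton_iff)
      have "card N = card L" using cN \<open>card E = 1\<close> \<open>k' = 2\<close> by (simp add: k'_def)
      then have "L = N" using card_subset_eq[OF fN(1) L1(1)] by simp
      moreover obtain a ps c ds where "e = (a, ps, c, ds)" by (cases e) auto
      ultimately show False using LE ltree_edge[OF t, of a ps c ds] e by auto
    qed
    have leaf_admissible: "leaf_admissible L N E" using L1 LE Lc unfolding leaf_admissible_def by auto
    have "bound L N E 0 + 140 * k' \<le> n + 300 * card E + 12 * (card E * (card E - 1))"
      using sum_cost[OF t L1(1) Lc LE] long_edges_bound[OF fN(2)] n(1) unfolding bound_def VE(1) k'_def by linarith
    then have "bound L N E 0 \<le> m" unfolding m(1) by (rule final_count[OF k3 kk jE])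
    with ltree_good[OF R t leaf_admissible, of 0] m(2) show ?thesis unfolding VE by (intro good_emb)
  qed
qed

section \<open>Oriented trees and tournaments as digraphs\<close>

lemma pcas_zip: "successively (\<lambda>a b. (a, b) \<in> E) (x # xs) \<Longrightarrow>
    pcas x (zip (x # xs) xs) (last (x # xs)) \<and> pawalk_verts x (zip (x # xs) xs) = x # xs \<and> set (zip (x # xs) xs) \<subseteq> E"
  by (induction xs arbitrary: x) auto

lemma cycle_of_path:
  assumes "(v, hd zs) \<in> parcs G" "(last zs, v) \<in> parcs G" "successively (\<lambda>a b. (a, b) \<in> parcs G) zs"
    and "distinct zs" "v \<notin> set zs" "zs \<noteq> []" "v \<in> pverts G"
  shows "\<exists>p. pre_digraph.cycle (with_proj G) p \<and> length p = Suc (length zs)"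
proof -
  have "successively (\<lambda>a b. (a, b) \<in> parcs G) (zs @ [v])"
    using assms(2,3,6) by (simp add: successively_append_iff)
  then have "successively (\<lambda>a b. (a, b) \<in> parcs G) (v # zs @ [v])"
    using assms(1,6) by (cases zs) auto
  from pcas_zip[OF this] have "pre_digraph.cycle (with_proj G) (zip (v # zs @ [v]) (zs @ [v]))"
    using assms(4,5,7) unfolding pre_digraph.cycle_def pre_digraph.awalk_def cas_with_proj_eq awalk_verts_with_proj_eq
    by (intro exI[of _ v]) (cases zs; auto)
  then show ?thesis by (intro exI[of _ "zip (v # zs @ [v]) (zs @ [v])"]) simp
qed

text \<open>A walk that starts in \<open>S\<close> could otherwise never leave \<open>S\<close>.
  Symmetry ensures that \<open>mk_symmetric\<close> adds no arcs.\<close>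

lemma connected_cut:
  assumes "connected (with_proj G)" "sym (parcs G)" "S \<subset> pverts G" "S \<noteq> {}"
  obtains u v where "u \<in> S" "v \<in> pverts G" "v \<notin> S" "(u, v) \<in> parcs G"
proof -
  have "parcs (mk_symmetric (with_proj G)) = parcs G"
    using assms(2) by (fastforce simp: parcs_mk_symmetric dest: symD)
  then have r: "(x, y) \<in> rtrancl_on (pverts G) (parcs G)" if "x \<in> pverts G" "y \<in> pverts G" for x y
    using assms(1) that unfolding connected_def strongly_connected_def reachable_def by simp
  have "\<exists>u v. u \<in> S \<and> v \<in> pverts G \<and> v \<notin> S \<and> (u, v) \<in> parcs G"
  proof (rule ccontr)
    assume no: "\<not> ?thesis"
    obtain x where x: "x \<in> S" using assms(4) by blast
    obtain y where y: "y \<in> pverts G" "y \<notin> S" using assms(3) by blast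
    have "(x', y) \<in> rtrancl_on (pverts G) (parcs G) \<Longrightarrow> x' \<in> S \<Longrightarrow> y \<in> S" for x' y
      by (induction rule: rtrancl_on.induct) (use no in blast)+
    then show False using r[of x y] x y assms(3) by blast
  qed
  then show ?thesis using that by blast
qed

text \<open>Every arc becomes a path without inner vertices. A largest vertex set is taken that
  forms an \<open>ltree\<close> and whose vertices are joined pairwise by paths inside it; these
  paths show that a new vertex has only one neighbour in the set, so that it can be added as a
  leaf.\<close>

lemma ltree_of_tree:
  fixes g :: "'a \<Rightarrow> nat"
  assumes G: "undirected_tree G" and D: "orientation D G" and g: "inj_on g (pverts D)"
  shows "ltree (g ` pverts D) ((\<lambda>(a, b). (g a, [], g b, [True])) ` parcs D)"
proof -
  interpret pair_graph G using G by (simp add: undirected_tree_def)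
  have D': "pverts D = pverts G" "parcs D \<union> (parcs D)\<inverse> = parcs G" "parcs D \<inter> (parcs D)\<inverse> = {}"
    using D by (auto simp: orientation_def)
  have conn: "connected (with_proj G)" and acyc: "\<And>p. pre_digraph.cycle (with_proj G) p \<Longrightarrow> length p < 3"
    using G unfolding undirected_tree_def by (auto simp: not_le)
  have sym: "sym (parcs G)" unfolding D'(2)[symmetric] by (rule sym_Un_converse)
  have loop: "(x, x) \<notin> parcs G" for x using pair_no_loops by fastforce
  have ginj: "g x = g y \<longleftrightarrow> x = y" if "x \<in> pverts G" "y \<in> pverts G" for x y
    using g that inj_on_eq_iff[of g "pverts D"] by (simp add: D'(1))
  define F where "F S = (\<lambda>(a, b). (g a, [] :: nat list, g b, [True])) ` (parcs D \<inter> S \<times> S)" for S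
  define path where "path S x y \<longleftrightarrow> (\<exists>zs. zs \<noteq> [] \<and> hd zs = x \<and> last zs = y \<and> distinct zs \<and> set zs \<subseteq> S \<and>
      successively (\<lambda>a b. (a, b) \<in> parcs G) zs)" for S x y
  define P where "P S \<longleftrightarrow> S \<subseteq> pverts G \<and> S \<noteq> {} \<and> ltree (g ` S) (F S) \<and> (\<forall>x\<in>S. \<forall>y\<in>S. path S x y)" for S
  have grow: "P (insert v S)" if S: "P S" and uv: "u \<in> S" "v \<in> pverts G" "v \<notin> S" "(u, v) \<in> parcs G" for S u v
  proof -
    have S': "S \<subseteq> pverts G" "ltree (g ` S) (F S)" "\<And>x y. x \<in> S \<Longrightarrow> y \<in> S \<Longrightarrow> path S x y" using S by (auto simp: P_def)
    have vu: "(v, u) \<in> parcs G" using uv(4) sym by (rule symD[rotated])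
    \<comment> \<open>A second neighbour \<open>x\<close> would close the path from \<open>u\<close>
      to \<open>x\<close> through \<open>v\<close> to a cycle with at least three arcs.\<close>
    have uniq: "x = u" if x: "x \<in> S" "(x, v) \<in> parcs G \<or> (v, x) \<in> parcs G" for x
    proof (rule ccontr)
      assume ne: "x \<noteq> u"
      have xv: "(x, v) \<in> parcs G" using x(2) sym by (auto dest: symD)
      obtain zs where zs: "zs \<noteq> []" "hd zs = u" "last zs = x" "distinct zs" "set zs \<subseteq> S" "successively (\<lambda>a b. (a, b) \<in> parcs G) zs"
        using S'(3)[OF uv(1) x(1)] unfolding path_def by blast
      have "\<exists>p. pre_digraph.cycle (with_proj G) p \<and> length p = Suc (length zs)"
        by (rule cycle_of_path) (use zs vu xv uv in auto)
      then obtain p where "pre_digraph.cycle (with_proj G) p" "length p = Suc (length zs)" by blast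
      then have "length zs < 2" using acyc[of p] by simp
      then show False using zs ne by (cases zs) auto
    qed
    have VF: "VV (g ` T) (F T) = g ` T" for T by (auto simp: VV_def F_def)
    have gv: "g v \<notin> g ` S" using ginj S'(1) uv by blast
    have one: "(v, x) \<notin> parcs D" "(x, v) \<notin> parcs D" if "x \<in> S" "x \<noteq> u" for x using uniq[OF that(1)] that(2) D'(2) by auto
    have vv: "(v, v) \<notin> parcs D" using loop D'(2) by blast
    have lt: "ltree (g ` insert v S) (F (insert v S))"
    proof (cases "(u, v) \<in> parcs D")
      case True
      then have "(v, u) \<notin> parcs D" using D'(3) by blast
      then have "parcs D \<inter> insert v S \<times> insert v S = insert (u, v) (parcs D \<inter> S \<times> S)" using True one vv uv(1) by auto
      then have F: "F (insert v S) = insert (g u, [], g v, [True]) (F S \<union> {})" by (simp add: F_def)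
      have "joins (g ` S) (F S) {g v} {} (g u) [] (g v) [True]" unfolding joins_def VF using uv gv by auto
      from ltree.join[OF S'(2) ltree.single this] show ?thesis unfolding F by simp
    next
      case False
      then have "(v, u) \<in> parcs D" using uv(4) D'(2) by blast
      then have "parcs D \<inter> insert v S \<times> insert v S = insert (v, u) (parcs D \<inter> S \<times> S)" using False one vv uv(1) by auto
      then have F: "F (insert v S) = insert (g v, [], g u, [True]) ({} \<union> F S)" by (simp add: F_def)
      have "joins {g v} {} (g ` S) (F S) (g v) [] (g u) [True]" unfolding joins_def VF using uv gv by auto
      from ltree.join[OF ltree.single S'(2) this] show ?thesis unfolding F by simp
    qed
    have pa: "path (insert v S) x y" if xy: "x \<in> insert v S" "y \<in> insert v S" for x y
    proof -
      consider "x \<in> S" "y \<in> S" | "x = v" "y = v" | "x = v" "y \<in> S" | "x \<in> S" "y = v" using xy by blast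
      then show ?thesis
      proof cases
        case 1
        then show ?thesis using S'(3)[of x y] unfolding path_def by blast
      next
        case 2
        then show ?thesis unfolding path_def by (intro exI[of _ "[v]"]) auto
      next
        case 3
        obtain zs where zs: "zs \<noteq> []" "hd zs = u" "last zs = y" "distinct zs" "set zs \<subseteq> S" "successively (\<lambda>a b. (a, b) \<in> parcs G) zs"
          using S'(3)[OF uv(1) 3(2)] unfolding path_def by blast
        have "successively (\<lambda>a b. (a, b) \<in> parcs G) (v # zs)" using zs vu by (cases zs) auto
        then show ?thesis unfolding path_def by (intro exI[of _ "v # zs"]) (use zs 3 uv in auto)
      next
        case 4
        obtain zs where zs: "zs \<noteq> []" "hd zs = x" "last zs = u" "distinct zs" "set zs \<subseteq> S" "successively (\<lambda>a b. (a, b) \<in> parcs G) zs"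
          using S'(3)[OF 4(1) uv(1)] unfolding path_def by blast
        have "successively (\<lambda>a b. (a, b) \<in> parcs G) (zs @ [v])" using zs uv by (simp add: successively_append_iff)
        then show ?thesis unfolding path_def by (intro exI[of _ "zs @ [v]"]) (use zs 4 uv in auto)
      qed
    qed
    show ?thesis unfolding P_def using S'(1) uv(2) lt pa by blast
  qed
  have "pverts G \<noteq> {}" using conn unfolding connected_def strongly_connected_def by simp
  then obtain r where r: "r \<in> pverts G" by blast
  have "parcs D \<inter> {r} \<times> {r} = {}" using loop D'(2) by blast
  then have "ltree (g ` {r}) (F {r})" by (simp add: F_def ltree.single)
  moreover have "path {r} r r" unfolding path_def by (intro exI[of _ "[r]"]) auto
  ultimately have P0: "P {r}" using r by (simp add: P_def)
  have bd: "\<forall>S. P S \<longrightarrow> card S < card (pverts G) + 1" using card_mono[OF pair_finite_verts] by (auto simp: P_def less_Suc_eq_le)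
  obtain S where S: "P S" and mx: "\<And>S'. P S' \<Longrightarrow> card S' \<le> card S"
    using ex_has_greatest_nat[of P "{r}" card, OF P0 bd] by blast
  have sub: "S \<subseteq> pverts G" "S \<noteq> {}" "ltree (g ` S) (F S)" using S by (auto simp: P_def)
  have "S = pverts G"
  proof (rule ccontr)
    assume "S \<noteq> pverts G"
    then have "S \<subset> pverts G" using sub by blast
    then obtain u v where uv: "u \<in> S" "v \<in> pverts G" "v \<notin> S" "(u, v) \<in> parcs G"
      by (rule connected_cut[OF conn sym _ sub(2)]) (rule that)
    have "finite S" using sub(1) pair_finite_verts finite_subset by blast
    then show False using mx[OF grow[OF S uv]] uv(3) by simp
  qed
  moreover have "parcs D \<subseteq> parcs G" using D'(2) by auto
  then have "parcs D \<inter> pverts G \<times> pverts G = parcs D" by (auto dest: in_arcsD1 in_arcsD2)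
  ultimately show ?thesis using sub(3) by (simp add: F_def D'(1))
qed

lemma contains_subdigraphI:
  assumes T: "wf_digraph (with_proj T)" and D: "wf_digraph (with_proj D)"
    and \<phi>: "inj_on \<phi> (pverts D)" "\<phi> ` pverts D \<subseteq> pverts T" "\<And>a b. (a, b) \<in> parcs D \<Longrightarrow> (\<phi> a, \<phi> b) \<in> parcs T"
  shows "contains_subdigraph T D"
proof -
  define H where "H = \<lparr>pverts = \<phi> ` pverts D, parcs = map_prod \<phi> \<phi> ` parcs D\<rparr>"
  have ends: "a \<in> pverts D \<and> b \<in> pverts D" if "(a, b) \<in> parcs D" for a b
    using wf_digraph.tail_in_verts[OF D, of "(a, b)"] wf_digraph.head_in_verts[OF D, of "(a, b)"] that by simp
  have "subgraph (with_proj H) (with_proj T)"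
    unfolding subgraph_def compatible_def wf_digraph_def using \<phi> ends T[unfolded wf_digraph_def] by (auto simp: H_def)
  moreover have "digraph_iso (with_proj D) (with_proj H)"
    unfolding digraph_iso_def
  proof (intro exI conjI)
    let ?i = "\<lparr>iso_verts = \<phi>, iso_arcs = map_prod \<phi> \<phi>, iso_head = snd, iso_tail = fst\<rparr>"
    have "inj_on (map_prod \<phi> \<phi>) (parcs D)"
      by (rule inj_on_subset[OF map_prod_inj_on[OF \<phi>(1) \<phi>(1)]]) (use ends in auto)
    then show "pre_digraph.digraph_isomorphism (with_proj D) ?i"
      unfolding pre_digraph.digraph_isomorphism_def using D \<phi>(1) by simp
    show "with_proj H = app_iso ?i (with_proj D)" by (simp add: app_iso_def with_proj_def H_def)
  qed
  ultimately show ?thesis unfolding contains_subdigraph_def by blast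
qed

theorem mainTheorem6:
  fixes D :: "'a pair_pre_digraph" and n k :: nat
  assumes "oriented_tree D"
    and "card (pverts D) = n"
    and "n \<ge> 2"
    and "card (leaves D) = k"
  shows "unavoidable TYPE('b) (nat (int n + 144 * (int k)\<^sup>2 - 280 * int k + 124)) D"
  unfolding unavoidable_def
proof (intro allI impI)
  fix T :: "'b pair_pre_digraph"
  define m where "m = nat (int n + 144 * (int k)\<^sup>2 - 280 * int k + 124)"
  assume "tournament (nat (int n + 144 * (int k)\<^sup>2 - 280 * int k + 124)) T"
  then obtain K where K: "complete_digraph m (with_proj K)" "orientation T K" unfolding tournament_def m_def by blast
  obtain G where G: "undirected_tree G" "orientation D G" using assms(1) unfolding oriented_tree_def by blast
  interpret G: pair_graph G using G(1) by (simp add: undirected_tree_def)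
  have D: "pverts D = pverts G" "parcs D \<union> (parcs D)\<inverse> = parcs G" using G(2) by (auto simp: orientation_def)
  have T: "pverts T = pverts K" "parcs T \<union> (parcs T)\<inverse> = parcs K" "parcs T \<inter> (parcs T)\<inverse> = {}" using K(2) by (auto simp: orientation_def)
  have K': "graph (with_proj K)" "card (pverts T) = m" "parcs K = {(u, v). (u, v) \<in> pverts T \<times> pverts T \<and> u \<noteq> v}"
    using K(1) unfolding complete_digraph_def by (simp_all add: T(1))
  have fT: "finite (pverts T)" using fin_digraph.finite_verts[of "with_proj K"] K'(1) by (simp add: graph_def digraph_def T(1))
  have wfD: "wf_digraph (with_proj D)" using D G.in_arcsD1 G.in_arcsD2 by unfold_locales fastforce+
  have wfT: "wf_digraph (with_proj T)" using T K'(3) by unfold_locales fastforce+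
  have ends: "a \<in> pverts D \<and> b \<in> pverts D" if "(a, b) \<in> parcs D" for a b
    using wf_digraph.tail_in_verts[OF wfD, of "(a, b)"] wf_digraph.head_in_verts[OF wfD, of "(a, b)"] that by simp
  have fD: "finite (pverts D)" using G.pair_finite_verts D by simp
  \<comment> \<open>Renaming the vertices to natural numbers leaves infinitely many fresh ones for
    the dummies.\<close>
  obtain g :: "'a \<Rightarrow> nat" where g: "inj_on g (pverts D)" using finite_imp_inj_to_nat_seg[OF fD] by blast
  define A where "A = (\<lambda>(a, b). (g a, g b)) ` parcs D"
  have t: "ltree (g ` pverts D) ((\<lambda>(a, b). (g a, [], g b, [True])) ` parcs D)" by (rule ltree_of_tree[OF G g])
  have VA: "VV (g ` pverts D) ((\<lambda>(a, b). (g a, [], g b, [True])) ` parcs D) = g ` pverts D"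
    "AA ((\<lambda>(a, b). (g a, [], g b, [True])) ` parcs D) = A"
    by (auto simp: VV_def AA_def A_def)
  have cV: "card (g ` pverts D) = n" using card_image[OF g] assms(2) by simp
  have gA: "(g a, g b) \<in> A \<longleftrightarrow> (a, b) \<in> parcs D" if "a \<in> pverts D" "b \<in> pverts D" for a b
  proof
    assume "(g a, g b) \<in> A"
    then obtain a' b' where "(a', b') \<in> parcs D" "g a = g a'" "g b = g b'" by (auto simp: A_def)
    then show "(a, b) \<in> parcs D" using that ends[of a' b'] inj_onD[OF g, of a a'] inj_onD[OF g, of b b'] by simp
  qed (auto simp: A_def)
  have AV: "A \<subseteq> g ` pverts D \<times> g ` pverts D" using ends by (auto simp: A_def)
  have nb: "card {u. (u, g v) \<in> A \<or> (g v, u) \<in> A} = card {u. (u, v) \<in> parcs D \<or> (v, u) \<in> parcs D}" if "v \<in> pverts D" for v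
  proof -
    have "{u. (u, g v) \<in> A \<or> (g v, u) \<in> A} = g ` {u. (u, v) \<in> parcs D \<or> (v, u) \<in> parcs D}"
      using AV gA that ends by blast
    moreover have "inj_on g {u. (u, v) \<in> parcs D \<or> (v, u) \<in> parcs D}" by (rule inj_on_subset[OF g]) (use ends in blast)
    ultimately show ?thesis by (simp add: card_image)
  qed
  have "{v\<in>g ` pverts D. card {u. (u, v) \<in> A \<or> (v, u) \<in> A} \<le> 1} = g ` leaves D"
    unfolding leaves_def using nb by auto
  moreover have "inj_on g (leaves D)" by (rule inj_on_subset[OF g]) (auto simp: leaves_def)
  ultimately have cL: "card {v\<in>g ` pverts D. card {u. (u, v) \<in> A \<or> (v, u) \<in> A} \<le> 1} = k"
    using assms(4) by (simp add: card_image)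
  have tT: "(x, y) \<in> parcs T \<longleftrightarrow> (y, x) \<notin> parcs T" if "x \<in> pverts T" "y \<in> pverts T" "x \<noteq> y" for x y
    using that T K'(3) by blast
  obtain R h where h: "rtour R" "med R 0 (int (card (pverts T)))" "inj_on h {0..<int (card (pverts T))}" "h ` {0..<int (card (pverts T))} \<subseteq> pverts T"
    "\<And>x y. x \<in> {0..<int (card (pverts T))} \<Longrightarrow> y \<in> {0..<int (card (pverts T))} \<Longrightarrow> R x y \<Longrightarrow> (h x, h y) \<in> parcs T"
    by (rule ex_median_order[OF fT, where T = "\<lambda>x y. (x, y) \<in> parcs T", OF tT]) (assumption+, rule that)
  obtain f :: "nat \<Rightarrow> int" where "emb R A (g ` pverts D) {0..<int m} f"
    using ltree_emb[OF h(1) t VA cV assms(3) cL m_def h(2)[unfolded K'(2)]] by blast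
  then have f: "inj_on f (g ` pverts D)" "f ` g ` pverts D \<subseteq> {0..<int m}" "\<And>u v. (u, v) \<in> A \<Longrightarrow> R (f u) (f v)"
    unfolding emb_def by auto
  show "contains_subdigraph T D"
  proof (rule contains_subdigraphI[OF wfT wfD, of "h \<circ> f \<circ> g"])
    show "inj_on (h \<circ> f \<circ> g) (pverts D)"
      by (intro comp_inj_on g f(1) inj_on_subset[OF h(3)[unfolded K'(2)] f(2)])
    show "(h \<circ> f \<circ> g) ` pverts D \<subseteq> pverts T" using f(2) h(4)[unfolded K'(2)] by (auto simp: image_subset_iff)
    show "((h \<circ> f \<circ> g) a, (h \<circ> f \<circ> g) b) \<in> parcs T" if ab: "(a, b) \<in> parcs D" for a b
    proof -
      have "(g a, g b) \<in> A" using ab by (auto simp: A_def)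
      then show ?thesis using h(5)[unfolded K'(2), of "f (g a)" "f (g b)"] f(2,3) ends[OF ab] by (auto simp: image_subset_iff)
    qed
  qed
qed

end
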